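(* Let $F$ be a finite extension of $\mathbb{Q}_p$ with ramification index $e$ and residue field $\mathbb{F}_q$, $q=p^f$. Let $0<r<q-1$ and write $r=r_0+r_1p+\dots+r_{f-1}p^{f-1}$ with $0<r_j<p-1$ for all $0\leq j\leq f-1$. When $f=1$, assume moreover $2<r<p-3$. Then a basis of the space of $I(1)$-invariants of \[\pi_r=\frac{\mathrm{ind}_{IZ}^G \chi_r}{(\mathrm{Ker}\,T_{-1,0},\mathrm{Ker}\,T_{1,2})}\] as an $\overline{\mathbb F}_p$-vector space is given by the images in $\pi_r$ of the following sets: (1) $\{[\mathrm{Id},1],[\beta,1]\}$ when $F=\mathbb{Q}_p$; (2) $\mathcal{S}_2\cup\{[\mathrm{Id},1],[\beta,1]\}\cup\mathcal{T}_2$ when $F\neq\mathbb{Q}_p$.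
   Context: $F$ has ring of integers $\mathcal O$, fixed uniformizer $\varpi$; for $x\in\mathbb F_q$, $[x]\in\mathcal O$ is its multiplicative (Teichmüller) representative; $\overline{\mathbb F}_p$ is an algebraic closure of $\mathbb F_p$ containing $\mathbb F_q$, and for $a\in\mathcal O$, $\bar a\in\mathbb F_q$ is its reduction. $G=\mathrm{GL}_2(F)$, $K=\mathrm{GL}_2(\mathcal O)$, $Z$ the centre of $G$, $I\subset K$ the Iwahori subgroup (lower-left entry in $\varpi\mathcal O$), $I(1)\subset I$ the pro-$p$ Iwahori subgroup (elements of $I$ with diagonal entries $\equiv 1 \bmod \varpi$). $\chi_r:IZ\to\overline{\mathbb F}_p^\times$ is the character $\begin{pmatrix} a&b\\ \varpi c&d\end{pmatrix}\mapsto \bar d^{\,r}$, $\mathrm{diag}(\varpi,\varpi)\mapsto 1$. $\mathrm{ind}_{IZ}^G\chi_r$ is the compact induction (compactly supported $\phi:G\to\overline{\mathbb F}_p$ with $\phi(hg)=\chi_r(h)\phi(g)$ for $h\in IZ$, $G$ acting by right translation). For $g\in G$, $[g,1]$ is the element supported on $IZg^{-1}$ with value $1$ at $g^{-1}$; thus $h\cdot[g,1]=[hg,1]$. Let $\beta=\begin{pmatrix}0&1\\ \varpi&0\end{pmatrix}$, $w=\begin{pmatrix}0&1\\1&0\end{pmatrix}$. $T_{-1,0},T_{1,2}$ are the $G$-equivariant endomorphisms of $\mathrm{ind}_{IZ}^G\chi_r$ given by $T_{-1,0}[g,1]=\sum_{\lambda\in I_1}[g\begin{pmatrix}\varpi&\lambda\\0&1\end{pmatrix},1]$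 and $T_{1,2}[g,1]=\sum_{\lambda\in I_1}[g\beta\begin{pmatrix}1&\lambda\\0&1\end{pmatrix}w,1]$; $(\mathrm{Ker}\,T_{-1,0},\mathrm{Ker}\,T_{1,2})$ denotes the subrepresentation $\mathrm{Ker}\,T_{-1,0}+\mathrm{Ker}\,T_{1,2}$. Here $I_0=\{0\}$ and for $n\ge1$, $I_n=\{[\mu_0]+[\mu_1]\varpi+\dots+[\mu_{n-1}]\varpi^{n-1}:\mu_i\in\mathbb F_q\}\subset\mathcal O$; for $\mu\in I_n$, $\mu_i\in\mathbb F_q$ denotes its $i$-th digit and $[\mu]_m=\sum_{i<m}[\mu_i]\varpi^i$. For $n\ge1$ and $0\le k,s\le q-1$ (with $0^0=1$): $s_n^k=\sum_{\mu\in I_n}\mu_{n-1}^k\left[\begin{pmatrix}\varpi^n&\mu\\0&1\end{pmatrix},1\right]$, $t_n^s=\sum_{\mu\in I_n}\mu_{n-1}^s\left[\begin{pmatrix}\varpi^{n-1}&[\mu]_{n-1}\\0&1\end{pmatrix}\begin{pmatrix}1&[\mu_{n-1}]\\0&1\end{pmatrix}w,1\right]$. $\mathcal S_2=\bigcup_{l=0}^{f-1}\big(\{s_n^{q-1-r+p^l}\}_{n\ge2}\cup\{\beta s_n^{q-1-r+p^l}\}_{n\ge2}\big)$ and $\mathcal T_2=\bigcup_{l=0}^{f-1}\big(\{t_n^{r+p^l}\}_{n\ge2}\cup\{\beta t_n^{r+p^l}\}_{n\ge2}\big)$. *)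

theory Defs
  imports "HOL-Computational_Algebra.Primes" "HOL-Library.FuncSet"
begin

text \<open>F is modelled as a field type 'f with a normalized discrete valuation
v : F - {0} -> Z (the value of v at 0 is irrelevant; every use is guarded by x = 0).
"x in varpi^n O" is written inO v n x.\<close>

definition inO :: "('f::field \<Rightarrow> int) \<Rightarrow> int \<Rightarrow> 'f \<Rightarrow> bool" where
  "inO v n x \<longleftrightarrow> x = 0 \<or> v x \<ge> n"

definition Oset :: "('f::field \<Rightarrow> int) \<Rightarrow> 'f set" where
  "Oset v = {x. inO v 0 x}"

text \<open>Data: F is a finite extension of Q_p with ramification index e and residue
field F_q, q = p^f; varpi is a uniformizer; red : O -> Fbar_p is the reduction map
(its image on O is the residue field F_q, viewed inside Fbar_p = 'k).
A field of characteristic 0, complete for a discrete valuation with finite residue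
field of characteristic p, is exactly a finite extension of Q_p; then
e = v(p) and [F:Q_p] = e f.  'k is an algebraic closure of F_p: algebraically
closed, of characteristic p, and algebraic over F_p.\<close>

definition padic_data ::
  "('f::field \<Rightarrow> int) \<Rightarrow> ('f \<Rightarrow> 'k::field) \<Rightarrow> 'f \<Rightarrow> nat \<Rightarrow> nat \<Rightarrow> nat \<Rightarrow> bool" where
  "padic_data v red \<pi> p e f \<longleftrightarrow>
     
     (\<forall>x y. x \<noteq> 0 \<longrightarrow> y \<noteq> 0 \<longrightarrow> v (x * y) = v x + v y) \<and>
     (\<forall>x y. x \<noteq> 0 \<longrightarrow> y \<noteq> 0 \<longrightarrow> x + y \<noteq> 0 \<longrightarrow> v (x + y) \<ge> min (v x) (v y)) \<and>
     \<pi> \<noteq> 0 \<and> v \<pi> = 1 \<and>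
     
     (\<forall>a :: nat \<Rightarrow> 'f.
        (\<forall>N. \<exists>M. \<forall>m\<ge>M. \<forall>n\<ge>M. inO v N (a m - a n)) \<longrightarrow>
        (\<exists>L. \<forall>N. \<exists>M. \<forall>n\<ge>M. inO v N (a n - L))) \<and>
     
     (\<forall>n::nat. n > 0 \<longrightarrow> (of_nat n :: 'f) \<noteq> 0) \<and>
     prime p \<and> e \<ge> 1 \<and> f \<ge> 1 \<and> v (of_nat p) = int e \<and>
     
     red 1 = 1 \<and>
     (\<forall>x\<in>Oset v. \<forall>y\<in>Oset v. red (x + y) = red x + red y \<and> red (x * y) = red x * red y) \<and>
     (\<forall>x\<in>Oset v. red x = 0 \<longleftrightarrow> inO v 1 x) \<and>
     finite (red ` Oset v) \<and> card (red ` Oset v) = p ^ f \<and>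
     
     (of_nat p :: 'k) = 0 \<and>
     (\<forall>n>0. \<forall>c :: nat \<Rightarrow> 'k. \<exists>x. x ^ n + (\<Sum>i<n. c i * x ^ i) = 0) \<and>
     (\<forall>x :: 'k. \<exists>m>0. x ^ (p ^ m) = x)"

definition Fq :: "('f::field \<Rightarrow> int) \<Rightarrow> ('f \<Rightarrow> 'k::field) \<Rightarrow> 'k set" where
  "Fq v red = red ` Oset v"

definition teich :: "('f::field \<Rightarrow> int) \<Rightarrow> ('f \<Rightarrow> 'k::field) \<Rightarrow> nat \<Rightarrow> 'k \<Rightarrow> 'f" where
  "teich v red q x = (THE y. inO v 0 y \<and> red y = x \<and> y ^ q = y)"

type_synonym 'f m2 = "'f \<times> 'f \<times> 'f \<times> 'f"  

definition ea :: "'f m2 \<Rightarrow> 'f" where "ea g = (case g of (a,b,c,d) \<Rightarrow> a)"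
definition eb :: "'f m2 \<Rightarrow> 'f" where "eb g = (case g of (a,b,c,d) \<Rightarrow> b)"
definition ec :: "'f m2 \<Rightarrow> 'f" where "ec g = (case g of (a,b,c,d) \<Rightarrow> c)"
definition ed :: "'f m2 \<Rightarrow> 'f" where "ed g = (case g of (a,b,c,d) \<Rightarrow> d)"

definition mmul :: "'f::field m2 \<Rightarrow> 'f m2 \<Rightarrow> 'f m2" where
  "mmul X Y = (ea X * ea Y + eb X * ec Y, ea X * eb Y + eb X * ed Y,
               ec X * ea Y + ed X * ec Y, ec X * eb Y + ed X * ed Y)"

definition mdet :: "'f::field m2 \<Rightarrow> 'f" where
  "mdet X = ea X * ed X - eb X * ec X"

definition minv :: "'f::field m2 \<Rightarrow> 'f m2" where
  "minv X = (ed X / mdet X, - eb X / mdet X, - ec X / mdet X, ea X / mdet X)"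

definition GL2 :: "'f::field m2 set" where
  "GL2 = {g. mdet g \<noteq> 0}"

definition Kgrp :: "('f::field \<Rightarrow> int) \<Rightarrow> 'f m2 set" where
  "Kgrp v = {g. inO v 0 (ea g) \<and> inO v 0 (eb g) \<and> inO v 0 (ec g) \<and> inO v 0 (ed g)
              \<and> mdet g \<noteq> 0 \<and> v (mdet g) = 0}"

definition Iwa :: "('f::field \<Rightarrow> int) \<Rightarrow> 'f m2 set" where
  "Iwa v = {g\<in>Kgrp v. inO v 1 (ec g)}"

definition Iwa1 :: "('f::field \<Rightarrow> int) \<Rightarrow> 'f m2 set" where
  "Iwa1 v = {g\<in>Iwa v. inO v 1 (ea g - 1) \<and> inO v 1 (ed g - 1)}"

definition IZ :: "('f::field \<Rightarrow> int) \<Rightarrow> 'f m2 set" where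
  "IZ v = {mmul (z, 0, 0, z) k | z k. z \<noteq> 0 \<and> k \<in> Iwa v}"

text \<open>chi_r on IZ: for h = varpi^m u k (u unit scalar, k in I), d(h) = varpi^m u d(k),
so chi_r(h) = red(u d(k))^r = red(d(h)/varpi^{v(d(h))})^r.\<close>
definition chi :: "('f::field \<Rightarrow> int) \<Rightarrow> ('f \<Rightarrow> 'k::field) \<Rightarrow> 'f \<Rightarrow> nat \<Rightarrow> 'f m2 \<Rightarrow> 'k" where
  "chi v red \<pi> r h = red (ed h / power_int \<pi> (v (ed h))) ^ r"

definition IZcoset :: "('f::field \<Rightarrow> int) \<Rightarrow> 'f m2 \<Rightarrow> 'f m2 set" where
  "IZcoset v x = (\<lambda>h. mmul h x) ` IZ v"

definition supp_cosets :: "('f::field \<Rightarrow> int) \<Rightarrow> ('f m2 \<Rightarrow> 'k::zero) \<Rightarrow> 'f m2 set set" where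
  "supp_cosets v \<phi> = {IZcoset v x | x. x \<in> GL2 \<and> \<phi> x \<noteq> 0}"

text \<open>ind_{IZ}^G chi_r: functions on G (extended by 0 off G), left (IZ,chi_r)-equivariant,
supported on finitely many cosets IZ g (compact support modulo IZ).\<close>
definition indG :: "('f::field \<Rightarrow> int) \<Rightarrow> ('f \<Rightarrow> 'k::field) \<Rightarrow> 'f \<Rightarrow> nat \<Rightarrow> ('f m2 \<Rightarrow> 'k) set" where
  "indG v red \<pi> r = {\<phi>. (\<forall>x. x \<notin> GL2 \<longrightarrow> \<phi> x = 0) \<and>
      (\<forall>h\<in>IZ v. \<forall>x\<in>GL2. \<phi> (mmul h x) = chi v red \<pi> r h * \<phi> x) \<and>
      finite (supp_cosets v \<phi>)}"

definition act :: "'f::field m2 \<Rightarrow> ('f m2 \<Rightarrow> 'k) \<Rightarrow> ('f m2 \<Rightarrow> 'k)" where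
  "act g \<phi> = (\<lambda>x. \<phi> (mmul x g))"

definition br :: "('f::field \<Rightarrow> int) \<Rightarrow> ('f \<Rightarrow> 'k::field) \<Rightarrow> 'f \<Rightarrow> nat \<Rightarrow> 'f m2 \<Rightarrow> ('f m2 \<Rightarrow> 'k)" where
  "br v red \<pi> r g = (\<lambda>x. if x \<in> GL2 \<and> mmul x g \<in> IZ v then chi v red \<pi> r (mmul x g) else 0)"

definition Idm :: "'f::field m2" where "Idm = (1, 0, 0, 1)"
definition betam :: "'f::field \<Rightarrow> 'f m2" where "betam \<pi> = (0, 1, \<pi>, 0)"
definition wm :: "'f::field m2" where "wm = (0, 1, 1, 0)"

definition digs :: "('f::field \<Rightarrow> int) \<Rightarrow> ('f \<Rightarrow> 'k::field) \<Rightarrow> nat \<Rightarrow> (nat \<Rightarrow> 'k) set" where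
  "digs v red n = PiE {..<n} (\<lambda>_. Fq v red)"

definition dsum :: "('f::field \<Rightarrow> int) \<Rightarrow> ('f \<Rightarrow> 'k::field) \<Rightarrow> nat \<Rightarrow> 'f \<Rightarrow> nat \<Rightarrow> (nat \<Rightarrow> 'k) \<Rightarrow> 'f" where
  "dsum v red q \<pi> m \<mu> = (\<Sum>i<m. teich v red q (\<mu> i) * \<pi> ^ i)"

definition I1set :: "('f::field \<Rightarrow> int) \<Rightarrow> ('f \<Rightarrow> 'k::field) \<Rightarrow> nat \<Rightarrow> 'f set" where
  "I1set v red q = teich v red q ` Fq v red"

text \<open>A G-equivariant operator with T[g,1] = sum_{lam in I_1} [g M(lam), 1], extended
linearly: phi = sum over support cosets IZ x of phi(x) [x^{-1},1]
(each summand independent of the representative x).\<close>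
definition hecke :: "('f::field \<Rightarrow> int) \<Rightarrow> ('f \<Rightarrow> 'k::field) \<Rightarrow> 'f \<Rightarrow> nat \<Rightarrow> nat
     \<Rightarrow> ('f \<Rightarrow> 'f m2) \<Rightarrow> ('f m2 \<Rightarrow> 'k) \<Rightarrow> ('f m2 \<Rightarrow> 'k)" where
  "hecke v red \<pi> r q M \<phi> = (\<lambda>y. \<Sum>C\<in>supp_cosets v \<phi>.
      (let x = (SOME x. x \<in> C) in
        \<phi> x * (\<Sum>lam\<in>I1set v red q. br v red \<pi> r (mmul (minv x) (M lam)) y)))"

definition Tm10 where
  "Tm10 v red \<pi> r q = hecke v red \<pi> r q (\<lambda>lam. (\<pi>, lam, 0, 1))"

definition T12 where
  "T12 v red \<pi> r q = hecke v red \<pi> r q (\<lambda>lam. mmul (mmul (betam \<pi>) (1, lam, 0, 1)) wm)"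

definition Wsub :: "('f::field \<Rightarrow> int) \<Rightarrow> ('f \<Rightarrow> 'k::field) \<Rightarrow> 'f \<Rightarrow> nat \<Rightarrow> nat \<Rightarrow> ('f m2 \<Rightarrow> 'k) set" where
  "Wsub v red \<pi> r q = {(\<lambda>x. \<phi>1 x + \<phi>2 x) | \<phi>1 \<phi>2.
      \<phi>1 \<in> indG v red \<pi> r \<and> Tm10 v red \<pi> r q \<phi>1 = (\<lambda>_. 0) \<and>
      \<phi>2 \<in> indG v red \<pi> r \<and> T12 v red \<pi> r q \<phi>2 = (\<lambda>_. 0)}"

text \<open>phi in ind represents an I(1)-invariant vector of pi_r = ind / W.\<close>
definition inv_mod :: "('f::field \<Rightarrow> int) \<Rightarrow> ('f \<Rightarrow> 'k::field) \<Rightarrow> 'f \<Rightarrow> nat \<Rightarrow> nat \<Rightarrow> ('f m2 \<Rightarrow> 'k) \<Rightarrow> bool" where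
  "inv_mod v red \<pi> r q \<phi> \<longleftrightarrow> \<phi> \<in> indG v red \<pi> r \<and>
      (\<forall>k\<in>Iwa1 v. (\<lambda>x. act k \<phi> x - \<phi> x) \<in> Wsub v red \<pi> r q)"

definition sfun where
  "sfun v red \<pi> r q n k = (\<lambda>y. \<Sum>\<mu>\<in>digs v red n.
      \<mu> (n - 1) ^ k * br v red \<pi> r (\<pi> ^ n, dsum v red q \<pi> n \<mu>, 0, 1) y)"

definition tfun where
  "tfun v red \<pi> r q n s = (\<lambda>y. \<Sum>\<mu>\<in>digs v red n.
      \<mu> (n - 1) ^ s * br v red \<pi> r
        (mmul (mmul (\<pi> ^ (n - 1), dsum v red q \<pi> (n - 1) \<mu>, 0, 1)
                    (1, teich v red q (\<mu> (n - 1)), 0, 1)) wm) y)"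

datatype bidx = BId | BBeta | BS nat nat | BBS nat nat | BT nat nat | BBT nat nat

text \<open>Index set of the claimed basis: case (1) F = Q_p (e = f = 1), case (2) otherwise.
BS n l = s_n^{q-1-r+p^l}, BBS n l = beta s_n^{...}, BT n l = t_n^{r+p^l}, BBT n l = beta t_n^{...}.\<close>
definition bindex :: "nat \<Rightarrow> nat \<Rightarrow> bidx set" where
  "bindex e f = (if e = 1 \<and> f = 1 then {BId, BBeta}
     else {BId, BBeta} \<union> {BS n l | n l. n \<ge> 2 \<and> l < f} \<union> {BBS n l | n l. n \<ge> 2 \<and> l < f}
          \<union> {BT n l | n l. n \<ge> 2 \<and> l < f} \<union> {BBT n l | n l. n \<ge> 2 \<and> l < f})"

fun belem :: "('f::field \<Rightarrow> int) \<Rightarrow> ('f \<Rightarrow> 'k::field) \<Rightarrow> 'f \<Rightarrow> nat \<Rightarrow> nat \<Rightarrow> nat \<Rightarrow> bidx \<Rightarrow> ('f m2 \<Rightarrow> 'k)" where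
  "belem v red \<pi> r p q BId = br v red \<pi> r Idm"
| "belem v red \<pi> r p q BBeta = br v red \<pi> r (betam \<pi>)"
| "belem v red \<pi> r p q (BS n l) = sfun v red \<pi> r q n (q - 1 - r + p ^ l)"
| "belem v red \<pi> r p q (BBS n l) = act (betam \<pi>) (sfun v red \<pi> r q n (q - 1 - r + p ^ l))"
| "belem v red \<pi> r p q (BT n l) = tfun v red \<pi> r q n (r + p ^ l)"
| "belem v red \<pi> r p q (BBT n l) = act (betam \<pi>) (tfun v red \<pi> r q n (r + p ^ l))"

end

theory Submission
  imports Defs "HOL-Computational_Algebra.Polynomial"
begin

text \<open>The vectors [g,1] are indexed by the oriented edges of the tree; every edge is
beta^s (pi^n, x; 0, 1) beta^t with x in O modulo pi^n, so an element of the induction is a family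
of coordinates on O / pi^n, and on edges T_{-1,0} and T_{1,2} become explicit difference equations.
An element of level at most N in Ker T_{-1,0} + Ker T_{1,2} splits into two kernel elements of level
at most N, so that the convolution H of its top coordinates with a power character depends only on
x modulo pi^(N-1); conversely, if H has this property, the top coordinates can be removed modulo the
kernels. For an invariant vector, translations force H to be affine and additive in the last digit,
that is, a combination of the Frobenius powers u^(p^l), and these are exactly what s_N and t_N
contribute. At level 1 the additive part vanishes because the two halves of the tree share the edges
of level 0, and for F = Q_p it vanishes by a count of carries: the sum over a in F_p of
[a] + [b] - [a + b] is p [b], which is not divisible by p^2 unless b = 0.\<close>

section \<open>Valuation and residue field\<close>

text \<open>One kind of kernel equation compares a coordinate with a weighted sum over the
  \<open>q\<close> edges that differ in the last digit; the weights are values of chi_r on elements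
  of IZ and come out as \<open>m ^ r\<close> for T_{1,2} and \<open>(- m) ^ (q - 1 - r)\<close> for
  T_{-1,0}. Convolving \<open>m ^ (q - 1 - R + p ^ l)\<close> with a weight of exponent R leaves, of
  all power sums over F_q, only the one of exponent \<open>q - 1\<close>: the result is a multiple
  of \<open>u ^ (p ^ l)\<close> by \<open>R choose p ^ l\<close>, which modulo \<open>p\<close> is
  the digit of R at place \<open>l\<close>. It is nonzero for R = r and R = q - 1 - r alike because
  0 < r_j < p - 1; hence the exponents in S_2 and T_2. The delicate point is their invariance when F
  is not Q_p. An element of I(1) changes the last digit by an amount depending on the earlier
  digits: a carry plus a polynomial of degree at most 2 in the digit before. The difference of s_n
  or t_n and its translate can be pushed one level down modulo the kernels, and there the next
  convolution must vanish. The hypotheses on \<open>r\<close> keep the relevant degrees below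
  \<open>q - 1\<close>, so it does. Two levels are used up, whence n >= 2.\<close>

locale padic =
  fixes v :: "'f::field \<Rightarrow> int" and red :: "'f \<Rightarrow> 'k::field" and \<pi> :: 'f
    and p e f r :: nat
  assumes data: "padic_data v red \<pi> p e f"
    and r_pos: "0 < r" and r_lt: "r < p ^ f - 1"
    and digits: "\<forall>j<f. 0 < r div p ^ j mod p \<and> r div p ^ j mod p < p - 1"
    and f1: "f = 1 \<longrightarrow> 2 < r \<and> r < p - 3"
begin

abbreviation "q \<equiv> p ^ f"
abbreviation "FF \<equiv> Fq v red"
abbreviation "tc \<equiv> teich v red q"
abbreviation "inn \<equiv> inO v"

section \<open>Arithmetic of the valuation and of congruences modulo powers of the
  uniformizer\<close>

lemma v_mult: "x \<noteq> 0 \<Longrightarrow> y \<noteq> 0 \<Longrightarrow> v (x * y) = v x + v y"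
  and v_add: "x \<noteq> 0 \<Longrightarrow> y \<noteq> 0 \<Longrightarrow> x + y \<noteq> 0 \<Longrightarrow> v (x + y) \<ge> min (v x) (v y)"
  and pi_nz [simp]: "\<pi> \<noteq> 0" and v_pi [simp]: "v \<pi> = 1"
  using data unfolding padic_data_def by simp_all

lemma complete:
  fixes a :: "nat \<Rightarrow> 'f"
  shows "(\<forall>N. \<exists>M. \<forall>m\<ge>M. \<forall>n\<ge>M. inn N (a m - a n)) \<Longrightarrow> (\<exists>L. \<forall>N. \<exists>M. \<forall>n\<ge>M. inn N (a n - L))"
proof -
  have "\<forall>a :: nat \<Rightarrow> 'f. (\<forall>N. \<exists>M. \<forall>m\<ge>M. \<forall>n\<ge>M. inn N (a m - a n)) \<longrightarrow> (\<exists>L. \<forall>N. \<exists>M. \<forall>n\<ge>M. inn N (a n - L))"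
    using data unfolding padic_data_def by (elim conjE) assumption
  then show "(\<forall>N. \<exists>M. \<forall>m\<ge>M. \<forall>n\<ge>M. inn N (a m - a n)) \<Longrightarrow> (\<exists>L. \<forall>N. \<exists>M. \<forall>n\<ge>M. inn N (a n - L))"
    by blast
qed

lemma prime_p: "prime p" and e_ge: "e \<ge> 1" and f_ge: "f \<ge> 1" and v_p: "v (of_nat p) = int e"
  and red_1 [simp]: "red 1 = 1"
  using data unfolding padic_data_def by simp_all

lemma char0: "n > 0 \<Longrightarrow> (of_nat n :: 'f) \<noteq> 0"
proof -
  have "\<forall>n::nat. n > 0 \<longrightarrow> (of_nat n :: 'f) \<noteq> 0"
    using data unfolding padic_data_def by (elim conjE) assumption
  then show "n > 0 \<Longrightarrow> (of_nat n :: 'f) \<noteq> 0" by blast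
qed

lemma red_add: "inn 0 x \<Longrightarrow> inn 0 y \<Longrightarrow> red (x + y) = red x + red y"
  and red_mult: "inn 0 x \<Longrightarrow> inn 0 y \<Longrightarrow> red (x * y) = red x * red y"
  and red_0_iff: "inn 0 x \<Longrightarrow> red x = 0 \<longleftrightarrow> inn 1 x"
  using data unfolding padic_data_def Oset_def by simp_all

lemma fin_FF [simp]: "finite FF" and card_FF: "card FF = q"
  and char_k: "(of_nat p :: 'k) = 0"
  using data unfolding padic_data_def Fq_def by simp_all

declare One_nat_def [simp del]

lemma v_1 [simp]: "v 1 = 0"
  using v_mult[of 1 1] by simp

lemma v_neg [simp]: "v (- x) = v x"
proof (cases "x = 0")
  case False
  have "v (-1) + v (-1) = 0" using v_mult[of "-1" "-1"] by simp
  then show ?thesis using v_mult[of "-1" x] False by simp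
qed simp

lemma v_inverse: "x \<noteq> 0 \<Longrightarrow> v (inverse x) = - v x"
  using v_mult[of x "inverse x"] by simp

lemma v_divide: "x \<noteq> 0 \<Longrightarrow> y \<noteq> 0 \<Longrightarrow> v (x / y) = v x - v y"
  by (simp add: divide_inverse v_mult v_inverse)

lemma v_power: "x \<noteq> 0 \<Longrightarrow> v (x ^ n) = int n * v x"
  by (induction n) (auto simp: v_mult algebra_simps)

lemma v_pi_power [simp]: "v (\<pi> ^ n) = int n"
  by (simp add: v_power)

lemma v_pi_powi [simp]: "v (power_int \<pi> k) = k"
  by (cases "k \<ge> 0") (auto simp: power_int_def v_inverse v_power)

lemma inn_0 [simp]: "inn n 0" by (simp add: inO_def)

lemma inn_1 [simp]: "inn 0 1" by (simp add: inO_def)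

lemma inn_neg [simp]: "inn n (- x) = inn n x" by (simp add: inO_def)

lemma inn_add: "inn n x \<Longrightarrow> inn n y \<Longrightarrow> inn n (x + y)"
  unfolding inO_def using v_add[of x y] by (smt (verit) add.left_neutral add.right_neutral)

lemma inn_diff: "inn n x \<Longrightarrow> inn n y \<Longrightarrow> inn n (x - y)"
  using inn_add[of n x "- y"] by simp

lemma inn_sum: "(\<And>i. i \<in> A \<Longrightarrow> inn n (g i)) \<Longrightarrow> inn n (sum g A)"
  by (induction A rule: infinite_finite_induct) (auto intro: inn_add)

lemma inn_mono: "inn n x \<Longrightarrow> m \<le> n \<Longrightarrow> inn m x"
  by (auto simp: inO_def)

lemma inn_mult: "inn n x \<Longrightarrow> inn m y \<Longrightarrow> inn (n + m) (x * y)"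
  by (cases "x = 0"; cases "y = 0"; simp add: inO_def v_mult)

lemma inn_mult0: "inn 0 x \<Longrightarrow> inn 0 y \<Longrightarrow> inn 0 (x * y)"
  using inn_mult[of 0 x 0 y] by simp

lemma inn_mult_left: "inn 0 x \<Longrightarrow> inn n y \<Longrightarrow> inn n (x * y)"
  using inn_mult[of 0 x n y] by simp

lemma inn_mult_right: "inn n x \<Longrightarrow> inn 0 y \<Longrightarrow> inn n (x * y)"
  using inn_mult[of n x 0 y] by simp

lemma inn_power: "inn 0 x \<Longrightarrow> inn 0 (x ^ n)"
  by (induction n) (auto intro: inn_mult0)

lemma inn_of_nat [simp]: "inn 0 (of_nat n)"
  by (induction n) (auto intro: inn_add)

lemma inn_pi_power [simp]: "m \<le> int n \<Longrightarrow> inn m (\<pi> ^ n)"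
  by (simp add: inO_def)

lemma inn_pi [simp]: "m \<le> 1 \<Longrightarrow> inn m \<pi>"
  by (simp add: inO_def)

lemma inn_mult_pi_iff [simp]: "inn m (\<pi> ^ n * x) \<longleftrightarrow> inn (m - int n) x"
  by (cases "x = 0"; auto simp: inO_def v_mult)

lemma inn_mult_pi_iff' [simp]: "inn m (x * \<pi> ^ n) \<longleftrightarrow> inn (m - int n) x"
  by (cases "x = 0"; auto simp: inO_def v_mult)

lemma inn_mult_pi1_iff [simp]: "inn m (\<pi> * x) \<longleftrightarrow> inn (m - 1) x"
  by (cases "x = 0"; auto simp: inO_def v_mult)

lemma inn_mult_pi1_iff' [simp]: "inn m (x * \<pi>) \<longleftrightarrow> inn (m - 1) x"
  by (cases "x = 0"; auto simp: inO_def v_mult)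

lemma inn_mult_iff: "y \<noteq> 0 \<Longrightarrow> inn m (x * y) \<longleftrightarrow> inn (m - v y) x"
  by (cases "x = 0"; auto simp: inO_def v_mult)

lemma inn_div_iff: "y \<noteq> 0 \<Longrightarrow> inn m (x / y) \<longleftrightarrow> inn (m + v y) x"
  by (cases "x = 0"; auto simp: inO_def v_divide)

lemma inn_cancel: "inn n x \<Longrightarrow> inn n (x + y) \<longleftrightarrow> inn n y"
  using inn_add[of n x y] inn_diff[of n "x + y" x] by auto

lemma inn_trans: "inn n (x - y) \<Longrightarrow> inn n (y - z) \<Longrightarrow> inn n (x - z)"
  using inn_add[of n "x - y" "y - z"] by simp

lemma inn_sym: "inn n (x - y) \<Longrightarrow> inn n (y - x)"
  using inn_neg[of n "x - y"] by simp

lemma inn_all_0: "(\<And>n. inn n x) \<Longrightarrow> x = 0"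
  unfolding inO_def using zless_add1_eq[of "v x" "v x"] by (metis add_le_same_cancel1 not_one_le_zero)

lemma unit_1: "inn 1 (x - 1) \<Longrightarrow> x \<noteq> 0 \<and> v x = 0"
proof -
  assume a: "inn 1 (x - 1)"
  have nz: "x \<noteq> 0" using a by (auto simp: inO_def)
  have "inn 0 x" using a inn_add[of 0 "x - 1" 1] inn_mono[of 1 "x - 1" 0] by simp
  moreover have "\<not> inn 1 x"
  proof
    assume "inn 1 x"
    then have "inn 1 (1::'f)" using inn_diff[of 1 x "x - 1"] a by simp
    then show False by (simp add: inO_def)
  qed
  ultimately show ?thesis using nz by (auto simp: inO_def)
qed

section \<open>The reduction map and the residue field inside \<open>'k\<close>\<close>

lemma red_0 [simp]: "red 0 = 0"
  using red_0_iff[of 0] by simp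

lemma red_neg: "inn 0 x \<Longrightarrow> red (- x) = - red x"
  using red_add[of x "- x"] by (simp add: eq_neg_iff_add_eq_0 add.commute)

lemma red_diff: "inn 0 x \<Longrightarrow> inn 0 y \<Longrightarrow> red (x - y) = red x - red y"
  using red_add[of x "- y"] by (simp add: red_neg)

lemma red_eq_iff: "inn 0 x \<Longrightarrow> inn 0 y \<Longrightarrow> red x = red y \<longleftrightarrow> inn 1 (x - y)"
  using red_0_iff[of "x - y"] red_diff[of x y] inn_diff[of 0 x y] by auto

lemma red_power: "inn 0 x \<Longrightarrow> red (x ^ n) = red x ^ n"
  by (induction n) (auto simp: red_mult inn_power)

lemma red_sum: "(\<And>i. i \<in> A \<Longrightarrow> inn 0 (g i)) \<Longrightarrow> red (sum g A) = (\<Sum>i\<in>A. red (g i))"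
  by (induction A rule: infinite_finite_induct) (auto simp: red_add inn_sum)

lemma red_of_nat: "red (of_nat n) = of_nat n"
  by (induction n) (auto simp: red_add)

lemma red_inverse: "x \<noteq> 0 \<Longrightarrow> v x = 0 \<Longrightarrow> red (inverse x) = inverse (red x)"
proof -
  assume a: "x \<noteq> 0" "v x = 0"
  have "red x * red (inverse x) = 1"
    using red_mult[of x "inverse x"] a by (simp add: inO_def v_inverse)
  then show ?thesis by (metis inverse_unique)
qed

lemma red_in_FF [simp]: "inn 0 x \<Longrightarrow> red x \<in> FF"
  by (auto simp: Fq_def Oset_def)

lemma FF_E: assumes "a \<in> FF" obtains x where "inn 0 x" "red x = a"
  using assms by (auto simp: Fq_def Oset_def)

lemma FF_0 [simp]: "0 \<in> FF" and FF_1 [simp]: "1 \<in> FF"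
  using red_in_FF[of 0] red_in_FF[of 1] by auto

lemma FF_add [simp]: "a \<in> FF \<Longrightarrow> b \<in> FF \<Longrightarrow> a + b \<in> FF"
  by (elim FF_E) (metis inn_add red_add red_in_FF)

lemma FF_mult [simp]: "a \<in> FF \<Longrightarrow> b \<in> FF \<Longrightarrow> a * b \<in> FF"
  by (elim FF_E) (metis inn_mult0 red_mult red_in_FF)

lemma FF_neg [simp]: "a \<in> FF \<Longrightarrow> - a \<in> FF"
  by (elim FF_E) (metis inn_neg red_neg red_in_FF)

lemma FF_diff [simp]: "a \<in> FF \<Longrightarrow> b \<in> FF \<Longrightarrow> a - b \<in> FF"
  using FF_add[of a "- b"] by simp

lemma FF_power [simp]: "a \<in> FF \<Longrightarrow> a ^ n \<in> FF"
  by (induction n) auto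

lemma FF_inverse [simp]: "a \<in> FF \<Longrightarrow> inverse a \<in> FF"
proof (cases "a = 0")
  case False
  assume "a \<in> FF"
  then obtain x where x: "inn 0 x" "red x = a" by (rule FF_E)
  then have "x \<noteq> 0" "v x = 0" using False red_0_iff[of x] by (auto simp: inO_def)
  then show ?thesis using x red_inverse[of x] red_in_FF[of "inverse x"] by (auto simp: inO_def v_inverse)
qed simp

text \<open>Multiplication by \<open>a\<close> permutes the nonzero residues, so their product is
  unchanged by the factor \<open>a ^ (q - 1)\<close>.\<close>

lemma FF_fermat1: assumes "a \<in> FF" "a \<noteq> 0" shows "a ^ (q - 1) = 1"
proof -
  let ?S = "FF - {0}"
  have bij: "bij_betw (\<lambda>x. a * x) ?S ?S"
    using assms by (intro bij_betwI[where g = "\<lambda>x. inverse a * x"]) auto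
  have "prod (\<lambda>x. x) ?S = prod (\<lambda>x. a * x) ?S"
    using prod.reindex_bij_betw[OF bij, of "\<lambda>x. x"] by simp
  also have "\<dots> = a ^ card ?S * prod (\<lambda>x. x) ?S" by (simp add: prod.distrib)
  finally have "a ^ card ?S = 1" by simp
  then show ?thesis by (simp add: card_FF)
qed

text \<open>A digit strictly between 0 and \<open>p - 1\<close> leaves no room for
  \<open>p = 2\<close>.\<close>

lemma p_ge3: "p \<ge> 3"
  using digits[rule_format, of 0] f_ge by auto

lemma p_pos [simp]: "0 < p" "p \<noteq> 0"
  using p_ge3 by auto

lemma q_ge: "q \<ge> 3"
  using p_ge3 f_ge by (metis One_nat_def le_trans power_increasing power_one_right Suc_le_eq zero_less_numeral less_le_trans)

lemma FF_fermat: "a \<in> FF \<Longrightarrow> a ^ q = a"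
  using FF_fermat1[of a] power_minus_mult[of q a] q_ge by (cases "a = 0") auto

lemma FF_power_red: "a \<in> FF \<Longrightarrow> n > 0 \<Longrightarrow> a ^ (n + (q - 1)) = a ^ n"
  using FF_fermat1[of a] by (cases "a = 0") (auto simp: power_add)

lemma odd_p: "odd p"
  using prime_p p_ge3 prime_odd_nat[of p] by auto

section \<open>Frobenius, polynomial functions and power sums on F_q\<close>

lemma CHAR_k: "CHAR('k) = p"
  using char_k prime_p by (metis CHAR_eq_posI One_nat_def CHAR_not_1 of_nat_eq_0_iff_char_dvd prime_nat_iff)

lemma frob: "(x + y :: 'k) ^ (p ^ n) = x ^ (p ^ n) + y ^ (p ^ n)"
  using freshmans_dream'[of "p ^ n" n x y] prime_p by (simp add: CHAR_k)

lemma frob_diff: "(x - y :: 'k) ^ (p ^ n) = x ^ (p ^ n) - y ^ (p ^ n)"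
  using frob[of x "-y" n] odd_p by simp

lemma frob_sum: "(sum g A :: 'k) ^ (p ^ n) = (\<Sum>i\<in>A. g i ^ (p ^ n))"
  using freshmans_dream_sum'[of "p ^ n" n g A] prime_p by (simp add: CHAR_k)

lemma of_nat_k_0_iff: "(of_nat n :: 'k) = 0 \<longleftrightarrow> p dvd n"
  by (simp add: of_nat_eq_0_iff_char_dvd CHAR_k)

lemma of_nat_q: "(of_nat q :: 'k) = 0"
  using f_ge by (simp add: of_nat_k_0_iff dvd_power)

lemma FF_shift: "a \<in> FF \<Longrightarrow> (\<Sum>m\<in>FF. g (m + a)) = sum g FF"
  by (intro sum.reindex_bij_betw bij_betwI[where g = "\<lambda>x. x - a"]) auto

lemma FF_scale: "a \<in> FF \<Longrightarrow> a \<noteq> 0 \<Longrightarrow> (\<Sum>m\<in>FF. g (a * m)) = sum g FF"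
  by (intro sum.reindex_bij_betw bij_betwI[where g = "\<lambda>x. inverse a * x"]) auto

text \<open>A nonzero polynomial of degree below \<open>q\<close> cannot have all \<open>q\<close>
  elements of \<open>FF\<close> as roots; this is the tool for every later comparison of
  coefficients.\<close>

lemma poly_FF_0:
  assumes "\<And>u. u \<in> FF \<Longrightarrow> (\<Sum>j<q. c j * u ^ j) = (0::'k)" "j < q"
  shows "c j = 0"
proof -
  define P where "P = (\<Sum>j<q. monom (c j) j)"
  have deg: "degree P < q"
    unfolding P_def using q_ge by (intro degree_lessI) (auto simp: coeff_sum)
  have "P = 0"
  proof (rule ccontr)
    assume nz: "P \<noteq> 0"
    have "FF \<subseteq> {x. poly P x = 0}"
      using assms(1) by (auto simp: P_def poly_sum poly_monom)
    then have "card FF \<le> card {x. poly P x = 0}"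
      by (intro card_mono poly_roots_finite nz)
    also have "\<dots> \<le> degree P" using nz by (rule card_poly_roots_bound)
    finally show False using deg card_FF by simp
  qed
  then have "coeff P j = 0" by simp
  moreover have "coeff P j = (\<Sum>i<q. if i = j then c i else 0)"
    by (simp add: P_def coeff_sum)
  ultimately show ?thesis using assms(2) by simp
qed

lemma FF_nonroot: assumes "0 < j" "j < q - 1" obtains a where "a \<in> FF" "a \<noteq> 0" "a ^ j \<noteq> 1"
proof (rule ccontr)
  assume "\<not> thesis"
  then have H: "\<And>a. a \<in> FF \<Longrightarrow> a \<noteq> 0 \<Longrightarrow> a ^ j = 1" using that by blast
  \<comment> \<open>Coefficients of \<open>u ^ Suc j - u\<close>, which would vanish on all of
    \<open>FF\<close>; the extra factor \<open>u\<close> takes care of \<open>u = 0\<close>.\<close>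
  define c :: "nat \<Rightarrow> 'k" where "c = (\<lambda>i. if i = Suc j then 1 else if i = 1 then -1 else 0)"
  have "(\<Sum>i<q. c i * u ^ i) = 0" if "u \<in> FF" for u
  proof -
    have "(\<Sum>i<q. c i * u ^ i) = (\<Sum>i\<in>{1, Suc j}. c i * u ^ i)"
      using assms by (intro sum.mono_neutral_right) (auto simp: c_def)
    also have "\<dots> = u ^ Suc j - u" using assms by (simp add: c_def)
    also have "\<dots> = 0" using H[OF that] by (cases "u = 0") auto
    finally show ?thesis .
  qed
  from poly_FF_0[OF this, of "Suc j"] assms show False by (simp add: c_def less_diff_conv)
qed

text \<open>Scaling by an \<open>a\<close> with \<open>a ^ j\<close> different from 1 multiplies the
  sum by \<open>a ^ j\<close>. For \<open>j = 0\<close> the sum is \<open>q\<close>, which is 0 in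
  \<open>'k\<close>.\<close>

lemma power_sum_small: assumes "j < q - 1" shows "(\<Sum>m\<in>FF. m ^ j) = (0::'k)"
proof (cases "j = 0")
  case True
  then show ?thesis by (simp add: card_FF of_nat_q del: of_nat_power)
next
  case False
  then obtain a where a: "a \<in> FF" "a \<noteq> 0" "a ^ j \<noteq> 1" using FF_nonroot assms by blast
  have "(\<Sum>m\<in>FF. m ^ j) = (\<Sum>m\<in>FF. (a * m) ^ j)" using FF_scale[OF a(1,2), of "\<lambda>m. m ^ j"] by simp
  also have "\<dots> = a ^ j * (\<Sum>m\<in>FF. m ^ j)" by (simp add: power_mult_distrib sum_distrib_left)
  finally show ?thesis using a(3) by simp
qed

lemma power_sum_top: "(\<Sum>m\<in>FF. m ^ (q - 1)) = (-1::'k)"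
proof -
  have "(\<Sum>m\<in>FF. m ^ (q - 1)) = (\<Sum>m\<in>FF - {0}. m ^ (q - 1))"
    using q_ge by (intro sum.mono_neutral_right) auto
  also have "\<dots> = (\<Sum>m\<in>FF - {0}. 1)" by (intro sum.cong) (auto simp: FF_fermat1)
  also have "\<dots> = of_nat (q - 1)" by (simp add: card_FF)
  also have "\<dots> = -1" using of_nat_q q_ge by (subst of_nat_diff) auto
  finally show ?thesis .
qed

lemma power_sum_mid: assumes "q - 1 < j" "j < 2 * (q - 1)" shows "(\<Sum>m\<in>FF. m ^ j) = (0::'k)"
proof -
  have "(\<Sum>m\<in>FF. m ^ j) = (\<Sum>m\<in>FF. m ^ (j - (q - 1)))"
    using assms FF_power_red[of _ "j - (q - 1)"] by (intro sum.cong) auto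
  then show ?thesis using assms by (simp add: power_sum_small)
qed


section \<open>Teichmueller representatives and digits\<close>

text \<open>The cofactor of \<open>x - y\<close> in \<open>x ^ n - y ^ n\<close> reduces to
  \<open>n * red y ^ (n - 1)\<close>, which is 0 because \<open>p\<close> divides \<open>n\<close>;
  this gains one power of the uniformizer.\<close>

lemma inn_power_cong:
  assumes "inn 0 x" "inn 0 y" "inn m (x - y)" "m \<ge> 1" "p dvd n"
  shows "inn (m + 1) (x ^ n - y ^ n)"
proof (cases n)
  case (Suc k)
  let ?S = "\<Sum>i<Suc k. x ^ i * y ^ (k - i)"
  have r: "red x = red y" using assms red_eq_iff[of x y] inn_mono by blast
  have S: "inn 0 ?S" using assms by (intro inn_sum inn_mult0 inn_power) auto
  have "red ?S = (\<Sum>i<Suc k. red x ^ i * red y ^ (k - i))"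
    using assms by (subst red_sum) (auto simp: red_mult red_power inn_power inn_mult0)
  also have "\<dots> = (\<Sum>i<Suc k. red y ^ k)" 
    unfolding r by (intro sum.cong) (auto simp flip: power_add)
  also have "\<dots> = of_nat n * red y ^ k" by (simp add: Suc)
  also have "\<dots> = 0" using assms of_nat_k_0_iff[of n] by simp
  finally have "inn 1 ?S" using red_0_iff[OF S] by simp
  then have "inn (m + 1) ((x - y) * ?S)" using inn_mult[OF assms(3)] by blast
  moreover have "x ^ n - y ^ n = (x - y) * ?S"
    unfolding Suc by (rule diff_power_eq_sum)
  ultimately show ?thesis by simp
qed simp

text \<open>Both elements equal their \<open>q\<close>-th powers, so each use of
  \<open>inn_power_cong\<close> improves their congruence by one power of
  \<open>\<pi>\<close>.\<close>

lemma teich_unique: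
  assumes "inn 0 y" "inn 0 z" "red y = red z" "y ^ q = y" "z ^ q = z"
  shows "y = z"
proof -
  have "inn (int n + 1) (y - z)" for n
  proof (induction n)
    case 0
    then show ?case using assms red_eq_iff[of y z] by simp
  next
    case (Suc n)
    have "p dvd q" using f_ge by (simp add: dvd_power)
    from inn_power_cong[OF assms(1,2) Suc _ this] assms show ?case by (simp add: add.commute)
  qed
  then have "inn k (y - z)" for k
    by (rule inn_mono[of "int (nat k) + 1"]) auto
  then show ?thesis using inn_all_0[of "y - z"] by simp
qed

lemma teich_exists:
  assumes "a \<in> FF" shows "\<exists>y. inn 0 y \<and> red y = a \<and> y ^ q = y"
proof -
  obtain x where x: "inn 0 x" "red x = a" using assms by (rule FF_E)
  \<comment> \<open>The representative is the limit of the \<open>q ^ n\<close>-th powers of an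
    arbitrary lift; \<open>step\<close> shows that consecutive terms agree modulo
    \<open>\<pi> ^ (n + 1)\<close>.\<close>
  define y where "y n = x ^ (q ^ n)" for n :: nat
  have pq: "p dvd q" using f_ge by (simp add: dvd_power)
  have yO: "inn 0 (y n)" for n by (simp add: y_def inn_power x)
  have ySuc: "y (Suc n) = y n ^ q" for n by (simp add: y_def mult.commute flip: power_mult)
  have step: "inn (int n + 1) (y (Suc n) - y n)" for n
  proof (induction n)
    case 0
    have "red (y 1) = red (y 0)" by (simp add: y_def red_power x FF_fermat assms)
    then show ?case using red_eq_iff[OF yO yO] by (simp add: One_nat_def)
  next
    case (Suc n)
    from inn_power_cong[OF yO yO Suc _ pq] show ?case by (simp add: ySuc add.commute)
  qed
  have cau: "inn (int n + 1) (y (n + k) - y n)" for n k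
  proof (induction k)
    case (Suc k)
    have "inn (int n + 1) (y (Suc (n + k)) - y (n + k))"
      using step[of "n + k"] by (rule inn_mono) simp
    with Suc show ?case using inn_trans by (metis add_Suc_right)
  qed simp
  have cau': "inn N (y m - y n)" if "m \<ge> nat N" "n \<ge> nat N" for N m n
  proof -
    have "inn (int (nat N) + 1) (y m - y (nat N))" "inn (int (nat N) + 1) (y n - y (nat N))"
      using cau[of "nat N" "m - nat N"] cau[of "nat N" "n - nat N"] that by auto
    then have "inn (int (nat N) + 1) (y m - y n)" using inn_trans inn_sym by blast
    then show ?thesis by (rule inn_mono) simp
  qed
  obtain L where L: "\<forall>N. \<exists>M. \<forall>n\<ge>M. inn N (y n - L)"
    using complete[of y] cau' by blast
  have close: "\<exists>n. inn N (y n - L) \<and> inn N (y (Suc n) - L)" for N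
    using L by (metis le_SucI order_refl)
  have LO: "inn 0 L"
    using close[of 0] yO inn_cancel by (metis diff_conv_add_uminus inn_neg)
  have Lred: "red L = a"
  proof -
    obtain n where "inn 1 (y n - L)" using close by blast
    then have "red L = red (y n)" using red_eq_iff[OF yO LO, of n] by simp
    also have "\<dots> = a"
    proof (induction n)
      case (Suc n)
      then show ?case using assms by (simp only: ySuc red_power yO FF_fermat)
    qed (simp add: y_def x)
    finally show ?thesis .
  qed
  have "inn N (L ^ q - L)" for N
  proof -
    let ?N = "max N 1"
    obtain n where n: "inn ?N (y n - L)" "inn ?N (y (Suc n) - L)" using close by blast
    have "inn (?N + 1) (y n ^ q - L ^ q)"
      by (rule inn_power_cong[OF yO LO n(1) _ pq]) simp
    then have "inn ?N (L ^ q - y (Suc n))" using inn_sym inn_mono[of "?N + 1" _ ?N] by (simp add: ySuc)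
    then have "inn ?N (L ^ q - L)" using n(2) inn_trans by blast
    then show ?thesis by (rule inn_mono) simp
  qed
  then have "L ^ q = L" using inn_all_0[of "L ^ q - L"] by simp
  then show ?thesis using LO Lred by blast
qed

lemma tc_props: assumes "a \<in> FF" shows "inn 0 (tc a) \<and> red (tc a) = a \<and> tc a ^ q = tc a"
proof -
  have "\<exists>!y. inn 0 y \<and> red y = a \<and> y ^ q = y"
    using teich_exists[OF assms] teich_unique by metis
  then show ?thesis unfolding teich_def by (rule theI')
qed

lemma tc_inn [simp]: "a \<in> FF \<Longrightarrow> inn 0 (tc a)" and tc_red [simp]: "a \<in> FF \<Longrightarrow> red (tc a) = a"
  and tc_pow_q: "a \<in> FF \<Longrightarrow> tc a ^ q = tc a"
  using tc_props by auto

lemma tc_eqI: "inn 0 y \<Longrightarrow> y ^ q = y \<Longrightarrow> tc (red y) = y"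
  by (rule teich_unique) (auto simp: tc_pow_q)

lemma tc_0 [simp]: "tc 0 = 0"
  using tc_eqI[of 0] by simp

lemma tc_power: "a \<in> FF \<Longrightarrow> tc a ^ n = tc (a ^ n)"
  using tc_eqI[of "tc a ^ n"] by (simp add: red_power inn_power power_mult[symmetric] mult.commute)
    (metis mult.commute power_mult tc_pow_q)

lemma tc_inverse: "a \<in> FF \<Longrightarrow> a \<noteq> 0 \<Longrightarrow> inverse (tc a) = tc (inverse a) \<and> tc a \<noteq> 0 \<and> v (tc a) = 0"
proof -
  assume a: "a \<in> FF" "a \<noteq> 0"
  have nz: "tc a \<noteq> 0" using a tc_red[of a] red_0 by metis
  have v0: "v (tc a) = 0" using a tc_inn[of a] red_0_iff[of "tc a"] nz by (auto simp: inO_def)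
  have "tc (red (inverse (tc a))) = inverse (tc a)"
    using nz v0 a by (intro tc_eqI) (auto simp: inO_def v_inverse power_inverse tc_pow_q)
  then show ?thesis using nz v0 a red_inverse[of "tc a"] by auto
qed

lemma tc_cong: "a \<in> FF \<Longrightarrow> b \<in> FF \<Longrightarrow> inn 1 (tc a - tc b) \<longleftrightarrow> a = b"
  using red_eq_iff[of "tc a" "tc b"] by simp

lemma tc_red_cong: "inn 0 x \<Longrightarrow> inn 1 (x - tc (red x))"
  using red_eq_iff[of x "tc (red x)"] by simp

lemma tc_add_cong: "a \<in> FF \<Longrightarrow> b \<in> FF \<Longrightarrow> inn 1 (tc a + tc b - tc (a + b))"
  using tc_red_cong[of "tc a + tc b"] by (simp add: red_add inn_add)

lemma tc_inj: "inj_on tc FF"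
  by (rule inj_on_inverseI[of _ red]) simp

section \<open>Teichmueller expansions and extraction of digits\<close>

abbreviation "ds \<equiv> dsum v red q \<pi>"

lemma ds_0 [simp]: "ds 0 \<mu> = 0" by (simp add: dsum_def)

lemma ds_Suc: "ds (Suc n) \<mu> = ds n \<mu> + tc (\<mu> n) * \<pi> ^ n"
  by (simp add: dsum_def)

lemma ds_cong: "(\<And>i. i < n \<Longrightarrow> \<mu> i = \<nu> i) \<Longrightarrow> ds n \<mu> = ds n \<nu>"
  by (simp add: dsum_def)

lemma ds_inn: "(\<And>i. i < n \<Longrightarrow> \<mu> i \<in> FF) \<Longrightarrow> inn 0 (ds n \<mu>)"
  unfolding dsum_def by (intro inn_sum inn_mult0) auto

lemma digs_FF: "\<mu> \<in> digs v red n \<Longrightarrow> i < n \<Longrightarrow> \<mu> i \<in> FF"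
  by (auto simp: digs_def PiE_def)

lemma finite_digs [simp]: "finite (digs v red n)"
  unfolding digs_def by (intro finite_PiE) auto

lemma digs_inn [simp]: "\<mu> \<in> digs v red n \<Longrightarrow> m \<le> n \<Longrightarrow> inn 0 (ds m \<mu>)"
  by (rule ds_inn) (auto simp: digs_FF)

lemma ds_unique:
  assumes "\<And>i. i < n \<Longrightarrow> \<mu> i \<in> FF" "\<And>i. i < n \<Longrightarrow> \<nu> i \<in> FF" "inn (int n) (ds n \<mu> - ds n \<nu>)"
  shows "i < n \<Longrightarrow> \<mu> i = \<nu> i"
  using assms
proof (induction n arbitrary: i)
  case (Suc n)
  have eq: "ds (Suc n) \<mu> - ds (Suc n) \<nu> = (ds n \<mu> - ds n \<nu>) + (tc (\<mu> n) - tc (\<nu> n)) * \<pi> ^ n"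
    by (simp add: ds_Suc algebra_simps)
  have F: "\<mu> n \<in> FF" "\<nu> n \<in> FF" using Suc.prems by auto
  have "inn (int n) ((tc (\<mu> n) - tc (\<nu> n)) * \<pi> ^ n)"
    using F by (simp add: inn_diff)
  moreover have "inn (int n) (ds (Suc n) \<mu> - ds (Suc n) \<nu>)"
    using Suc.prems(4) by (rule inn_mono) simp
  ultimately have "inn (int n) (ds n \<mu> - ds n \<nu>)"
    unfolding eq using inn_cancel by (metis add.commute)
  then have IH: "\<And>i. i < n \<Longrightarrow> \<mu> i = \<nu> i" using Suc.IH Suc.prems by simp
  then have "ds n \<mu> = ds n \<nu>" by (rule ds_cong)
  then have "inn 1 (tc (\<mu> n) - tc (\<nu> n))" using Suc.prems(4) unfolding eq by simp
  then have "\<mu> n = \<nu> n" using tc_cong F by simp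
  then show ?case using IH Suc.prems(1) by (auto simp: less_Suc_eq)
qed simp

text \<open>The tail of the Teichmueller expansion: the first \<open>n\<close> digits are removed
  and the rest is divided by \<open>\<pi> ^ n\<close>, so that \<open>trunc_rem\<close>
  holds.\<close>

primrec rem :: "nat \<Rightarrow> 'f \<Rightarrow> 'f" where
  "rem 0 x = x"
| "rem (Suc n) x = (rem n x - tc (red (rem n x))) / \<pi>"

definition dg :: "nat \<Rightarrow> 'f \<Rightarrow> 'k" where "dg n x = red (rem n x)"

definition trunc :: "nat \<Rightarrow> 'f \<Rightarrow> 'f" where "trunc n x = ds n (\<lambda>i. dg i x)"

lemma rem_inn [simp]: "inn 0 x \<Longrightarrow> inn 0 (rem n x)"
  by (induction n) (auto simp: inn_div_iff tc_red_cong)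

lemma dg_FF [simp]: "inn 0 x \<Longrightarrow> dg n x \<in> FF"
  by (simp add: dg_def)

lemma trunc_rem: "x = trunc n x + \<pi> ^ n * rem n x"
  by (induction n) (auto simp: trunc_def ds_Suc dg_def field_simps)

lemma trunc_inn [simp]: "inn 0 x \<Longrightarrow> inn 0 (trunc n x)"
  unfolding trunc_def by (rule ds_inn) simp

lemma trunc_cong: "inn 0 x \<Longrightarrow> inn (int n) (x - trunc n x)"
  using trunc_rem[of x n] inn_mult_pi_iff[of "int n" n "rem n x"] by (metis add_diff_cancel_left' diff_self rem_inn)

lemma dg_ds:
  assumes "inn 0 x" "\<And>i. i < n \<Longrightarrow> \<mu> i \<in> FF" "inn (int n) (x - ds n \<mu>)" "i < n"
  shows "dg i x = \<mu> i"
proof -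
  have "inn (int n) (ds n (\<lambda>i. dg i x) - ds n \<mu>)"
    using trunc_cong[OF assms(1), of n] assms(3) unfolding trunc_def
    by (meson inn_sym inn_trans)
  then show ?thesis using ds_unique[of n "\<lambda>i. dg i x" \<mu> i] assms by simp
qed

lemma dg_cong: "inn 0 x \<Longrightarrow> inn 0 y \<Longrightarrow> inn (int n) (x - y) \<Longrightarrow> i < n \<Longrightarrow> dg i x = dg i y"
  by (rule dg_ds) (auto simp flip: trunc_def intro: inn_trans trunc_cong)

lemma trunc_eq: "inn 0 x \<Longrightarrow> inn 0 y \<Longrightarrow> inn (int n) (x - y) \<Longrightarrow> trunc n x = trunc n y"
  unfolding trunc_def by (rule ds_cong) (rule dg_cong)

text \<open>Digits are not additive because of carries, but a multiple of \<open>\<pi> ^ n\<close>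
  leaves the first \<open>n\<close> digits alone, so the tail itself is additive.\<close>

lemma rem_add: assumes "inn 0 x" "inn 0 z" shows "rem n (x + \<pi> ^ n * z) = rem n x + z"
proof -
  have "inn 0 (x + \<pi> ^ n * z)" using assms by (intro inn_add) (auto intro: inn_mono)
  then have "trunc n (x + \<pi> ^ n * z) = trunc n x"
    using assms by (intro trunc_eq) auto
  then have "x + \<pi> ^ n * z = trunc n x + \<pi> ^ n * rem n (x + \<pi> ^ n * z)"
    using trunc_rem[of "x + \<pi> ^ n * z" n] by (simp only:)
  moreover have "P * R' = P * (R + Z)" if "X = T + P * R" "X + P * Z = T + P * R'" for X Z T R R' P :: 'f
    using that by (simp add: algebra_simps)
  ultimately have "\<pi> ^ n * rem n (x + \<pi> ^ n * z) = \<pi> ^ n * (rem n x + z)"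
    using trunc_rem[of x n] by blast
  then show ?thesis by simp
qed

lemma dg_add: "inn 0 x \<Longrightarrow> inn 0 z \<Longrightarrow> dg n (x + \<pi> ^ n * z) = dg n x + red z"
  by (simp add: dg_def rem_add red_add)

lemma dgs_digs: "inn 0 x \<Longrightarrow> restrict (\<lambda>i. dg i x) {..<n} \<in> digs v red n"
  by (auto simp: digs_def)

text \<open>Exactly one tuple of digits is congruent to \<open>x\<close> modulo
  \<open>\<pi> ^ n\<close>. This collapses the sums over I_n that define s_n and t_n.\<close>

lemma digs_sum:
  assumes "inn 0 x"
  shows "(\<Sum>\<mu>\<in>digs v red n. if inn (int n) (x - ds n \<mu>) then g \<mu> else 0) = g (restrict (\<lambda>i. dg i x) {..<n})"
proof -
  let ?m = "restrict (\<lambda>i. dg i x) {..<n}"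
  have iff: "inn (int n) (x - ds n \<mu>) \<longleftrightarrow> \<mu> = ?m" if "\<mu> \<in> digs v red n" for \<mu>
  proof
    assume "inn (int n) (x - ds n \<mu>)"
    then have "\<And>i. i < n \<Longrightarrow> dg i x = \<mu> i" using dg_ds assms digs_FF[OF that] by blast
    then show "\<mu> = ?m" using that by (auto simp: digs_def PiE_def extensional_def)
  next
    assume m: "\<mu> = ?m"
    have "ds n ?m = trunc n x" unfolding trunc_def by (rule ds_cong) simp
    then show "inn (int n) (x - ds n \<mu>)" using trunc_cong assms m by simp
  qed
  have "(\<Sum>\<mu>\<in>digs v red n. if inn (int n) (x - ds n \<mu>) then g \<mu> else 0)
      = (\<Sum>\<mu>\<in>digs v red n. if \<mu> = ?m then g \<mu> else 0)"
    by (intro sum.cong) (auto simp: iff)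
  then show ?thesis using dgs_digs[OF assms] by simp
qed

section \<open>The carry in the addition of two Teichmueller representatives\<close>

definition cr :: "'k \<Rightarrow> 'k \<Rightarrow> 'k" where "cr a b = red ((tc a + tc b - tc (a + b)) / \<pi>)"

lemma cr_inn: "a \<in> FF \<Longrightarrow> b \<in> FF \<Longrightarrow> inn 0 ((tc a + tc b - tc (a + b)) / \<pi>)"
  by (simp add: inn_div_iff tc_add_cong)

lemma p_pi_inn: "inn 0 (of_nat p / \<pi>)"
  using v_p e_ge by (simp add: inn_div_iff) (simp add: inO_def)

text \<open>Through this residue the ramification index enters the carries.\<close>

lemma p_pi_red: "red (of_nat p / \<pi>) = 0 \<longleftrightarrow> e \<ge> 2"
  unfolding red_0_iff[OF p_pi_inn] using v_p e_ge char0[of p] by (simp add: inn_div_iff) (simp add: inO_def)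

text \<open>Shifting by \<open>b\<close> permutes the Teichmueller representatives, so their sums
  cancel and only the \<open>q = p\<close> copies of \<open>tc b\<close> survive.\<close>

lemma cr_sum: assumes "f = 1" "b \<in> FF" shows "(\<Sum>a\<in>FF. cr a b) = red (of_nat p / \<pi>) * b"
proof -
  have "(\<Sum>a\<in>FF. cr a b) = red (\<Sum>a\<in>FF. (tc a + tc b - tc (a + b)) / \<pi>)"
    unfolding cr_def by (rule red_sum[symmetric]) (rule cr_inn[OF _ assms(2)])
  also have "(\<Sum>a\<in>FF. (tc a + tc b - tc (a + b)) / \<pi>) = (of_nat p / \<pi>) * tc b"
    using FF_shift[OF assms(2), of tc] card_FF assms(1)
    by (simp add: sum_divide_distrib[symmetric] sum.distrib sum_subtractf)
  finally show ?thesis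
    using red_mult[OF p_pi_inn tc_inn[OF assms(2)]] assms(2) by (simp only: tc_red)
qed

text \<open>As p-th powers of congruent elements are congruent modulo pi^2, the carry is found by extracting p-th roots.\<close>

lemma cr_formula:
  assumes "a \<in> FF" "b \<in> FF"
  shows "cr a b = (\<Sum>i\<in>{1..<p}. (- red (of_nat p / \<pi>) * of_nat ((p choose i) div p) * (a ^ p ^ (f - 1)) ^ (p - i)) * b ^ (i * p ^ (f - 1)))"
proof -
  let ?a = "a ^ p ^ (f - 1)" and ?b = "b ^ p ^ (f - 1)"
  have pf: "p ^ (f - 1) * p = q" using f_ge by (simp add: power_minus_mult)
  \<comment> \<open>As \<open>c ^ q = c\<close>, the power \<open>c ^ p ^ (f - 1)\<close> is the
    \<open>p\<close>-th root of \<open>c\<close> in F_q.\<close>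
  have root: "tc (c ^ p ^ (f - 1)) ^ p = tc c" if "c \<in> FF" for c
    using that by (simp add: tc_power flip: power_mult) (simp add: pf FF_fermat)
  have ab: "?a \<in> FF" "?b \<in> FF" using assms by auto
  define A where "A = tc ?a" 
  define B where "B = tc ?b"
  define C where "C = tc ((a + b) ^ p ^ (f - 1))"
  have O: "inn 0 A" "inn 0 B" "inn 0 C" using ab assms by (auto simp: A_def B_def C_def)
  have "red C = red (A + B)" using ab assms O by (simp add: red_add A_def B_def C_def frob)
  then have "inn 1 (C - (A + B))" using red_eq_iff O inn_add by blast
  then have "inn (1 + 1) (C ^ p - (A + B) ^ p)"
    by (intro inn_power_cong) (use O inn_add in auto)
  then have rest: "inn 1 ((C ^ p - (A + B) ^ p) / \<pi>)" by (simp add: inn_div_iff)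
  define S where "S = (\<Sum>i\<in>{1..<p}. of_nat ((p choose i) div p) * A ^ (p - i) * B ^ i)"
  have "(B + A) ^ p = (\<Sum>i\<le>p. of_nat (p choose i) * B ^ i * A ^ (p - i))"
    by (rule binomial_ring)
  also have "{..p} = insert 0 (insert p {1..<p})" by auto
  also have "(\<Sum>i\<in>\<dots>. of_nat (p choose i) * B ^ i * A ^ (p - i))
      = A ^ p + (B ^ p + (\<Sum>i\<in>{1..<p}. of_nat (p choose i) * B ^ i * A ^ (p - i)))"
    by simp
  also have "(\<Sum>i\<in>{1..<p}. of_nat (p choose i) * B ^ i * A ^ (p - i)) = of_nat p * S"
    unfolding S_def sum_distrib_left
  proof (intro sum.cong refl)
    fix i assume "i \<in> {1..<p}"
    then have "p dvd (p choose i)" using prime_p by (intro dvd_choose_prime) auto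
    then have "of_nat (p choose i) = (of_nat p * of_nat ((p choose i) div p) :: 'f)"
      by (metis dvd_mult_div_cancel of_nat_mult)
    then show "of_nat (p choose i) * B ^ i * A ^ (p - i) = of_nat p * (of_nat ((p choose i) div p) * A ^ (p - i) * B ^ i)"
      by (simp add: algebra_simps)
  qed
  finally have bin: "(A + B) ^ p = A ^ p + B ^ p + of_nat p * S" by (simp add: add.commute add.left_commute)
  have SO: "inn 0 S" unfolding S_def by (intro inn_sum inn_mult0 inn_power O inn_of_nat)
  have "(tc a + tc b - tc (a + b)) / \<pi> = - (of_nat p / \<pi>) * S - (C ^ p - (A + B) ^ p) / \<pi>"
    using root[OF assms(1)] root[OF assms(2)] root[of "a + b"] assms
    by (simp add: A_def[symmetric] B_def[symmetric] C_def[symmetric] bin field_simps)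
  then have "cr a b = red (- (of_nat p / \<pi>) * S) - red ((C ^ p - (A + B) ^ p) / \<pi>)"
    unfolding cr_def using SO p_pi_inn rest inn_mono[OF rest, of 0] 
    by (simp only:) (rule red_diff, simp only: inn_neg minus_mult_left[symmetric] inn_mult0, simp)
  also have "red ((C ^ p - (A + B) ^ p) / \<pi>) = 0" using rest inn_mono[OF rest, of 0] by (simp add: red_0_iff)
  also have "red (- (of_nat p / \<pi>) * S) = - red (of_nat p / \<pi>) * red S"
    using SO p_pi_inn by (subst red_mult) (auto simp del: minus_divide_left simp: red_neg)
  also have "red S = (\<Sum>i\<in>{1..<p}. of_nat ((p choose i) div p) * ?a ^ (p - i) * ?b ^ i)"
    unfolding S_def using O ab by (subst red_sum) (auto simp: red_mult red_power red_of_nat inn_mult0 inn_power A_def B_def)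
  finally show ?thesis
    by (simp add: sum_distrib_left mult.assoc power_mult[symmetric] mult.commute[of "p ^ (f - 1)"])
qed

section \<open>Matrices and cosets of IZ\<close>

lemma mat_simps [simp]: "ea (a, b, c, d) = a" "eb (a, b, c, d) = b" "ec (a, b, c, d) = c" "ed (a, b, c, d) = d"
  by (simp_all add: ea_def eb_def ec_def ed_def)

lemma mmul_eq [simp]:
  "mmul (a, b, c, d) (a', b', c', d') = (a * a' + b * c', a * b' + b * d', c * a' + d * c', c * b' + d * d')"
  by (simp add: mmul_def)

lemma mdet_eq [simp]: "mdet (a, b, c, d) = a * d - b * c"
  by (simp add: mdet_def)

lemma GL2_iff: "g \<in> GL2 \<longleftrightarrow> mdet g \<noteq> 0"
  by (simp add: GL2_def)

lemma mmul_assoc: "mmul (mmul X Y) Z = mmul X (mmul Y Z)"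
  by (cases X; cases Y; cases Z) (simp add: algebra_simps)

lemma mmul_1 [simp]: "mmul Idm X = X" "mmul X Idm = X"
  by (cases X; simp add: Idm_def)+

lemma mdet_mmul: "mdet (mmul X Y) = mdet X * mdet Y"
  by (cases X; cases Y) (simp add: algebra_simps)

lemma GL2_mmul [simp]: "mmul X Y \<in> GL2 \<longleftrightarrow> X \<in> GL2 \<and> Y \<in> GL2"
  by (simp add: GL2_iff mdet_mmul)

lemma minv_eq: "minv (a, b, c, d) = (d / (a * d - b * c), - b / (a * d - b * c), - c / (a * d - b * c), a / (a * d - b * c))"
  by (simp add: minv_def)

lemma minv_left: "X \<in> GL2 \<Longrightarrow> mmul (minv X) X = Idm"
  and minv_right: "X \<in> GL2 \<Longrightarrow> mmul X (minv X) = Idm"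
proof -
  assume "X \<in> GL2"
  moreover obtain a b c d where X: "X = (a, b, c, d)" by (cases X)
  ultimately obtain D where D: "D = a * d - b * c" "D \<noteq> 0" by (simp add: GL2_iff)
  show "mmul (minv X) X = Idm" "mmul X (minv X) = Idm"
    unfolding X minv_eq D(1)[symmetric] mmul_eq Idm_def using D(2)
    by (auto simp: add_divide_distrib[symmetric] diff_divide_distrib[symmetric] mult.commute D(1) divide_eq_1_iff)
qed

lemma Idm_GL2 [simp]: "Idm \<in> GL2"
  by (simp add: GL2_iff Idm_def)

lemma minv_GL2 [simp]: "X \<in> GL2 \<Longrightarrow> minv X \<in> GL2"
  using minv_left[of X] GL2_mmul[of "minv X" X] Idm_GL2 by metis

lemma minv_unique: "X \<in> GL2 \<Longrightarrow> mmul X Y = Idm \<Longrightarrow> minv X = Y"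
  by (metis minv_left mmul_1 mmul_assoc)

lemma minv_mmul: "X \<in> GL2 \<Longrightarrow> Y \<in> GL2 \<Longrightarrow> minv (mmul X Y) = mmul (minv Y) (minv X)"
  by (rule minv_unique) (simp, metis minv_right mmul_1(1) mmul_assoc)

abbreviation scal :: "'f \<Rightarrow> 'f m2" where "scal z \<equiv> (z, 0, 0, z)"

lemma scal_comm: "mmul X (scal z) = mmul (scal z) X"
  by (cases X) simp

text \<open>In I both diagonal entries are units because \<open>b' * c'\<close> lies in the maximal
  ideal; the scalar \<open>z\<close> then shifts all valuations equally.\<close>

lemma IZ_iff: "(a, b, c, d) \<in> IZ v \<longleftrightarrow> a \<noteq> 0 \<and> d \<noteq> 0 \<and> v a = v d \<and> inn (v d) b \<and> inn (v d + 1) c"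
proof
  assume "(a, b, c, d) \<in> IZ v"
  then obtain z k where zk: "z \<noteq> 0" "k \<in> Iwa v" "(a, b, c, d) = mmul (scal z) k" by (auto simp: IZ_def)
  obtain a' b' c' d' where k: "k = (a', b', c', d')" by (cases k)
  have I: "inn 0 a'" "inn 0 b'" "inn 1 c'" "inn 0 d'" "a' * d' - b' * c' \<noteq> 0" "v (a' * d' - b' * c') = 0"
    using zk(2) by (auto simp: k Iwa_def Kgrp_def)
  have "inn 1 (b' * c')" using I inn_mult[of 0 b' 1 c'] by simp
  then have "\<not> inn 1 (a' * d')" using I inn_diff[of 1 "a' * d'" "b' * c'"] by (auto simp: inO_def)
  then have nz: "a' \<noteq> 0" "d' \<noteq> 0" "v a' + v d' < 1" by (auto simp: inO_def v_mult)
  then have "v a' = 0" "v d' = 0" using I by (auto simp: inO_def)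
  then show "a \<noteq> 0 \<and> d \<noteq> 0 \<and> v a = v d \<and> inn (v d) b \<and> inn (v d + 1) c"
    using zk nz I by (auto simp: k v_mult inn_mult_iff mult.commute[of z])
next
  assume a: "a \<noteq> 0 \<and> d \<noteq> 0 \<and> v a = v d \<and> inn (v d) b \<and> inn (v d + 1) c"
  let ?k = "(a / d, b / d, c / d, 1)"
  have bc: "inn 1 (b * c / (d * d))"
    using a inn_mult[of "v d" b "v d + 1" c] by (simp add: inn_div_iff v_mult algebra_simps)
  have m: "a / d - b / d * (c / d) = a / d - b * c / (d * d)" by simp
  have "inn 0 (a / d - b * c / (d * d))" using a bc by (intro inn_diff) (auto simp: inn_div_iff inO_def v_divide)
  moreover have "\<not> inn 1 (a / d - b * c / (d * d))"
    using a bc inn_cancel[of 1 "- (b * c / (d * d))" "a / d"] by (auto simp: inO_def v_divide)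
  ultimately have "a / d - b / d * (c / d) \<noteq> 0" "v (a / d - b / d * (c / d)) = 0" unfolding m by (auto simp: inO_def)
  then have "?k \<in> Iwa v" using a inn_mono[of "v d + 1" c "v d"]
    by (auto simp: Iwa_def Kgrp_def inn_div_iff add.commute) (simp add: inO_def)
  moreover have "(a, b, c, d) = mmul (scal d) ?k" using a by simp
  ultimately show "(a, b, c, d) \<in> IZ v" unfolding IZ_def using a by blast
qed

text \<open>The leading residue of \<open>x\<close>: multiplicative on nonzero elements and 1 at
  \<open>\<pi>\<close>, so that chi_r is the \<open>r\<close>-th power of \<open>up\<close> of the
  lower right entry.\<close>

definition up :: "'f \<Rightarrow> 'k" where "up x = red (x / power_int \<pi> (v x))"

lemma up_inn: "x \<noteq> 0 \<Longrightarrow> inn 0 (x / power_int \<pi> (v x))"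
  by (simp add: inn_div_iff) (simp add: inO_def)

lemma up_mult: "x \<noteq> 0 \<Longrightarrow> y \<noteq> 0 \<Longrightarrow> up (x * y) = up x * up y"
  using red_mult[OF up_inn[of x] up_inn[of y]] by (simp add: up_def v_mult power_int_add field_simps)

lemma up_1 [simp]: "up 1 = 1" by (simp add: up_def)

lemma up_pi [simp]: "up \<pi> = 1" by (simp add: up_def)

lemma up_unit: "x \<noteq> 0 \<Longrightarrow> v x = 0 \<Longrightarrow> up x = red x" by (simp add: up_def)

lemma v_cong: "y \<noteq> 0 \<Longrightarrow> inn (v y + 1) (x - y) \<Longrightarrow> x \<noteq> 0 \<and> v x = v y"
proof -
  assume a: "y \<noteq> 0" "inn (v y + 1) (x - y)"
  then have "inn 1 (x / y - 1)" using inn_div_iff[of y 1 "x - y"] by (simp add: diff_divide_distrib add.commute)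
  then have "x / y \<noteq> 0 \<and> v (x / y) = 0" by (rule unit_1)
  then show ?thesis using a by (auto simp: v_divide)
qed

lemma up_cong: "y \<noteq> 0 \<Longrightarrow> inn (v y + 1) (x - y) \<Longrightarrow> up x = up y"
proof -
  assume a: "y \<noteq> 0" "inn (v y + 1) (x - y)"
  note x = v_cong[OF a]
  have "inn 1 (x / power_int \<pi> (v x) - y / power_int \<pi> (v y))"
    using a x by (simp flip: diff_divide_distrib add: inn_div_iff add.commute)
  then show ?thesis unfolding up_def using a x up_inn red_eq_iff by blast
qed

lemma chi_eq: "chi v red \<pi> r (a, b, c, d) = up d ^ r"
  by (simp add: chi_def up_def)

text \<open>The products \<open>b * c'\<close> and \<open>c * b'\<close> lie one valuation deeper
  than \<open>a * a'\<close> and \<open>d * d'\<close>, so they change neither the valuations nor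
  the leading residues on the diagonal.\<close>

lemma IZ_mmul: "h \<in> IZ v \<Longrightarrow> k \<in> IZ v \<Longrightarrow> mmul h k \<in> IZ v \<and> chi v red \<pi> r (mmul h k) = chi v red \<pi> r h * chi v red \<pi> r k"
proof -
  assume hk: "h \<in> IZ v" "k \<in> IZ v"
  obtain a b c d where h: "h = (a, b, c, d)" by (cases h)
  obtain a' b' c' d' where k: "k = (a', b', c', d')" by (cases k)
  have H: "a \<noteq> 0" "d \<noteq> 0" "v a = v d" "inn (v d) b" "inn (v d + 1) c" using hk(1) unfolding h IZ_iff by auto
  have K: "a' \<noteq> 0" "d' \<noteq> 0" "v a' = v d'" "inn (v d') b'" "inn (v d' + 1) c'" using hk(2) unfolding k IZ_iff by auto
  have inn_self: "inn (v x) x" for x by (simp add: inO_def)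
  have e1: "inn (v (d * d') + 1) ((c * b' + d * d') - d * d')"
    using inn_mult[OF H(5) K(4)] H K by (simp add: v_mult algebra_simps)
  have e2: "inn (v (a * a') + 1) ((a * a' + b * c') - a * a')"
    using inn_mult[OF H(4) K(5)] H K by (simp add: v_mult algebra_simps)
  note d1 = v_cong[OF _ e1] and a1 = v_cong[OF _ e2] and u = up_cong[OF _ e1]
  have b1: "inn (v d + v d') (a * b' + b * d')"
    using inn_mult[OF inn_self[of a] K(4)] inn_mult[OF H(4) inn_self[of d']] H by (intro inn_add) auto
  have c1: "inn (v d + v d' + 1) (c * a' + d * c')"
    using inn_mult[OF H(5) inn_self[of a']] inn_mult[OF inn_self[of d] K(5)] K 
    by (intro inn_add) (auto simp: algebra_simps)
  show ?thesis unfolding h k mmul_eq IZ_iff chi_eq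
    using d1 a1 u H K b1 c1 by (simp add: v_mult up_mult power_mult_distrib)
qed

lemma IZ_GL2: "h \<in> IZ v \<Longrightarrow> h \<in> GL2"
proof -
  assume "h \<in> IZ v"
  moreover obtain a b c d where h: "h = (a, b, c, d)" by (cases h)
  ultimately have H: "a \<noteq> 0" "d \<noteq> 0" "v a = v d" "inn (v d) b" "inn (v d + 1) c" unfolding h IZ_iff by auto
  have "inn (v (a * d) + 1) ((a * d - b * c) - a * d)"
    using inn_mult[OF H(4,5)] H by (simp add: v_mult algebra_simps)
  from v_cong[OF _ this] H show ?thesis by (simp add: h GL2_iff)
qed

lemma IZ_minv: "h \<in> IZ v \<Longrightarrow> minv h \<in> IZ v"
proof -
  assume hI: "h \<in> IZ v"
  moreover obtain a b c d where h: "h = (a, b, c, d)" by (cases h)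
  ultimately have H: "a \<noteq> 0" "d \<noteq> 0" "v a = v d" "inn (v d) b" "inn (v d + 1) c" unfolding h IZ_iff by auto
  have "inn (v (a * d) + 1) ((a * d - b * c) - a * d)"
    using inn_mult[OF H(4,5)] H by (simp add: v_mult algebra_simps)
  from v_cong[OF _ this] H have D: "a * d - b * c \<noteq> 0" "v (a * d - b * c) = 2 * v d" by (auto simp: v_mult)
  show ?thesis using D H unfolding h by (simp add: minv_def IZ_iff v_divide inn_div_iff)
qed

lemma chi_minv: "h \<in> IZ v \<Longrightarrow> chi v red \<pi> r (minv h) * chi v red \<pi> r h = 1"
  using IZ_mmul[OF IZ_minv, of h h] minv_left[OF IZ_GL2, of h] by (simp add: Idm_def chi_eq)

lemma Idm_IZ [simp]: "Idm \<in> IZ v" by (simp add: Idm_def IZ_iff)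

lemma scal_IZ: "z \<noteq> 0 \<Longrightarrow> scal z \<in> IZ v" by (simp add: IZ_iff)

lemma IZ_scal_iff: "z \<noteq> 0 \<Longrightarrow> mmul (scal z) g \<in> IZ v \<longleftrightarrow> g \<in> IZ v"
proof -
  assume z: "z \<noteq> 0"
  have "mmul (scal (inverse z)) (mmul (scal z) g) = g" using z by (cases g) simp
  then show ?thesis using IZ_mmul scal_IZ z by (metis inverse_nonzero_iff_nonzero)
qed

lemma IZ_left_iff: "h \<in> IZ v \<Longrightarrow> mmul h g \<in> IZ v \<longleftrightarrow> g \<in> IZ v"
proof
  assume h: "h \<in> IZ v"
  assume "mmul h g \<in> IZ v"
  then have "mmul (minv h) (mmul h g) \<in> IZ v" using IZ_mmul IZ_minv h by blast
  then show "g \<in> IZ v" using h by (simp add: mmul_assoc[symmetric] minv_left IZ_GL2)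
qed (use IZ_mmul in blast)

abbreviation "bet \<equiv> betam \<pi>"

lemma bet_GL2 [simp]: "bet \<in> GL2" by (simp add: betam_def GL2_iff)

lemma bet_bet: "mmul bet bet = scal \<pi>" by (simp add: betam_def)

text \<open>Beta normalizes IZ; conjugation by it exchanges the diagonal entries.\<close>

lemma bet_conj: "h \<in> IZ v \<Longrightarrow> \<exists>h' \<in> IZ v. mmul bet h = mmul h' bet"
proof -
  assume "h \<in> IZ v"
  moreover obtain a b c d where h: "h = (a, b, c, d)" by (cases h)
  ultimately have H: "a \<noteq> 0" "d \<noteq> 0" "v a = v d" "inn (v d) b" "inn (v d + 1) c" unfolding h IZ_iff by auto
  then have "(d, c / \<pi>, \<pi> * b, a) \<in> IZ v" by (simp add: IZ_iff inn_div_iff)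
  moreover have "mmul bet h = mmul (d, c / \<pi>, \<pi> * b, a) bet" by (simp add: h betam_def)
  ultimately show ?thesis by blast
qed

section \<open>Representatives of the cosets IZ g\<close>

definition ro :: "'f m2 \<Rightarrow> 'f m2 \<Rightarrow> bool" where "ro y y' \<longleftrightarrow> (\<exists>h\<in>IZ v. y = mmul h y')"

lemma roI: "h \<in> IZ v \<Longrightarrow> y = mmul h y' \<Longrightarrow> ro y y'" by (auto simp: ro_def)

lemma ro_refl [simp]: "ro y y" by (rule roI[of Idm]) auto

lemma ro_trans [trans]: "ro x y \<Longrightarrow> ro y z \<Longrightarrow> ro x z"
  unfolding ro_def using IZ_mmul mmul_assoc by metis

lemma ro_sym: "ro x y \<Longrightarrow> ro y x"
  unfolding ro_def using IZ_minv minv_left IZ_GL2 mmul_assoc mmul_1(1) by metis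

lemma ro_right: "ro x y \<Longrightarrow> ro (mmul x g) (mmul y g)"
  unfolding ro_def using mmul_assoc by metis

lemma ro_bet: "ro x y \<Longrightarrow> ro (mmul bet x) (mmul bet y)"
  unfolding ro_def using bet_conj mmul_assoc by metis

lemma ro_scal: "z \<noteq> 0 \<Longrightarrow> ro (mmul (scal z) x) x"
  by (rule roI[of "scal z"]) (auto simp: scal_IZ)

text \<open>Row reduction within IZ, possible because \<open>c / a\<close> lies in the maximal
  ideal; dividing out \<open>a\<close> and the unit parts leaves only the exponent
  \<open>m\<close>.\<close>

lemma ro_triangular:
  assumes "a \<noteq> 0" "a * d - b * c \<noteq> 0" "inn (v a + 1) c" "m = 2 * v a - v (a * d - b * c)"
  shows "ro (a, b, c, d) (power_int \<pi> m, b * power_int \<pi> m / a, 0, 1)"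
proof (rule roI)
  let ?P = "power_int \<pi> m"
  have P: "?P \<noteq> 0" by simp
  have dd: "d - c * b / a = (a * d - b * c) / a" using assms by (simp add: field_simps)
  show "(a / ?P, 0, c / ?P, d - c * b / a) \<in> IZ v"
    unfolding IZ_iff dd using assms by (auto simp: v_divide inn_div_iff)
  show "(a, b, c, d) = mmul (a / ?P, 0, c / ?P, d - c * b / a) (?P, b * ?P / a, 0, 1)"
    using assms P by (simp add: field_simps)
qed

definition bt :: "bool \<Rightarrow> 'f m2" where "bt t = (if t then bet else Idm)"

text \<open>Up to the centre, ci t n x is the inverse of the edge (pi^n, x; 0, 1) beta^t.\<close>

definition ci :: "bool \<Rightarrow> nat \<Rightarrow> 'f \<Rightarrow> 'f m2" where "ci t n x = mmul (bt t) (1, - x, 0, \<pi> ^ n)"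

lemma bt_GL2 [simp]: "bt t \<in> GL2" by (simp add: bt_def)

lemma ci_GL2 [simp]: "ci t n x \<in> GL2" by (simp add: ci_def) (simp add: GL2_iff)

text \<open>The sizes of \<open>\<pi> ^ m\<close> and \<open>b\<close> decide where the edge lies:
  \<open>s\<close> records the half of the tree, \<open>t\<close> the orientation.\<close>

lemma upper_coset: "\<exists>s t n x. inn 0 x \<and> ro (power_int \<pi> m, b, 0, 1) (mmul (ci t n x) (bt s))"
proof -
  let ?P = "power_int \<pi> m"
  consider "m \<le> 0 \<and> inn m b" | "\<not> (m \<le> 0 \<and> inn m b)" "inn 0 b" | "\<not> (m \<le> 0 \<and> inn m b)" "\<not> inn 0 b" by blast
  then show ?thesis
  proof cases
    case 1
    define n where "n = nat (- m)"
    have P: "?P * \<pi> ^ n = 1" using 1 unfolding n_def 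
      by (cases "m = 0") (simp_all add: power_int_def power_inverse)
    have "(?P, b, 0, 1) = mmul (scal ?P) (mmul (ci False n (- (b * \<pi> ^ n))) (bt False))"
      using P by (simp add: ci_def bt_def Idm_def algebra_simps)
    moreover have "inn 0 (- (b * \<pi> ^ n))" using 1 by (simp add: n_def)
    ultimately show ?thesis using ro_scal[of ?P] by (metis power_int_not_zero pi_nz)
  next
    case 2
    then have m: "m > 0" using inn_mono by (metis not_less)
    define n where "n = nat m"
    have P: "?P = \<pi> ^ n" using m by (simp add: n_def power_int_def)
    have "ro (?P, b, 0, 1) (?P, 0, 0, 1)"
      by (rule roI[of "(1, b, 0, 1)"]) (use 2 in \<open>auto simp: IZ_iff\<close>)
    also have "ro (?P, 0, 0, 1) (mmul (scal \<pi>) (?P, 0, 0, 1))" by (rule ro_sym, rule ro_scal) simp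
    also have "mmul (scal \<pi>) (?P, 0, 0, 1) = mmul (ci True n 0) (bt True)"
      by (simp add: ci_def bt_def betam_def P)
    finally show ?thesis using inn_0 by blast
  next
    case 3
    then have b: "b \<noteq> 0" "v b < 0" by (auto simp: inO_def)
    then have moeb: "m > v b" using 3(1) by (auto simp: inO_def)
    \<comment> \<open>After right multiplication by \<open>bet\<close> the upper left entry is
      \<open>\<pi> * b\<close>, which dominates the lower left entry \<open>\<pi>\<close>;
      \<open>ro_triangular\<close> then yields the exponent \<open>2 * v b + 1 - m\<close>, that is
      \<open>- n\<close>.\<close>
    define n where "n = nat (m - 2 * v b - 1)"
    have n: "int n = m - 2 * v b - 1" using moeb b by (simp add: n_def)
    define x where "x = - (?P / (\<pi> * b))"
    have xO: "inn 0 x" using b moeb by (simp add: x_def inn_div_iff v_mult) (simp add: inO_def)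
    have "ro (mmul (?P, b, 0, 1) bet) (power_int \<pi> (- int n), ?P * power_int \<pi> (- int n) / (\<pi> * b), 0, 1)"
      using ro_triangular[of "\<pi> * b" 0 ?P \<pi> "- int n"] b moeb n
      by (simp add: betam_def v_mult mult.commute[of b])
    also have "\<dots> = mmul (scal (power_int \<pi> (- int n))) (ci False n x)"
      by (simp add: ci_def bt_def Idm_def x_def power_int_minus mult.commute)
    also have "ro \<dots> (ci False n x)" by (rule ro_scal) simp
    finally have "ro (mmul (mmul (?P, b, 0, 1) bet) bet) (mmul (ci False n x) bet)" by (rule ro_right)
    moreover have "mmul (mmul (?P, b, 0, 1) bet) bet = mmul (scal \<pi>) (?P, b, 0, 1)"
      by (simp add: mmul_assoc bet_bet scal_comm)
    ultimately have "ro (mmul (scal \<pi>) (?P, b, 0, 1)) (mmul (ci False n x) (bt True))"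
      unfolding bt_def by (simp only: if_True)
    then have "ro (?P, b, 0, 1) (mmul (ci False n x) (bt True))"
      by (rule ro_trans[OF ro_sym[OF ro_scal[OF pi_nz]]])
    then show ?thesis using xO by blast
  qed
qed

text \<open>If the first column is dominated by its lower entry, left multiplication by
  \<open>bet\<close> exchanges the rows. As \<open>bet\<close> normalizes IZ, undoing this only
  flips \<open>t\<close>.\<close>

lemma coset_cover:
  assumes "y \<in> GL2" shows "\<exists>s t n x. inn 0 x \<and> ro y (mmul (ci t n x) (bt s))"
proof -
  obtain a b c d where y: "y = (a, b, c, d)" by (cases y)
  have det: "a * d - b * c \<noteq> 0" using assms by (simp add: y GL2_iff)
  show ?thesis
  proof (cases "a \<noteq> 0 \<and> inn (v a + 1) c")
    case True
    define m where "m = 2 * v a - v (a * d - b * c)"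
    have "ro y (power_int \<pi> m, b * power_int \<pi> m / a, 0, 1)"
      unfolding y using True det m_def by (intro ro_triangular) auto
    moreover obtain s t n x where "inn 0 x"
      "ro (power_int \<pi> m, b * power_int \<pi> m / a, 0, 1) (mmul (ci t n x) (bt s))"
      using upper_coset by blast
    ultimately show ?thesis using ro_trans by blast
  next
    case False
    then have c: "c \<noteq> 0" "inn (v c + 1) (\<pi> * a)"
      using det by (cases "a = 0"; auto simp: inO_def v_mult)+
    define m where "m = 2 * v c - v (c * (\<pi> * b) - d * (\<pi> * a))"
    have det': "c * (\<pi> * b) - d * (\<pi> * a) \<noteq> 0" 
    proof -
      have "c * (\<pi> * b) - d * (\<pi> * a) = - \<pi> * (a * d - b * c)" by (simp add: algebra_simps)
      then show ?thesis using det by simp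
    qed
    have "ro (mmul bet y) (power_int \<pi> m, d * power_int \<pi> m / c, 0, 1)"
      using ro_triangular[OF c(1) det' c(2) m_def] by (simp add: y betam_def)
    moreover obtain s t n x where x: "inn 0 x"
      "ro (power_int \<pi> m, d * power_int \<pi> m / c, 0, 1) (mmul (ci t n x) (bt s))"
      using upper_coset by blast
    ultimately have "ro (mmul bet y) (mmul (ci t n x) (bt s))" using ro_trans by blast
    then have "ro (mmul bet (mmul bet y)) (mmul bet (mmul (ci t n x) (bt s)))" by (rule ro_bet)
    then have "ro (mmul (scal \<pi>) y) (mmul (mmul bet (ci t n x)) (bt s))"
      unfolding mmul_assoc[symmetric] bet_bet .
    then have "ro y (mmul (mmul bet (ci t n x)) (bt s))"
      by (rule ro_trans[OF ro_sym[OF ro_scal[OF pi_nz]]])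
    moreover have "ro (mmul bet (ci t n x)) (ci (\<not> t) n x)"
      using ro_scal[of \<pi> "(1, - x, 0, \<pi> ^ n)"]
      by (cases t) (simp_all add: ci_def bt_def mmul_assoc[symmetric] bet_bet)
    ultimately have "ro y (mmul (ci (\<not> t) n x) (bt s))" using ro_right ro_trans by blast
    then show ?thesis using x(1) by blast
  qed
qed

section \<open>Coordinates on the compact induction\<close>

abbreviation "X \<equiv> chi v red \<pi> r"
abbreviation "ind \<equiv> indG v red \<pi> r"
abbreviation "brk \<equiv> br v red \<pi> r"

lemma X_scal_pi: "X (scal \<pi>) = 1" by (simp add: chi_eq)

lemma ind_out: "\<phi> \<in> ind \<Longrightarrow> x \<notin> GL2 \<Longrightarrow> \<phi> x = 0"
  and ind_left: "\<phi> \<in> ind \<Longrightarrow> h \<in> IZ v \<Longrightarrow> x \<in> GL2 \<Longrightarrow> \<phi> (mmul h x) = X h * \<phi> x"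
  and ind_fin: "\<phi> \<in> ind \<Longrightarrow> finite (supp_cosets v \<phi>)"
  unfolding indG_def by blast+

declare split_paired_All [simp del] split_paired_Ex [simp del]

lemma ind_0 [simp]: "(\<lambda>_. 0) \<in> ind"
  by (simp add: indG_def supp_cosets_def)

lemma ind_add: assumes "\<phi> \<in> ind" "\<psi> \<in> ind" shows "(\<lambda>x. \<phi> x + \<psi> x) \<in> ind"
proof -
  have "supp_cosets v (\<lambda>x. \<phi> x + \<psi> x) \<subseteq> supp_cosets v \<phi> \<union> supp_cosets v \<psi>"
    unfolding supp_cosets_def by fastforce
  then show ?thesis using assms by (auto simp: indG_def distrib_left intro: finite_subset)
qed

lemma ind_scale: assumes "\<phi> \<in> ind" shows "(\<lambda>x. c * \<phi> x) \<in> ind"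
proof -
  have "supp_cosets v (\<lambda>x. c * \<phi> x) \<subseteq> supp_cosets v \<phi>"
    unfolding supp_cosets_def by fastforce
  then show ?thesis using assms by (auto simp: indG_def intro: finite_subset)
qed

lemma ind_diff: "\<phi> \<in> ind \<Longrightarrow> \<psi> \<in> ind \<Longrightarrow> (\<lambda>x. \<phi> x - \<psi> x) \<in> ind"
  using ind_add[of \<phi> "\<lambda>x. (-1) * \<psi> x"] ind_scale[of \<psi> "-1"] by simp

lemma ind_sum: "(\<And>i. i \<in> A \<Longrightarrow> g i \<in> ind) \<Longrightarrow> (\<lambda>x. \<Sum>i\<in>A. g i x) \<in> ind"
  by (induction A rule: infinite_finite_induct) (auto intro: ind_add)

lemma IZcoset_eq: "h \<in> IZ v \<Longrightarrow> IZcoset v (mmul h x) = IZcoset v x"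
proof (intro equalityI subsetI)
  assume h: "h \<in> IZ v"
  fix y
  {
    assume "y \<in> IZcoset v (mmul h x)"
    then obtain k where "k \<in> IZ v" "y = mmul (mmul k h) x" by (auto simp: IZcoset_def mmul_assoc)
    then show "y \<in> IZcoset v x" using IZ_mmul h by (auto simp: IZcoset_def)
  next
    assume "y \<in> IZcoset v x"
    then obtain k where k: "k \<in> IZ v" "y = mmul k x" by (auto simp: IZcoset_def)
    have "y = mmul (mmul k (minv h)) (mmul h x)"
      unfolding k mmul_assoc mmul_assoc[symmetric, of "minv h" h x] minv_left[OF IZ_GL2[OF h]] by simp
    then show "y \<in> IZcoset v (mmul h x)" using IZ_mmul IZ_minv h k(1) unfolding IZcoset_def by blast
  }
qed

lemma IZcoset_self: "x \<in> IZcoset v x"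
  unfolding IZcoset_def by (rule image_eqI[of _ _ Idm]) auto

lemma IZcoset_D: "IZcoset v x = IZcoset v y \<Longrightarrow> ro x y"
  using IZcoset_self[of x] by (auto simp: IZcoset_def ro_def)

lemma brk_val: "brk g x = (if x \<in> GL2 \<and> mmul x g \<in> IZ v then X (mmul x g) else 0)"
  by (simp add: br_def)

lemma brk_left: "h \<in> IZ v \<Longrightarrow> x \<in> GL2 \<Longrightarrow> brk g (mmul h x) = X h * brk g x"
  using IZ_left_iff[of h "mmul x g"] IZ_mmul[of h "mmul x g"] IZ_GL2
  by (auto simp: brk_val mmul_assoc)

lemma brk_ind: assumes "g \<in> GL2" shows "brk g \<in> ind"
proof -
  have "supp_cosets v (brk g) \<subseteq> {IZcoset v (minv g)}"
  proof
    fix C assume "C \<in> supp_cosets v (brk g)"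
    then obtain x where x: "C = IZcoset v x" "x \<in> GL2" "mmul x g \<in> IZ v"
      by (auto simp: supp_cosets_def brk_val split: if_splits)
    have "x = mmul (mmul x g) (minv g)" using assms by (simp add: mmul_assoc minv_right)
    then show "C \<in> {IZcoset v (minv g)}" using IZcoset_eq[OF x(3), of "minv g"] x(1) by simp
  qed
  then have "finite (supp_cosets v (brk g))" by (rule finite_subset) simp
  moreover have "brk g x = 0" if "x \<notin> GL2" for x using that by (simp add: brk_val)
  ultimately show ?thesis unfolding indG_def using brk_left by blast
qed

lemma act_ind: assumes "\<phi> \<in> ind" "g \<in> GL2" shows "act g \<phi> \<in> ind"
proof -
  have "supp_cosets v (act g \<phi>) \<subseteq> (\<lambda>C. (\<lambda>z. mmul z (minv g)) ` C) ` supp_cosets v \<phi>"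
  proof
    fix C assume "C \<in> supp_cosets v (act g \<phi>)"
    then obtain x where x: "C = IZcoset v x" "x \<in> GL2" "\<phi> (mmul x g) \<noteq> 0"
      by (auto simp: supp_cosets_def act_def)
    have "C = (\<lambda>z. mmul z (minv g)) ` IZcoset v (mmul x g)"
      using assms(2) by (simp add: x IZcoset_def image_image mmul_assoc minv_right)
    moreover have "IZcoset v (mmul x g) \<in> supp_cosets v \<phi>"
      unfolding supp_cosets_def using x assms GL2_mmul by blast
    ultimately show "C \<in> (\<lambda>C. (\<lambda>z. mmul z (minv g)) ` C) ` supp_cosets v \<phi>" by blast
  qed
  then have "finite (supp_cosets v (act g \<phi>))" by (rule finite_subset) (simp add: ind_fin assms)
  moreover have "act g \<phi> x = 0" if "x \<notin> GL2" for x using that assms by (simp add: act_def ind_out)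
  moreover have "act g \<phi> (mmul h x) = X h * act g \<phi> x" if "h \<in> IZ v" "x \<in> GL2" for h x
    using that assms by (simp add: act_def mmul_assoc ind_left)
  ultimately show ?thesis unfolding indG_def by blast
qed

lemma act_brk: "g \<in> GL2 \<Longrightarrow> act g (brk h) = brk (mmul g h)"
  by (auto simp: act_def brk_val mmul_assoc)

lemma act_act: "act g (act h \<phi>) = act (mmul g h) \<phi>"
  by (simp add: act_def mmul_assoc)

lemma act_sum: "act g (\<lambda>x. \<Sum>i\<in>A. \<phi> i x) = (\<lambda>x. \<Sum>i\<in>A. act g (\<phi> i) x)"
  and act_add: "act g (\<lambda>x. \<phi>1 x + \<phi>2 x) = (\<lambda>x. act g \<phi>1 x + act g \<phi>2 x)"
  and act_diff: "act g (\<lambda>x. \<phi>1 x - \<phi>2 x) = (\<lambda>x. act g \<phi>1 x - act g \<phi>2 x)"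
  and act_scale: "act g (\<lambda>x. c * \<phi>1 x) = (\<lambda>x. c * act g \<phi>1 x)"
  and act_0: "act g (\<lambda>x. 0) = (\<lambda>x. 0)"
  by (simp_all add: act_def)

lemma act_scal_pi: "\<phi> \<in> ind \<Longrightarrow> act (scal \<pi>) \<phi> = \<phi>"
proof
  fix x assume a: "\<phi> \<in> ind"
  show "act (scal \<pi>) \<phi> x = \<phi> x"
  proof (cases "x \<in> GL2")
    case True
    then show ?thesis using ind_left[OF a scal_IZ[OF pi_nz], of x] by (simp add: act_def scal_comm X_scal_pi)
  next
    case False
    then show ?thesis using a by (simp add: act_def ind_out)
  qed
qed

lemma bb: "\<phi> \<in> ind \<Longrightarrow> act bet (act bet \<phi>) = \<phi>"
  by (simp add: act_act bet_bet act_scal_pi)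

lemma bet_ind [simp]: "\<phi> \<in> ind \<Longrightarrow> act bet \<phi> \<in> ind"
  by (simp add: act_ind)

section \<open>Coordinates, unit vectors and levels\<close>

definition co :: "bool \<Rightarrow> nat \<Rightarrow> 'f \<Rightarrow> ('f m2 \<Rightarrow> 'k) \<Rightarrow> 'k" where
  "co t n x \<phi> = \<phi> (ci t n x)"

lemma co_add: "co t n x (\<lambda>y. \<phi> y + \<psi> y) = co t n x \<phi> + co t n x \<psi>"
  and co_diff: "co t n x (\<lambda>y. \<phi> y - \<psi> y) = co t n x \<phi> - co t n x \<psi>"
  and co_scale: "co t n x (\<lambda>y. c * \<phi> y) = c * co t n x \<phi>"
  and co_sum: "co t n x (\<lambda>y. \<Sum>i\<in>A. g i y) = (\<Sum>i\<in>A. co t n x (g i))"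
  and co_0: "co t n x (\<lambda>y. 0) = 0"
  by (simp_all add: co_def)

text \<open>Moving \<open>x\<close> by a multiple of \<open>\<pi> ^ n\<close> multiplies the
  representative on the left by a unipotent element of IZ, on which chi_r is 1.\<close>

lemma co_cong:
  assumes "\<phi> \<in> ind" "inn (int n) (x - y)" shows "co t n x \<phi> = co t n y \<phi>"
proof -
  let ?z = "(y - x) / \<pi> ^ n"
  have z: "inn 0 ?z" using assms(2) inn_sym by (simp add: inn_div_iff)
  have zz: "?z * \<pi> ^ n = y - x" by simp
  define h :: "'f m2" where "h = (if t then (1, 0, \<pi> * ?z, 1) else (1, ?z, 0, 1))"
  have "h \<in> IZ v" "X h = 1" using z by (auto simp: h_def IZ_iff chi_eq simp del: times_divide_eq_right)
  moreover have "ci t n x = mmul h (ci t n y)"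
    by (simp add: ci_def bt_def h_def betam_def Idm_def) (simp add: field_simps)
  ultimately show ?thesis using ind_left[OF assms(1)] by (simp add: co_def)
qed

text \<open>By \<open>coset_cover\<close> the two families of coordinates together meet every coset
  of IZ.\<close>

lemma ind_zeroI:
  assumes "\<phi> \<in> ind" "\<And>t n x. inn 0 x \<Longrightarrow> co t n x \<phi> = 0" "\<And>t n x. inn 0 x \<Longrightarrow> co t n x (act bet \<phi>) = 0"
  shows "\<phi> = (\<lambda>_. 0)"
proof
  fix y
  show "\<phi> y = 0"
  proof (cases "y \<in> GL2")
    case True
    then obtain s t n x where x: "inn 0 x" "ro y (mmul (ci t n x) (bt s))" using coset_cover by blast
    then obtain h where h: "h \<in> IZ v" "y = mmul h (mmul (ci t n x) (bt s))" by (auto simp: ro_def)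
    have "\<phi> (mmul (ci t n x) (bt s)) = 0"
      using assms(2,3)[OF x(1), of t n] by (cases s) (simp_all add: co_def bt_def act_def)
    then show ?thesis using ind_left[OF assms(1) h(1)] h(2) by simp
  qed (use assms ind_out in blast)
qed

lemma ind_eqI:
  assumes "\<phi> \<in> ind" "\<psi> \<in> ind" "\<And>t n x. inn 0 x \<Longrightarrow> co t n x \<phi> = co t n x \<psi>"
    "\<And>t n x. inn 0 x \<Longrightarrow> co t n x (act bet \<phi>) = co t n x (act bet \<psi>)"
  shows "\<phi> = \<psi>"
proof -
  have "(\<lambda>x. \<phi> x - \<psi> x) = (\<lambda>_. 0)"
    by (rule ind_zeroI) (use assms in \<open>auto simp: ind_diff co_diff act_diff\<close>)
  then show ?thesis by (metis (no_types, lifting) eq_iff_diff_eq_0 ext)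
qed

text \<open>At level 0 both halves describe the same two cosets, represented by \<open>Idm\<close>
  and \<open>bet\<close>, and right translation by \<open>bet\<close> exchanges them.\<close>

lemma co_bet_0: assumes "\<phi> \<in> ind" "inn 0 x" "inn 0 y" shows "co t 0 x (act bet \<phi>) = co (\<not> t) 0 y \<phi>"
proof -
  have 1: "co t 0 x (act bet \<phi>) = co t 0 0 (act bet \<phi>)" "co (\<not> t) 0 y \<phi> = co (\<not> t) 0 0 \<phi>"
    using assms by (auto intro!: co_cong)
  have i: "(1, 0, 0, 1) = Idm" by (simp add: Idm_def)
  show ?thesis
  proof (cases t)
    case True
    have "\<phi> (mmul (scal \<pi>) Idm) = \<phi> Idm" using ind_left[OF assms(1) scal_IZ[OF pi_nz] Idm_GL2] X_scal_pi by simp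
    then show ?thesis using True unfolding 1 by (simp add: co_def act_def ci_def bt_def i bet_bet)
  next
    case False
    then show ?thesis unfolding 1 by (simp add: co_def act_def ci_def bt_def i)
  qed
qed

definition gA :: "nat \<Rightarrow> 'f \<Rightarrow> 'f m2" where "gA n x = (\<pi> ^ n, x, 0, 1)"

definition E :: "bool \<Rightarrow> nat \<Rightarrow> 'f \<Rightarrow> 'f m2 \<Rightarrow> 'k" where "E t n x = brk (mmul (gA n x) (bt t))"

lemma gA_GL2 [simp]: "gA n x \<in> GL2" by (simp add: gA_def GL2_iff)

lemma E_ind [simp]: "E t n x \<in> ind" unfolding E_def by (rule brk_ind) simp

lemma up_pi_pow [simp]: "up (\<pi> ^ n) = 1" by (induction n) (auto simp: up_mult)

lemma co_E:
  assumes "inn 0 x" "inn 0 y"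
  shows "co t n x (E t' n' y) = (if t = t' \<and> n = n' \<and> inn (int n) (x - y) then 1 else 0)"
proof -
  have s: "inn m (x - y) \<longleftrightarrow> inn m (y - x)" for m using inn_sym by blast
  have M: "mmul (ci t n x) (mmul (gA n' y) (bt t')) = mmul (bt t) (mmul (\<pi> ^ n', y - x, 0, \<pi> ^ n) (bt t'))"
    by (simp add: ci_def gA_def mmul_assoc[symmetric] bt_def betam_def Idm_def algebra_simps)
  show ?thesis
    unfolding co_def E_def brk_val M s
    by (cases t; cases t') (auto simp: bt_def betam_def Idm_def IZ_iff chi_eq v_mult up_mult mult.commute[of _ \<pi>])
qed

lemma red_1_plus: "inn 1 z \<Longrightarrow> 1 + z \<noteq> 0 \<and> v (1 + z) = 0 \<and> up (1 + z) = 1"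
proof -
  assume z: "inn 1 z"
  then have "inn (v 1 + 1) ((1 + z) - 1)" by simp
  from v_cong[OF _ this] up_cong[OF _ this] show ?thesis by simp
qed

text \<open>In \<open>(a, b, c, d)\<close> the entry \<open>b\<close> is a 1-unit, \<open>c\<close>
  a power of \<open>\<pi>\<close>, and \<open>a\<close>, \<open>d\<close> lie in the maximal ideal.
  Such a matrix enters IZ only after multiplication by \<open>bet\<close> on exactly one side, and
  only if \<open>c\<close> has valuation 1.\<close>

lemma co_bE:
  assumes "inn 0 x" "inn 0 y"
  shows "co t n x (act bet (E t' n' y)) = (if n = 0 \<and> n' = 0 \<and> t \<noteq> t' then 1 else 0)"
proof -
  define a where "a = - (x * (\<pi> * \<pi> ^ n'))" 
  define b where "b = 1 + (- (x * (\<pi> * y)))" 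
  define c where "c = \<pi> ^ Suc (n + n')"
  define d where "d = \<pi> ^ Suc n * y"
  have b: "b \<noteq> 0" "v b = 0" "up b = 1"
    using red_1_plus[of "- (x * (\<pi> * y))"] assms inn_mult[of 0 x 1 "\<pi> * y"] by (auto simp: b_def)
  have a: "inn (1 + int n') a" using assms inn_mult[of 0 x "1 + int n'" "\<pi> * \<pi> ^ n'"] by (simp add: a_def)
  have a1: "inn 1 a" using a by (rule inn_mono) simp
  have c: "c \<noteq> 0" "v c = 1 + int n + int n'" "up c = 1" unfolding c_def v_pi_power up_pi_pow by auto
  have d: "inn (1 + int n) d" unfolding d_def inn_mult_pi_iff using assms by simp
  have d1: "inn 1 d" using d by (rule inn_mono) simp
  have M: "mmul (ci t n x) (mmul bet (mmul (gA n' y) (bt t'))) = mmul (bt t) (mmul (a, b, c, d) (bt t'))"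
    by (simp add: ci_def gA_def mmul_assoc[symmetric] bt_def betam_def Idm_def a_def b_def c_def d_def algebra_simps power_add)
  have eq: "co t n x (act bet (E t' n' y)) = (if mmul (bt t) (mmul (a, b, c, d) (bt t')) \<in> IZ v then X (mmul (bt t) (mmul (a, b, c, d) (bt t'))) else 0)"
    unfolding E_def act_brk[OF bet_GL2] co_def brk_val M by simp
  show ?thesis
  proof (cases t; cases t')
    assume t: "t" "t'"
    have "\<not> (a \<noteq> 0 \<and> v a \<le> 0)" using a by (auto simp: inO_def)
    then have "(\<pi> * d, c, \<pi> * (\<pi> * b), \<pi> * a) \<notin> IZ v" using b by (auto simp: IZ_iff v_mult inO_def)
    then show ?thesis unfolding eq using t by (simp add: bt_def betam_def mult.commute mult.left_commute)
  next
    assume t: "t" "\<not> t'"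
    have "(c, d, \<pi> * a, \<pi> * b) \<in> IZ v \<longleftrightarrow> n = 0 \<and> n' = 0" using b c d1 a1 by (auto simp: IZ_iff v_mult)
    then show ?thesis unfolding eq using t b by (simp add: bt_def betam_def Idm_def chi_eq up_mult)
  next
    assume t: "\<not> t" "t'"
    have "(\<pi> * b, a, \<pi> * d, c) \<in> IZ v \<longleftrightarrow> n = 0 \<and> n' = 0" using b c d1 a1 by (auto simp: IZ_iff v_mult)
    then show ?thesis unfolding eq using t c by (simp add: bt_def betam_def Idm_def chi_eq mult.commute)
  next
    assume t: "\<not> t" "\<not> t'"
    have "\<not> (d \<noteq> 0 \<and> v d \<le> 0)" using d by (auto simp: inO_def)
    then have "(a, b, c, d) \<notin> IZ v" using b by (auto simp: IZ_iff inO_def)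
    then show ?thesis unfolding eq using t by (simp add: bt_def Idm_def)
  qed
qed

text \<open>Different levels give different cosets, as evaluation of \<open>E\<close> shows, while
  the support consists of finitely many cosets.\<close>

lemma finite_level_half:
  assumes "\<phi> \<in> ind" shows "\<exists>N. \<forall>n>N. \<forall>t x. inn 0 x \<longrightarrow> co t n x \<phi> = 0"
proof -
  have fin: "finite {n. \<exists>x. inn 0 x \<and> co t n x \<phi> \<noteq> 0}" (is "finite ?S") for t
  proof -
    define x where "x n = (SOME x. inn 0 x \<and> co t n x \<phi> \<noteq> 0)" for n
    have x: "inn 0 (x n) \<and> co t n (x n) \<phi> \<noteq> 0" if "n \<in> ?S" for n
      using that unfolding x_def by (simp only: mem_Collect_eq) (rule someI_ex)
    have "(\<lambda>n. IZcoset v (ci t n (x n))) ` ?S \<subseteq> supp_cosets v \<phi>"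
    proof (rule image_subsetI)
      fix n assume "n \<in> ?S"
      then show "IZcoset v (ci t n (x n)) \<in> supp_cosets v \<phi>"
        unfolding supp_cosets_def using x[of n] ci_GL2 unfolding co_def by blast
    qed
    then have "finite ((\<lambda>n. IZcoset v (ci t n (x n))) ` ?S)" using ind_fin[OF assms] finite_subset by blast
    moreover have "inj_on (\<lambda>n. IZcoset v (ci t n (x n))) ?S"
    proof (rule inj_onI)
      fix n m assume nm: "n \<in> ?S" "m \<in> ?S" "IZcoset v (ci t n (x n)) = IZcoset v (ci t m (x m))"
      then obtain h where h: "h \<in> IZ v" "ci t n (x n) = mmul h (ci t m (x m))"
        using IZcoset_D unfolding ro_def by blast
      have "co t n (x n) (E t n (x n)) = 1" using x[OF nm(1)] by (simp add: co_E)
      then have "X h * co t m (x m) (E t n (x n)) = 1"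
        using ind_left[OF E_ind h(1) ci_GL2] by (simp add: co_def h(2))
      then show "n = m" using x[OF nm(1)] x[OF nm(2)] by (auto simp: co_E split: if_splits)
    qed
    ultimately show ?thesis using finite_imageD by blast
  qed
  define S where "S = {n. \<exists>x. inn 0 x \<and> co True n x \<phi> \<noteq> 0} \<union> {n. \<exists>x. inn 0 x \<and> co False n x \<phi> \<noteq> 0}"
  have "finite S" unfolding S_def using fin by blast
  then obtain N where N: "\<forall>n\<in>S. n \<le> N" using finite_nat_set_iff_bounded_le by blast
  have "co t n x \<phi> = 0" if "n > N" "inn 0 x" for n t x
  proof (rule ccontr)
    assume "co t n x \<phi> \<noteq> 0"
    then have "n \<in> S" using that by (cases t) (auto simp: S_def)
    then show False using N that by auto
  qed
  then show ?thesis by blast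
qed

text \<open>The bound is imposed on both halves of the tree; \<open>act bet\<close> brings the
  second half into view.\<close>

definition lev :: "nat \<Rightarrow> ('f m2 \<Rightarrow> 'k) \<Rightarrow> bool" where
  "lev N \<phi> \<longleftrightarrow> (\<forall>n>N. \<forall>t x. inn 0 x \<longrightarrow> co t n x \<phi> = 0 \<and> co t n x (act bet \<phi>) = 0)"

lemma levD: "lev N \<phi> \<Longrightarrow> n > N \<Longrightarrow> inn 0 x \<Longrightarrow> co t n x \<phi> = 0"
  "lev N \<phi> \<Longrightarrow> n > N \<Longrightarrow> inn 0 x \<Longrightarrow> co t n x (act bet \<phi>) = 0"
  by (auto simp: lev_def)

lemma lev_mono: "lev N \<phi> \<Longrightarrow> N \<le> M \<Longrightarrow> lev M \<phi>"
  by (auto simp: lev_def)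

lemma lev_exists: assumes "\<phi> \<in> ind" shows "\<exists>N. lev N \<phi>"
proof -
  obtain N M where N: "\<forall>n>N. \<forall>t x. inn 0 x \<longrightarrow> co t n x \<phi> = 0"
    and M: "\<forall>n>M. \<forall>t x. inn 0 x \<longrightarrow> co t n x (act bet \<phi>) = 0"
    using finite_level_half[OF assms] finite_level_half[of "act bet \<phi>"] assms by auto
  have "lev (max N M) \<phi>" using N M by (auto simp: lev_def)
  then show ?thesis ..
qed

lemma lev_bet: "\<phi> \<in> ind \<Longrightarrow> lev N \<phi> \<Longrightarrow> lev N (act bet \<phi>)"
  by (auto simp: lev_def bb)

lemma lev_diff: "lev N \<phi> \<Longrightarrow> lev N \<psi> \<Longrightarrow> lev N (\<lambda>x. \<phi> x - \<psi> x)"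
  by (auto simp: lev_def co_diff act_diff)

lemma lev_scale: "lev N \<phi> \<Longrightarrow> lev N (\<lambda>x. c * \<phi> x)"
  by (auto simp: lev_def co_scale act_scale)

lemma lev_sum: "(\<And>i. i \<in> A \<Longrightarrow> lev N (g i)) \<Longrightarrow> lev N (\<lambda>x. \<Sum>i\<in>A. g i x)"
  by (auto simp: lev_def co_sum act_sum)

lemma lev_E: "inn 0 y \<Longrightarrow> m \<le> N \<Longrightarrow> lev N (E t m y)"
  by (auto simp: lev_def co_E co_bE)

section \<open>The Hecke operators as finite sums\<close>

lemma I1set_sum: "(\<Sum>l\<in>I1set v red q. g l) = (\<Sum>m\<in>FF. g (tc m))"
  unfolding I1set_def using sum.reindex[OF tc_inj] by simp

lemma supp_rep:
  assumes "\<phi> \<in> ind" "C \<in> supp_cosets v \<phi>"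
  shows "(SOME x. x \<in> C) \<in> GL2 \<and> C = IZcoset v (SOME x. x \<in> C)"
proof -
  obtain x0 where x0: "C = IZcoset v x0" "x0 \<in> GL2" using assms(2) unfolding supp_cosets_def by blast
  then have "x0 \<in> C" using IZcoset_self by blast
  then have "(SOME x. x \<in> C) \<in> C" by (rule someI)
  then obtain h where h: "h \<in> IZ v" "(SOME x. x \<in> C) = mmul h x0" unfolding x0(1) IZcoset_def by blast
  show ?thesis unfolding h(2) using h(1) x0 IZcoset_eq IZ_GL2 by auto
qed

lemma hecke_ind:
  assumes "\<phi> \<in> ind" "\<And>m. m \<in> FF \<Longrightarrow> M (tc m) \<in> GL2"
  shows "hecke v red \<pi> r q M \<phi> \<in> ind"
  unfolding hecke_def Let_def I1set_sum
  by (intro ind_sum ind_scale brk_ind) (use assms supp_rep in auto)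

text \<open>Dual description of a Hecke operator: the left cosets IZ N(m) play for evaluation the role
that the right cosets M(lam) IZ play for the generators [g,1].\<close>

lemma hecke_adjoint:
  assumes GL: "\<And>m. m \<in> FF \<Longrightarrow> M (tc m) \<in> GL2 \<and> N m \<in> GL2"
    and hit: "\<And>h m. h \<in> IZ v \<Longrightarrow> m \<in> FF \<Longrightarrow> \<exists>m'\<in>FF. ro (mmul (M (tc m)) h) (N m')"
    and uni: "\<And>j m'. j \<in> IZ v \<Longrightarrow> m' \<in> FF \<Longrightarrow> \<exists>m0\<in>FF.
       (\<forall>m\<in>FF. mmul (minv (N m')) (mmul j (M (tc m))) \<in> IZ v \<longleftrightarrow> m = m0) \<and>
       X (mmul (minv (N m')) (mmul j (M (tc m0)))) = X j"
    and dis: "\<And>m m'. m \<in> FF \<Longrightarrow> m' \<in> FF \<Longrightarrow> ro (N m) (N m') \<Longrightarrow> m = m'"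
    and phi: "\<phi> \<in> ind" and y: "y \<in> GL2"
  shows "hecke v red \<pi> r q M \<phi> y = (\<Sum>m\<in>FF. \<phi> (mmul (N m) y))"
proof -
  \<comment> \<open>\<open>F x\<close> is the summand of \<open>hecke\<close> at \<open>y\<close>
    for the coset of \<open>x\<close>. By \<open>A\<close> the representative chosen in the coset of
    \<open>N m' y\<close> is immaterial, and by \<open>B\<close> only these cosets
    contribute.\<close>
  define F where "F x = \<phi> x * (\<Sum>m\<in>FF. brk (mmul (minv x) (M (tc m))) y)" for x
  define rep where "rep C = (SOME x. x \<in> C)" for C :: "'f m2 set"
  define CN where "CN m = IZcoset v (mmul (N m) y)" for m
  have NG: "mmul (N m) y \<in> GL2" if "m \<in> FF" for m using GL[OF that] y by simp
  have A: "F x = \<phi> (mmul (N m') y)" if m': "m' \<in> FF" and x: "ro x (mmul (N m') y)" for m' x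
  proof -
    obtain k where k: "k \<in> IZ v" "x = mmul k (mmul (N m') y)" using x unfolding ro_def by blast
    define j where "j = minv k"
    have j: "j \<in> IZ v" using IZ_minv k j_def by blast
    obtain m0 where m0: "m0 \<in> FF" "\<And>m. m \<in> FF \<Longrightarrow> mmul (minv (N m')) (mmul j (M (tc m))) \<in> IZ v \<longleftrightarrow> m = m0"
      "X (mmul (minv (N m')) (mmul j (M (tc m0)))) = X j"
      using uni[OF j m'] by blast
    have "minv x = mmul (minv y) (mmul (minv (N m')) j)"
      using GL[OF m'] y IZ_GL2[OF k(1)] NG[OF m'] by (simp add: k(2) minv_mmul j_def mmul_assoc)
    then have e: "mmul y (mmul (minv x) (M (tc m))) = mmul (minv (N m')) (mmul j (M (tc m)))" for m
      using y by (simp add: mmul_assoc) (simp add: mmul_assoc[symmetric] minv_right)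
    have "(\<Sum>m\<in>FF. brk (mmul (minv x) (M (tc m))) y) = (\<Sum>m\<in>FF. if m = m0 then X j else 0)"
      unfolding brk_val e using y m0 by (intro sum.cong) auto
    also have "\<dots> = X j" using m0(1) by simp
    finally have "F x = X k * \<phi> (mmul (N m') y) * X j"
      using ind_left[OF phi k(1) NG[OF m']] by (simp add: F_def k(2))
    then show ?thesis using chi_minv[OF k(1)] by (simp add: j_def mult.commute mult.left_commute)
  qed
  have B: "\<exists>m'\<in>FF. IZcoset v x = CN m'" if x: "x \<in> GL2" "F x \<noteq> 0" for x
  proof -
    obtain m where m: "m \<in> FF" "brk (mmul (minv x) (M (tc m))) y \<noteq> 0"
      using x(2) by (auto simp: F_def dest: sum.not_neutral_contains_not_neutral)
    define h where "h = mmul y (mmul (minv x) (M (tc m)))"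
    have h: "h \<in> IZ v" using m(2) by (auto simp: brk_val h_def split: if_splits)
    have "mmul x (mmul (minv y) h) = M (tc m)"
      unfolding h_def using y x(1) by (simp add: mmul_assoc[symmetric] minv_left minv_right)
    then have "mmul (mmul (M (tc m)) (minv h)) y = x"
      using y IZ_GL2[OF h] by (simp add: mmul_assoc minv_left minv_right flip: \<open>mmul x (mmul (minv y) h) = M (tc m)\<close>)
    moreover obtain m' where m': "m' \<in> FF" "ro (mmul (M (tc m)) (minv h)) (N m')"
      using hit[OF IZ_minv[OF h] m(1)] by blast
    ultimately have "ro x (mmul (N m') y)" using ro_right by blast
    then have "IZcoset v x = CN m'" unfolding ro_def CN_def using IZcoset_eq by blast
    then show ?thesis using m'(1) by blast
  qed
  have repN: "ro (rep (CN m)) (mmul (N m) y)" for m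
  proof -
    have "rep (CN m) \<in> CN m" unfolding rep_def by (rule someI[of _ "mmul (N m) y"]) (simp add: CN_def IZcoset_self)
    then show ?thesis unfolding CN_def IZcoset_def ro_def by blast
  qed
  have "hecke v red \<pi> r q M \<phi> y = (\<Sum>C\<in>supp_cosets v \<phi>. F (rep C))"
    unfolding hecke_def Let_def I1set_sum F_def rep_def by simp
  also have "\<dots> = (\<Sum>C\<in>CN ` FF. F (rep C))"
  proof (rule sum.mono_neutral_cong)
    fix C assume "C \<in> CN ` FF - supp_cosets v \<phi>"
    then obtain m where m: "m \<in> FF" "C = CN m" "CN m \<notin> supp_cosets v \<phi>" by auto
    then have "\<phi> (mmul (N m) y) = 0" using NG unfolding supp_cosets_def CN_def by blast
    then show "F (rep C) = 0" using A[OF m(1) repN] m(2) by simp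
  next
    fix C assume C: "C \<in> supp_cosets v \<phi> - CN ` FF"
    then have "rep C \<in> GL2" "C = IZcoset v (rep C)" using supp_rep[OF phi] by (auto simp: rep_def)
    then show "F (rep C) = 0" using B C by blast
  qed (use ind_fin[OF phi] in auto)
  also have "\<dots> = (\<Sum>m\<in>FF. F (rep (CN m)))"
  proof (rule sum.reindex_cong[OF _ refl refl])
    show "inj_on CN FF"
    proof (rule inj_onI)
      fix m m' assume mm: "m \<in> FF" "m' \<in> FF" "CN m = CN m'"
      then have "ro (mmul (N m) y) (mmul (N m') y)" using IZcoset_D unfolding CN_def by blast
      then have "ro (mmul (mmul (N m) y) (minv y)) (mmul (mmul (N m') y) (minv y))" by (rule ro_right)
      then have "ro (N m) (N m')" using y by (simp add: mmul_assoc minv_right)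
      then show "m = m'" using dis mm by blast
    qed
  qed
  also have "\<dots> = (\<Sum>m\<in>FF. \<phi> (mmul (N m) y))" using A repN by (intro sum.cong) auto
  finally show ?thesis .
qed

section \<open>T_{-1,0}, and T_{1,2} as its conjugate by beta\<close>

definition M0 :: "'f \<Rightarrow> 'f m2" where "M0 l = (\<pi>, l, 0, 1)"
text \<open>\<open>M0\<close> represents cosets g IZ and \<open>N0\<close> cosets IZ g of one and
  the same double coset.\<close>

definition N0 :: "'k \<Rightarrow> 'f m2" where "N0 m = (\<pi>, 0, - \<pi> * tc m, 1)"
definition cj :: "'f m2 \<Rightarrow> 'f m2" where "cj g = mmul (mmul bet g) (minv bet)"

lemma M0_GL2 [simp]: "M0 l \<in> GL2" and N0_GL2 [simp]: "N0 m \<in> GL2"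
  by (simp_all add: M0_def N0_def GL2_iff)

lemma minv_bet: "minv bet = (0, 1 / \<pi>, 1, 0)" by (simp add: betam_def minv_eq)

lemma minv_N0: "minv (N0 m) = (1 / \<pi>, 0, tc m, 1)" by (simp add: N0_def minv_eq)

lemma cj_eq: "cj (a, b, c, d) = (d, c / \<pi>, \<pi> * b, a)"
  unfolding cj_def minv_bet by (simp add: betam_def)

lemma cj_mmul: "cj (mmul g h) = mmul (cj g) (cj h)"
  unfolding cj_def by (simp add: mmul_assoc) (simp add: mmul_assoc[symmetric] minv_left)

lemma cj_GL2 [simp]: "cj g \<in> GL2 \<longleftrightarrow> g \<in> GL2"
  unfolding cj_def by simp

lemma cj_Idm: "cj Idm = Idm" by (simp add: Idm_def cj_eq)

lemma cj_minv: "g \<in> GL2 \<Longrightarrow> minv (cj g) = cj (minv g)"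
  by (rule minv_unique) (auto simp: cj_mmul[symmetric] minv_right cj_Idm)

lemma cj_IZ [simp]: "cj g \<in> IZ v \<longleftrightarrow> g \<in> IZ v"
  by (cases g) (auto simp: cj_eq IZ_iff inn_div_iff)

lemma cj_surj: "h \<in> IZ v \<Longrightarrow> \<exists>h'\<in>IZ v. h = cj h'"
proof -
  assume h: "h \<in> IZ v"
  obtain a b c d where "h = (a, b, c, d)" by (cases h)
  then have "h = cj (d, c / \<pi>, \<pi> * b, a)" by (simp add: cj_eq)
  then show ?thesis using h cj_IZ by metis
qed

lemma cj_inj: "cj g = cj h \<Longrightarrow> g = h"
  by (cases g; cases h) (auto simp: cj_eq)

lemma ro_cj: "ro (cj x) (cj y) \<longleftrightarrow> ro x y"
proof
  assume "ro (cj x) (cj y)"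
  then obtain h where "h \<in> IZ v" "cj x = mmul h (cj y)" by (auto simp: ro_def)
  then obtain h' where "h' \<in> IZ v" "cj x = cj (mmul h' y)" using cj_surj cj_mmul by metis
  then show "ro x y" using cj_inj roI by blast
next
  assume "ro x y"
  then show "ro (cj x) (cj y)" unfolding ro_def using cj_mmul cj_IZ by metis
qed

text \<open>The residue \<open>m0\<close> of \<open>- b / a\<close> is the one that puts
  \<open>a * tc m + b\<close> one valuation deeper. The character is recorded also after
  \<open>cj\<close>: conjugation by beta carries the matrices of T_{-1,0} to those of T_{1,2}, but
  it does not preserve chi_r.\<close>

lemma N0_uni:
  assumes "j \<in> IZ v" "m' \<in> FF"
  shows "\<exists>m0\<in>FF. (\<forall>m\<in>FF. mmul (minv (N0 m')) (mmul j (M0 (tc m))) \<in> IZ v \<longleftrightarrow> m = m0) \<and>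
       X (mmul (minv (N0 m')) (mmul j (M0 (tc m0)))) = X j \<and>
       X (cj (mmul (minv (N0 m')) (mmul j (M0 (tc m0))))) = X (cj j)"
proof -
  obtain a b c d where j: "j = (a, b, c, d)" by (cases j)
  have J: "a \<noteq> 0" "d \<noteq> 0" "v a = v d" "inn (v d) b" "inn (v d + 1) c" using assms(1) unfolding j IZ_iff by auto
  define m0 where "m0 = red (- b / a)"
  have ba: "inn 0 (- b / a)" using J by (simp add: inn_div_iff)
  have m0: "m0 \<in> FF" using ba by (simp add: m0_def)
  have Y: "mmul (minv (N0 m')) (mmul j (M0 (tc m))) =
     (a, (a * tc m + b) / \<pi>, \<pi> * (tc m' * a + c), tc m' * (a * tc m + b) + (c * tc m + d))" for m
    by (simp add: minv_N0 M0_def j algebra_simps add_divide_distrib)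
  have key: "inn (v d + 1) (a * tc m + b) \<longleftrightarrow> m = m0" if "m \<in> FF" for m
  proof -
    have "m = m0 \<longleftrightarrow> inn 1 (tc m - (- b / a))"
      using red_eq_iff[of "tc m" "- b / a"] that ba by (simp add: m0_def)
    also have "tc m - (- b / a) = (a * tc m + b) / a" using J by (simp add: field_simps)
    finally show ?thesis using J by (simp add: inn_div_iff add.commute)
  qed
  have dd: "inn (v d + 1) ((tc m0 * c + tc m' * (a * tc m0 + b)) + d - d)"
  proof -
    have "inn (v d + 1) (tc m0 * c + tc m' * (a * tc m0 + b))"
      using key[OF m0] m0 assms(2) J by (auto intro!: inn_add[of _ "tc m0 * c"] inn_mult_left)
    then show ?thesis by simp
  qed
  have comm: "tc m' * (a * tc m0 + b) + (c * tc m0 + d) = tc m0 * c + tc m' * (a * tc m0 + b) + d"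
    by (simp add: algebra_simps)
  note vd = v_cong[OF J(2) dd] and ud = up_cong[OF J(2) dd]
  have iff: "mmul (minv (N0 m')) (mmul j (M0 (tc m))) \<in> IZ v \<longleftrightarrow> m = m0" if m: "m \<in> FF" for m
  proof
    assume "mmul (minv (N0 m')) (mmul j (M0 (tc m))) \<in> IZ v"
    then have "inn (v d + 1) (a * tc m + b)" unfolding Y IZ_iff using J by (auto simp: inn_div_iff)
    then show "m = m0" using key m by simp
  next
    assume mm: "m = m0"
    have "inn (v d) a" using J by (simp add: inO_def)
    then have "inn (v d) (tc m' * a + c)" using J assms(2) inn_mono[OF J(5), of "v d"]
      by (intro inn_add inn_mult_left) auto
    then show "mmul (minv (N0 m')) (mmul j (M0 (tc m))) \<in> IZ v"
      unfolding Y IZ_iff mm comm using vd key[OF m0] J by (auto simp: inn_div_iff)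
  qed
  have X: "X (mmul (minv (N0 m')) (mmul j (M0 (tc m0)))) = X j"
    unfolding Y chi_eq comm ud unfolding j chi_eq ..
  have Xc: "X (cj (mmul (minv (N0 m')) (mmul j (M0 (tc m0))))) = X (cj j)"
    unfolding Y cj_eq chi_eq unfolding j chi_eq cj_eq ..
  show ?thesis using m0 iff X Xc by blast
qed

lemma N0_hit:
  assumes "h \<in> IZ v" "m \<in> FF" shows "\<exists>m'\<in>FF. ro (mmul (M0 (tc m)) h) (N0 m')"
proof -
  obtain a b c d where h: "h = (a, b, c, d)" by (cases h)
  have H: "a \<noteq> 0" "d \<noteq> 0" "v a = v d" "inn (v d) b" "inn (v d + 1) c" using assms(1) unfolding h IZ_iff by auto
  have cd: "inn 0 (- c / (\<pi> * d))" using H by (simp add: inn_div_iff v_mult add.commute)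
  \<comment> \<open>Chosen so that \<open>c + \<pi> * d * tc m'\<close> gains one valuation; after
    division by \<open>\<pi>\<close> the left factor is still in IZ.\<close>
  define m' where "m' = red (- c / (\<pi> * d))"
  have m': "m' \<in> FF" using cd by (simp add: m'_def)
  have "inn 1 (tc m' - (- c / (\<pi> * d)))" using red_eq_iff[of "tc m'" "- c / (\<pi> * d)"] m' cd by (simp add: m'_def)
  also have "tc m' - (- c / (\<pi> * d)) = (c + \<pi> * d * tc m') / (\<pi> * d)" using H by (simp add: field_simps)
  finally have c1: "inn (v d + 2) (c + \<pi> * d * tc m')" using H by (simp add: inn_div_iff v_mult add.commute)
  have bb: "inn (v d + 1) (\<pi> * b * tc m')" using H m' inn_mult_right[of "v d + 1" "\<pi> * b" "tc m'"] by simp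
  have aa: "inn (v a + 1) ((a + \<pi> * b * tc m') - a)" using bb H by simp
  note va = v_cong[OF H(1) aa]
  have z: "(a + \<pi> * b * tc m', \<pi> * b, (c + \<pi> * d * tc m') / \<pi>, d) \<in> IZ v"
    unfolding IZ_iff using va H c1 inn_mono[OF H(4), of "v d - 1"] by (auto simp: inn_div_iff add.commute)
  have t: "(1, tc m, 0, 1) \<in> IZ v" using assms(2) by (simp add: IZ_iff)
  have "mmul (M0 (tc m)) h = mmul (mmul (1, tc m, 0, 1) (a + \<pi> * b * tc m', \<pi> * b, (c + \<pi> * d * tc m') / \<pi>, d)) (N0 m')"
    by (simp add: M0_def N0_def h field_simps)
  then show ?thesis using roI IZ_mmul[OF t z] m' by blast
qed

lemma N0_dis:
  assumes "m \<in> FF" "m' \<in> FF" "ro (N0 m) (N0 m')" shows "m = m'"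
proof -
  obtain h where h: "h \<in> IZ v" "N0 m = mmul h (N0 m')" using assms(3) by (auto simp: ro_def)
  obtain a b c d where hh: "h = (a, b, c, d)" by (cases h)
  have "b = 0" "d = 1" "c * \<pi> - \<pi> * tc m' = - \<pi> * tc m" using h(2) by (auto simp: N0_def hh)
  moreover have "c = tc m' - tc m" using calculation(3) by (simp add: algebra_simps) (metis add_diff_cancel_left' distrib_left mult_left_cancel pi_nz diff_add_cancel add.commute)
  ultimately have "inn 1 (tc m' - tc m)" using h(1) unfolding hh IZ_iff by simp
  then show ?thesis using tc_cong assms by metis
qed

lemma Tm10_adj: "\<phi> \<in> ind \<Longrightarrow> y \<in> GL2 \<Longrightarrow> Tm10 v red \<pi> r q \<phi> y = (\<Sum>m\<in>FF. \<phi> (mmul (N0 m) y))"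
  unfolding Tm10_def M0_def[symmetric]
  by (rule hecke_adjoint) (simp_all add: N0_hit N0_dis, use N0_uni in blast)

lemma T12_adj: "\<phi> \<in> ind \<Longrightarrow> y \<in> GL2 \<Longrightarrow> T12 v red \<pi> r q \<phi> y = (\<Sum>m\<in>FF. \<phi> (mmul (cj (N0 m)) y))"
proof -
  assume a: "\<phi> \<in> ind" "y \<in> GL2"
  have M: "(\<lambda>lam. mmul (mmul bet (1, lam, 0, 1)) wm) = (\<lambda>lam. cj (M0 lam))"
    by (rule ext) (simp add: M0_def cj_eq wm_def betam_def)
  show ?thesis unfolding T12_def M
  proof (rule hecke_adjoint[OF _ _ _ _ a])
    fix h m assume "h \<in> IZ v" "m \<in> FF"
    moreover from this obtain h' where "h' \<in> IZ v" "h = cj h'" using cj_surj by blast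
    ultimately show "\<exists>m'\<in>FF. ro (mmul (cj (M0 (tc m))) h) (cj (N0 m'))"
      using N0_hit by (simp add: cj_mmul[symmetric] ro_cj)
  next
    fix j m' assume "j \<in> IZ v" "m' \<in> FF"
    moreover from this obtain h' where h': "h' \<in> IZ v" "j = cj h'" using cj_surj by blast
    ultimately show "\<exists>m0\<in>FF. (\<forall>m\<in>FF. (mmul (minv (cj (N0 m'))) (mmul j (cj (M0 (tc m)))) \<in> IZ v) = (m = m0)) \<and>
           X (mmul (minv (cj (N0 m'))) (mmul j (cj (M0 (tc m0))))) = X j"
      using N0_uni[OF h'(1), of m'] unfolding h'(2) cj_minv[OF N0_GL2] cj_mmul[symmetric] cj_IZ by blast
  qed (use N0_dis in \<open>auto simp: ro_cj\<close>)
qed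

definition TT :: "bool \<Rightarrow> ('f m2 \<Rightarrow> 'k) \<Rightarrow> ('f m2 \<Rightarrow> 'k)" where
  "TT t = (if t then Tm10 v red \<pi> r q else T12 v red \<pi> r q)"

definition NN :: "bool \<Rightarrow> 'k \<Rightarrow> 'f m2" where "NN t m = (if t then N0 m else cj (N0 m))"

lemma NN_GL2 [simp]: "NN t m \<in> GL2" by (simp add: NN_def)

lemma TT_adj: "\<phi> \<in> ind \<Longrightarrow> y \<in> GL2 \<Longrightarrow> TT t \<phi> y = (\<Sum>m\<in>FF. \<phi> (mmul (NN t m) y))"
  by (simp add: TT_def NN_def Tm10_adj T12_adj)

lemma TT_ind: "\<phi> \<in> ind \<Longrightarrow> TT t \<phi> \<in> ind"
  unfolding TT_def Tm10_def T12_def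
  by (cases t) (auto intro!: hecke_ind simp: GL2_iff betam_def wm_def)

lemma TT_act: assumes "\<phi> \<in> ind" "g \<in> GL2" shows "TT t (act g \<phi>) = act g (TT t \<phi>)"
proof
  fix y
  show "TT t (act g \<phi>) y = act g (TT t \<phi>) y"
  proof (cases "y \<in> GL2")
    case True
    then show ?thesis using assms act_ind by (simp add: act_def TT_adj[OF act_ind, unfolded act_def] TT_adj mmul_assoc)
  next
    case False
    then show ?thesis using ind_out[OF TT_ind[OF act_ind[OF assms]] False]
      ind_out[OF act_ind[OF TT_ind[OF assms(1)] assms(2)] False] by simp
  qed
qed

section \<open>The two kernels and their sum\<close>

definition Ker :: "bool \<Rightarrow> ('f m2 \<Rightarrow> 'k) set" where "Ker t = {\<phi> \<in> ind. TT t \<phi> = (\<lambda>_. 0)}"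

lemma Ker_iff: "\<phi> \<in> Ker t \<longleftrightarrow> \<phi> \<in> ind \<and> (\<forall>y\<in>GL2. (\<Sum>m\<in>FF. \<phi> (mmul (NN t m) y)) = 0)"
proof -
  have "TT t \<phi> = (\<lambda>_. 0) \<longleftrightarrow> (\<forall>y\<in>GL2. TT t \<phi> y = 0)" if "\<phi> \<in> ind"
    using ind_out[OF TT_ind[OF that]] by (metis ext)
  then show ?thesis by (auto simp: Ker_def TT_adj)
qed

lemma Ker_ind: "\<phi> \<in> Ker t \<Longrightarrow> \<phi> \<in> ind" by (simp add: Ker_def)

lemma Ker_add: "\<phi> \<in> Ker t \<Longrightarrow> \<psi> \<in> Ker t \<Longrightarrow> (\<lambda>x. \<phi> x + \<psi> x) \<in> Ker t"
  unfolding Ker_iff by (auto simp: ind_add sum.distrib)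

lemma Ker_scale: "\<phi> \<in> Ker t \<Longrightarrow> (\<lambda>x. c * \<phi> x) \<in> Ker t"
  unfolding Ker_iff by (auto simp: ind_scale sum_distrib_left[symmetric])

lemma Ker_0: "(\<lambda>_. 0) \<in> Ker t"
  unfolding Ker_iff by simp

lemma Ker_act: "\<phi> \<in> Ker t \<Longrightarrow> g \<in> GL2 \<Longrightarrow> act g \<phi> \<in> Ker t"
  unfolding Ker_def by (auto simp: act_ind TT_act act_0)

abbreviation "W \<equiv> Wsub v red \<pi> r q"

text \<open>Available with either kernel first, so that later arguments can treat both values of
  \<open>t\<close> at once.\<close>

lemma W_iff: "\<psi> \<in> W \<longleftrightarrow> (\<exists>\<phi>1\<in>Ker t. \<exists>\<phi>2\<in>Ker (\<not> t). \<psi> = (\<lambda>x. \<phi>1 x + \<phi>2 x))"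
proof -
  have "\<psi> \<in> W \<longleftrightarrow> (\<exists>\<phi>1\<in>Ker True. \<exists>\<phi>2\<in>Ker False. \<psi> = (\<lambda>x. \<phi>1 x + \<phi>2 x))"
    unfolding Wsub_def Ker_def TT_def by auto
  moreover have "(\<exists>\<phi>1\<in>A. \<exists>\<phi>2\<in>B. \<psi> = (\<lambda>x. \<phi>1 x + \<phi>2 x)) \<longleftrightarrow> (\<exists>\<phi>1\<in>B. \<exists>\<phi>2\<in>A. \<psi> = (\<lambda>x. \<phi>1 x + \<phi>2 x))" for A B
    by (subst add.commute) blast
  ultimately show ?thesis by (cases t) simp_all
qed

lemma Ker_W: "\<phi> \<in> Ker t \<Longrightarrow> \<phi> \<in> W"
  unfolding W_iff[of \<phi> t] by (rule bexI[of _ \<phi>], rule bexI[of _ "\<lambda>_. 0"]) (auto simp: Ker_0)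

lemma W_ind: "\<phi> \<in> W \<Longrightarrow> \<phi> \<in> ind"
  unfolding W_iff[of \<phi> True] using Ker_ind ind_add by auto

lemma W_0: "(\<lambda>_. 0) \<in> W"
  using Ker_W Ker_0 by blast

lemma W_add: assumes "\<phi> \<in> W" "\<psi> \<in> W" shows "(\<lambda>x. \<phi> x + \<psi> x) \<in> W"
proof -
  obtain a b c d where ab: "a \<in> Ker True" "b \<in> Ker False" "\<phi> = (\<lambda>x. a x + b x)"
    "c \<in> Ker True" "d \<in> Ker False" "\<psi> = (\<lambda>x. c x + d x)"
    using assms unfolding W_iff[of _ True] by auto
  have "(\<lambda>x. \<phi> x + \<psi> x) = (\<lambda>x. (a x + c x) + (b x + d x))" by (simp add: ab algebra_simps)
  then show ?thesis unfolding W_iff[of _ True] using ab Ker_add[OF ab(1,4)] Ker_add[OF ab(2,5)] by auto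
qed

lemma W_scale: assumes "\<phi> \<in> W" shows "(\<lambda>x. c * \<phi> x) \<in> W"
proof -
  obtain a b where ab: "a \<in> Ker True" "b \<in> Ker False" "\<phi> = (\<lambda>x. a x + b x)"
    using assms unfolding W_iff[of _ True] by auto
  show ?thesis unfolding W_iff[of _ True]
    by (rule bexI[OF _ Ker_scale[OF ab(1), of c]], rule bexI[of _ "\<lambda>x. c * b x"])
       (use ab Ker_scale in \<open>simp_all add: distrib_left\<close>)
qed

lemma W_diff: "\<phi> \<in> W \<Longrightarrow> \<psi> \<in> W \<Longrightarrow> (\<lambda>x. \<phi> x - \<psi> x) \<in> W"
  using W_add[of \<phi> "\<lambda>x. (-1) * \<psi> x"] W_scale[of \<psi> "-1"] by simp

lemma W_sum: "(\<And>i. i \<in> A \<Longrightarrow> g i \<in> W) \<Longrightarrow> (\<lambda>x. \<Sum>i\<in>A. g i x) \<in> W"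
  by (induction A rule: infinite_finite_induct) (auto intro: W_add W_0)

lemma W_act: assumes "\<phi> \<in> W" "g \<in> GL2" shows "act g \<phi> \<in> W"
proof -
  obtain a b where ab: "a \<in> Ker True" "b \<in> Ker False" "\<phi> = (\<lambda>x. a x + b x)"
    using assms unfolding W_iff[of _ True] by auto
  then show ?thesis unfolding W_iff[of _ True] using Ker_act[OF _ assms(2)] by (auto simp: act_add)
qed

text \<open>Throughout, t = True goes with the vectors t_n and the operator T_{-1,0}, and t = False with s_n
and T_{1,2}: the kernel of the operator t is described by H t (see co_TT_other).\<close>

definition kap :: "bool \<Rightarrow> 'k \<Rightarrow> 'k" where
  "kap t m = (if t then (- m) ^ (q - 1 - r) else m ^ r)"

definition H :: "bool \<Rightarrow> nat \<Rightarrow> 'f \<Rightarrow> ('f m2 \<Rightarrow> 'k) \<Rightarrow> 'k" where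
  "H t n x \<phi> = (\<Sum>m\<in>FF. kap t m * co t n (x + \<pi> ^ (n - 1) * tc m) \<phi>)"

lemma co_TT_same: "\<phi> \<in> ind \<Longrightarrow> co t n x (TT t \<phi>) = (\<Sum>m\<in>FF. co t (Suc n) (x + \<pi> ^ n * tc m) \<phi>)"
  unfolding co_def TT_adj[OF _ ci_GL2]
  by (intro sum.cong refl)
     (cases t, simp_all add: NN_def N0_def cj_eq ci_def bt_def betam_def Idm_def algebra_simps)

text \<open>The term \<open>m = 0\<close> is the edge one level lower, up to the scalar
  \<open>\<pi>\<close>. Every other term leads to an edge of the same level and opposite type whose
  last digit is shifted by \<open>inverse m\<close>; the price is a factor \<open>h\<close> in IZ,
  and its character is the weight \<open>kap\<close>.\<close>

lemma co_TT_other: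
  assumes phi: "\<phi> \<in> ind" and n: "n \<ge> 1"
  shows "co (\<not> t) n x (TT t \<phi>) = co (\<not> t) (n - 1) x \<phi> + H t n x \<phi>"
proof -
  define y where "y = ci (\<not> t) n x"
  have pn: "\<pi> ^ n = \<pi> * \<pi> ^ (n - 1)" using n by (metis power_eq_if not_one_le_zero)
  have zero: "\<phi> (mmul (NN t 0) y) = co (\<not> t) (n - 1) x \<phi>"
  proof -
    have "mmul (NN t 0) y = mmul (scal \<pi>) (ci (\<not> t) (n - 1) x)"
      unfolding y_def by (cases t) (simp_all add: NN_def N0_def cj_eq ci_def bt_def betam_def Idm_def pn)
    then show ?thesis using ind_left[OF phi scal_IZ[OF pi_nz]] X_scal_pi by (simp add: co_def)
  qed
  have nz: "\<phi> (mmul (NN t m) y) = kap t (inverse m) * co t n (x + \<pi> ^ (n - 1) * tc (inverse m)) \<phi>"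
    if m: "m \<in> FF" "m \<noteq> 0" for m
  proof -
    note T = tc_inverse[OF m]
    define h :: "'f m2" where "h = (if t then (inverse (tc m), 1, 0, - tc m) else (- \<pi> * tc m, 0, \<pi> * \<pi>, \<pi> * inverse (tc m)))"
    have T2: "tc (inverse m) \<noteq> 0" "v (tc (inverse m)) = 0" using tc_inverse[of "inverse m"] m by auto
    have hI: "h \<in> IZ v" using T T2 by (auto simp: h_def IZ_iff v_mult)
    have e: "mmul (NN t m) y = mmul h (ci t n (x + \<pi> ^ (n - 1) * tc (inverse m)))"
      unfolding y_def using T
      by (cases t) (simp_all add: NN_def N0_def cj_eq ci_def bt_def betam_def Idm_def h_def pn
          flip: T[THEN conjunct1], simp_all add: field_simps)
    have "X h = kap t (inverse m)"
    proof (cases t)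
      case True
      \<comment> \<open>Both \<open>(- m) ^ r\<close> and \<open>(- inverse m) ^ (q - 1 - r)\<close>
        are inverse to \<open>(- inverse m) ^ r\<close>; this is where the exponent
        \<open>q - 1 - r\<close> arises.\<close>
      have "(- inverse m) ^ (q - 1 - r) * (- inverse m) ^ r = (1::'k)"
        using FF_fermat1[of "- inverse m"] m r_lt by (simp flip: power_add)
      moreover have "(- inverse m) ^ r * (- m) ^ r = 1" using m by (simp flip: power_mult_distrib)
      moreover have "c = a" if "a * b = 1" "b * c = 1" for a b c :: 'k
        using that by (metis mult.assoc mult.left_neutral mult.right_neutral)
      ultimately have "(- m) ^ r = (- inverse m) ^ (q - 1 - r)" by blast
      then show ?thesis using T True m up_unit[of "- tc m"]
        by (simp add: h_def chi_eq kap_def red_neg)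
    next
      case False
      then show ?thesis using T T2 m up_unit[of "tc (inverse m)"]
        by (simp add: h_def chi_eq kap_def up_mult v_inverse)
    qed
    then show ?thesis unfolding e using ind_left[OF phi hI ci_GL2] by (simp add: co_def)
  qed
  have "co (\<not> t) n x (TT t \<phi>) = (\<Sum>m\<in>FF. \<phi> (mmul (NN t m) y))"
    unfolding co_def y_def using TT_adj[OF phi ci_GL2] .
  also have "\<dots> = \<phi> (mmul (NN t 0) y) + (\<Sum>m\<in>FF - {0}. \<phi> (mmul (NN t m) y))"
    by (rule sum.remove) auto
  also have "(\<Sum>m\<in>FF - {0}. \<phi> (mmul (NN t m) y))
      = (\<Sum>m\<in>FF - {0}. kap t (inverse m) * co t n (x + \<pi> ^ (n - 1) * tc (inverse m)) \<phi>)"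
    using nz by (intro sum.cong) auto
  also have "\<dots> = (\<Sum>m\<in>FF - {0}. kap t m * co t n (x + \<pi> ^ (n - 1) * tc m) \<phi>)"
    by (rule sum.reindex_bij_betw[where h = inverse]) (rule bij_betwI[where g = inverse], auto)
  \<comment> \<open>The exponents in \<open>kap\<close> are positive, so its value at 0 vanishes and
    the missing term may be added.\<close>
  also have "\<dots> = H t n x \<phi>"
    unfolding H_def using r_pos r_lt by (intro sum.mono_neutral_left) (auto simp: kap_def)
  finally show ?thesis unfolding zero .
qed

lemma Ker_other: "\<phi> \<in> Ker t \<Longrightarrow> n \<ge> 1 \<Longrightarrow> co (\<not> t) (n - 1) x \<phi> + H t n x \<phi> = 0"
  using co_TT_other[of \<phi> n t x] by (simp add: Ker_def co_0)

lemma Ker_same: "\<phi> \<in> Ker t \<Longrightarrow> (\<Sum>m\<in>FF. co t (Suc n) (x + \<pi> ^ n * tc m) \<phi>) = 0"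
  using co_TT_same[of \<phi> t n x] by (simp add: Ker_def co_0)

lemma Ker_bet: "\<phi> \<in> Ker t \<Longrightarrow> act bet \<phi> \<in> Ker t"
  by (simp add: Ker_act)

section \<open>Relations in the quotient\<close>

definition kap_exp :: "bool \<Rightarrow> nat" where "kap_exp t = (if t then q - 1 - r else r)"

text \<open>Splitting off a sign makes the shifted weight \<open>kap t (m - \<nu>)\<close> a
  constant times a power of \<open>\<nu> - m\<close>, the form in which binomial expansion
  applies.\<close>

definition kap_sign :: "bool \<Rightarrow> 'k" where "kap_sign t = (if t then 1 else (-1) ^ r)"

lemma kap_eq: "kap t m = kap_sign t * (- m) ^ kap_exp t"
  by (simp add: kap_def kap_sign_def kap_exp_def power_mult_distrib[symmetric])

lemma kap_sign_nz [simp]: "kap_sign t \<noteq> 0"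
  by (simp add: kap_sign_def)

lemma kap_exp_bounds: "0 < kap_exp t" "kap_exp t < q - 1"
  using r_pos r_lt by (auto simp: kap_exp_def)

lemma conv_expand:
  "(\<Sum>m\<in>FF. m ^ j * (\<nu> - m) ^ R) = (\<Sum>i\<le>R. of_nat (R choose i) * \<nu> ^ i * (-1) ^ (R - i) * (\<Sum>m\<in>FF. m ^ (j + (R - i))))"
proof -
  have "(\<Sum>m\<in>FF. m ^ j * (\<nu> - m) ^ R) = (\<Sum>m\<in>FF. \<Sum>i\<le>R. of_nat (R choose i) * \<nu> ^ i * (-1) ^ (R - i) * m ^ (j + (R - i)))"
  proof (intro sum.cong refl)
    fix m :: 'k
    have "(\<nu> - m) ^ R = (\<Sum>i\<le>R. of_nat (R choose i) * \<nu> ^ i * (- m) ^ (R - i))"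
      using binomial_ring[of \<nu> "- m" R] by simp
    then show "m ^ j * (\<nu> - m) ^ R = (\<Sum>i\<le>R. of_nat (R choose i) * \<nu> ^ i * (-1) ^ (R - i) * m ^ (j + (R - i)))"
      by (simp only: sum_distrib_left power_add power_minus[of m] mult_ac)
  qed
  also have "\<dots> = (\<Sum>i\<le>R. \<Sum>m\<in>FF. of_nat (R choose i) * \<nu> ^ i * (-1) ^ (R - i) * m ^ (j + (R - i)))"
    by (rule sum.swap)
  finally show ?thesis by (simp add: sum_distrib_left)
qed

lemma conv_small: "j + R < q - 1 \<Longrightarrow> (\<Sum>m\<in>FF. m ^ j * (\<nu> - m) ^ R) = 0"
  unfolding conv_expand by (intro sum.neutral ballI) (simp add: power_sum_small)

text \<open>Of the binomial expansion only the term with the power sum of exponent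
  \<open>q - 1\<close> survives, and it does not involve \<open>m\<close>. This provides a test
  function for the weights.\<close>

lemma conv_one: assumes "R < q - 1" shows "(\<Sum>\<nu>\<in>FF. \<nu> ^ (q - 1 - R) * (\<nu> - m) ^ R) = -1"
proof -
  have "(\<Sum>\<nu>\<in>FF. \<nu> ^ (q - 1 - R) * (\<nu> - m) ^ R) = (-1) ^ R * (\<Sum>\<nu>\<in>FF. \<nu> ^ (q - 1 - R) * (m - \<nu>) ^ R)"
    by (simp add: sum_distrib_left mult.left_commute[of "(-1) ^ R"] flip: power_mult_distrib)
  also have "(\<Sum>\<nu>\<in>FF. \<nu> ^ (q - 1 - R) * (m - \<nu>) ^ R)
     = (\<Sum>i\<in>{0}. of_nat (R choose i) * m ^ i * (-1) ^ (R - i) * (\<Sum>m\<in>FF. m ^ (q - 1 - R + (R - i))))"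
    unfolding conv_expand
  proof (rule sum.mono_neutral_right)
    show "\<forall>i\<in>{..R} - {0}. of_nat (R choose i) * m ^ i * (-1) ^ (R - i) * (\<Sum>m\<in>FF. m ^ (q - 1 - R + (R - i))) = 0"
      using assms by (auto intro!: power_sum_small)
  qed auto
  also have "\<dots> = - ((-1) ^ R)" using assms by (simp add: power_sum_top)
  finally show ?thesis by (simp flip: power_mult_distrib)
qed

text \<open>Power sums vanish at all positive exponents below \<open>2 * (q - 1)\<close> except
  \<open>q - 1\<close>, so the exponent \<open>q - 1 + P - i\<close> singles out
  \<open>i = P\<close>.\<close>

lemma conv_frob:
  assumes "R < q - 1" "0 < P" "P < q - 1"
  shows "(\<Sum>m\<in>FF. m ^ (q - 1 - R + P) * (\<nu> - m) ^ R) = - of_nat (R choose P) * (-1) ^ (R - P) * \<nu> ^ P"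
proof -
  have "(\<Sum>m\<in>FF. m ^ (q - 1 - R + P) * (\<nu> - m) ^ R)
     = (\<Sum>i\<le>R. if i = P then - of_nat (R choose P) * (-1) ^ (R - P) * \<nu> ^ P else 0)"
    unfolding conv_expand
  proof (rule sum.cong[OF refl])
    fix i assume i: "i \<in> {..R}"
    have e: "q - 1 - R + P + (R - i) = q - 1 + P - i" using i assms by auto
    consider "i = P" | "i < P" | "i > P" by linarith
    then have "(\<Sum>m\<in>FF. m ^ (q - 1 - R + P + (R - i))) = (if i = P then - 1 else (0::'k))"
    proof cases
      case 1
      then show ?thesis unfolding e by (simp add: power_sum_top)
    next
      case 2
      then show ?thesis unfolding e using assms by (simp add: power_sum_mid)
    next
      case 3
      then show ?thesis unfolding e using assms i by (simp add: power_sum_small)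
    qed
    then show "of_nat (R choose i) * \<nu> ^ i * (-1) ^ (R - i) * (\<Sum>m\<in>FF. m ^ (q - 1 - R + P + (R - i)))
        = (if i = P then - of_nat (R choose P) * (-1) ^ (R - P) * \<nu> ^ P else 0)"
      by simp
  qed
  also have "\<dots> = - of_nat (R choose P) * (-1) ^ (R - P) * \<nu> ^ P" by (auto simp: binomial_eq_0)
  finally show ?thesis .
qed

text \<open>Test the hypothesis against \<open>\<nu> ^ (q - 1 - kap_exp t)\<close>: the constant is
  annihilated, while by \<open>conv_one\<close> every \<open>g m\<close> acquires the same nonzero
  factor. For the elements \<open>rel\<close> this makes one kernel equation a consequence of the
  other.\<close>

lemma kap_const_sum:
  assumes "\<And>\<nu>. \<nu> \<in> FF \<Longrightarrow> (\<Sum>m\<in>FF. kap t (m - \<nu>) * g m) = K"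
  shows "sum g FF = 0"
proof -
  let ?s = "q - 1 - kap_exp t"
  have "0 = K * (\<Sum>\<nu>\<in>FF. \<nu> ^ ?s)" using kap_exp_bounds[of t] by (simp add: power_sum_small)
  also have "\<dots> = (\<Sum>\<nu>\<in>FF. \<nu> ^ ?s * K)" by (simp add: sum_distrib_left mult.commute)
  also have "\<dots> = (\<Sum>\<nu>\<in>FF. \<nu> ^ ?s * (\<Sum>m\<in>FF. kap t (m - \<nu>) * g m))"
    using assms by (intro sum.cong) auto
  also have "\<dots> = (\<Sum>\<nu>\<in>FF. \<Sum>m\<in>FF. \<nu> ^ ?s * (kap t (m - \<nu>) * g m))"
    by (simp only: sum_distrib_left)
  also have "\<dots> = (\<Sum>m\<in>FF. \<Sum>\<nu>\<in>FF. \<nu> ^ ?s * (kap t (m - \<nu>) * g m))" by (rule sum.swap)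
  also have "\<dots> = (\<Sum>m\<in>FF. kap_sign t * g m * (\<Sum>\<nu>\<in>FF. \<nu> ^ ?s * (\<nu> - m) ^ kap_exp t))"
    by (simp add: sum_distrib_left kap_eq mult_ac)
  also have "\<dots> = (\<Sum>m\<in>FF. - kap_sign t * g m)"
    using conv_one[OF kap_exp_bounds(2)[of t]] by (intro sum.cong refl) simp
  also have "\<dots> = - kap_sign t * sum g FF"
    by (simp add: sum_distrib_left)
  finally show ?thesis by simp
qed

section \<open>Formal properties of the convolution \<open>H\<close>\<close>

lemma tc_inn_neg [simp]: "a \<in> FF \<Longrightarrow> inn (- int n) (tc a)"
  by (rule inn_mono[OF tc_inn]) auto

lemma inn_shift [simp]: "inn 0 x \<Longrightarrow> m \<in> FF \<Longrightarrow> inn 0 (x + \<pi> ^ n * tc m)"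
  by (intro inn_add) auto

lemma H_cong: "\<phi> \<in> ind \<Longrightarrow> inn (int n) (x - y) \<Longrightarrow> H t n x \<phi> = H t n y \<phi>"
  unfolding H_def by (intro sum.cong refl) (simp add: co_cong[of \<phi> n "x + c" "y + c" for c])

lemma H_add: "H t n x (\<lambda>y. \<phi> y + \<psi> y) = H t n x \<phi> + H t n x \<psi>"
  and H_diff: "H t n x (\<lambda>y. \<phi> y - \<psi> y) = H t n x \<phi> - H t n x \<psi>"
  and H_scale: "H t n x (\<lambda>y. c * \<phi> y) = c * H t n x \<phi>"
  by (simp_all add: H_def co_add co_diff co_scale algebra_simps sum.distrib sum_subtractf sum_distrib_left)

lemma H_sum: "H t n x (\<lambda>y. \<Sum>i\<in>A. g i y) = (\<Sum>i\<in>A. H t n x (g i))"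
  unfolding H_def co_sum sum_distrib_left by (rule sum.swap)

lemma H_0: "(\<And>x. inn 0 x \<Longrightarrow> co t n x \<phi> = 0) \<Longrightarrow> inn 0 x \<Longrightarrow> H t n x \<phi> = 0"
  unfolding H_def by (intro sum.neutral) auto

lemma tc_add_shift:
  assumes "\<phi> \<in> ind" "n \<ge> 1" "a \<in> FF" "b \<in> FF"
  shows "co t n (x + \<pi> ^ (n - 1) * tc a + \<pi> ^ (n - 1) * tc b) \<phi> = co t n (x + \<pi> ^ (n - 1) * tc (a + b)) \<phi>"
proof (rule co_cong[OF assms(1)])
  have "x + \<pi> ^ (n - 1) * tc a + \<pi> ^ (n - 1) * tc b - (x + \<pi> ^ (n - 1) * tc (a + b)) = \<pi> ^ (n - 1) * (tc a + tc b - tc (a + b))"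
    by (simp add: algebra_simps)
  moreover have "inn (int n) \<dots>" using tc_add_cong[OF assms(3,4)] assms(2) by (simp add: of_nat_diff)
  ultimately show "inn (int n) (x + \<pi> ^ (n - 1) * tc a + \<pi> ^ (n - 1) * tc b - (x + \<pi> ^ (n - 1) * tc (a + b)))" by simp
qed

text \<open>The carry in \<open>tc \<nu> + tc m\<close> ends up in \<open>\<pi> ^ n\<close>, which
  coordinates of level \<open>n\<close> do not see; so the shift can be moved to the weight.\<close>

lemma H_shift:
  assumes "\<phi> \<in> ind" "n \<ge> 1" "\<nu> \<in> FF"
  shows "H t n (x + \<pi> ^ (n - 1) * tc \<nu>) \<phi> = (\<Sum>m\<in>FF. kap t (m - \<nu>) * co t n (x + \<pi> ^ (n - 1) * tc m) \<phi>)"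
proof -
  have "H t n (x + \<pi> ^ (n - 1) * tc \<nu>) \<phi> = (\<Sum>m\<in>FF. kap t ((m + \<nu>) - \<nu>) * co t n (x + \<pi> ^ (n - 1) * tc (m + \<nu>)) \<phi>)"
    unfolding H_def using assms tc_add_shift[OF assms(1,2,3)] by (intro sum.cong refl) (simp add: add.commute[of _ \<nu>])
  also have "\<dots> = (\<Sum>m\<in>FF. kap t (m - \<nu>) * co t n (x + \<pi> ^ (n - 1) * tc m) \<phi>)"
    by (rule FF_shift[OF assms(3), of "\<lambda>m. kap t (m - \<nu>) * co t n (x + \<pi> ^ (n - 1) * tc m) \<phi>"])
  finally show ?thesis .
qed

text \<open>\<open>Ker_other\<close> at level \<open>n + 2\<close> kills one type of coordinates in
  each kernel, and not the same type in both; the vanishing of the sum disposes of the rest.\<close>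

lemma Ker_level:
  assumes K: "\<phi>1 \<in> Ker t" "\<phi>2 \<in> Ker (\<not> t)"
    and hi: "\<And>t x. inn 0 x \<Longrightarrow> co t (Suc (Suc n)) x \<phi>1 = 0" "\<And>t x. inn 0 x \<Longrightarrow> co t (Suc (Suc n)) x \<phi>2 = 0"
    and s: "\<And>t x. inn 0 x \<Longrightarrow> co t (Suc n) x \<phi>1 + co t (Suc n) x \<phi>2 = 0"
    and x: "inn 0 x"
  shows "co t' (Suc n) x \<phi>1 = 0 \<and> co t' (Suc n) x \<phi>2 = 0"
proof -
  have 1: "co (\<not> t) (Suc n) x \<phi>1 = 0"
    using Ker_other[OF K(1), of "Suc (Suc n)" x] H_0[OF hi(1) x, of t] by simp
  have 2: "co t (Suc n) x \<phi>2 = 0"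
    using Ker_other[OF K(2), of "Suc (Suc n)" x] H_0[OF hi(2) x, of "\<not> t"] by simp
  show ?thesis using 1 2 s[OF x, of t] s[OF x, of "\<not> t"] by (cases "t' = t") auto
qed

text \<open>Any decomposition will do: above level \<open>N\<close> the top levels of both summands
  are stripped one at a time by \<open>Ker_level\<close>, on both halves of the tree.\<close>

lemma W_split:
  assumes "\<psi> \<in> W" "lev N \<psi>"
  obtains \<phi>1 \<phi>2 where "\<phi>1 \<in> Ker t" "\<phi>2 \<in> Ker (\<not> t)" "\<psi> = (\<lambda>x. \<phi>1 x + \<phi>2 x)" "lev N \<phi>1" "lev N \<phi>2"
proof -
  obtain \<phi>1 \<phi>2 where K: "\<phi>1 \<in> Ker t" "\<phi>2 \<in> Ker (\<not> t)" and psi: "\<psi> = (\<lambda>x. \<phi>1 x + \<phi>2 x)"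
    using assms(1) unfolding W_iff[of _ t] by blast
  obtain M1 M2 where M: "lev M1 \<phi>1" "lev M2 \<phi>2" using lev_exists Ker_ind K by meson
  have "lev (N + k) \<phi>1 \<and> lev (N + k) \<phi>2 \<Longrightarrow> lev N \<phi>1 \<and> lev N \<phi>2" for k
  proof (induction k)
    case (Suc k)
    have "co t' (Suc (N + k)) x \<phi>1 = 0 \<and> co t' (Suc (N + k)) x \<phi>2 = 0" if "inn 0 x" for t' x
    proof (rule Ker_level[OF K])
      show "co t (Suc (N + k)) x \<phi>1 + co t (Suc (N + k)) x \<phi>2 = 0" if "inn 0 x" for t x
        using levD(1)[OF assms(2) _ that, of "Suc (N + k)" t] by (simp add: psi co_add)
    qed (use Suc.prems that in \<open>auto simp: lev_def\<close>)
    moreover have "co t' (Suc (N + k)) x (act bet \<phi>1) = 0 \<and> co t' (Suc (N + k)) x (act bet \<phi>2) = 0" if "inn 0 x" for t' x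
    proof (rule Ker_level[OF Ker_bet[OF K(1)] Ker_bet[OF K(2)]])
      show "co t (Suc (N + k)) x (act bet \<phi>1) + co t (Suc (N + k)) x (act bet \<phi>2) = 0" if "inn 0 x" for t x
        using levD(2)[OF assms(2) _ that, of "Suc (N + k)" t] by (simp add: psi co_add act_add)
    qed (use Suc.prems that in \<open>auto simp: lev_def\<close>)
    ultimately have "lev (N + k) \<phi>1 \<and> lev (N + k) \<phi>2"
      using Suc.prems unfolding lev_def by (metis Suc_lessI add_Suc_right)
    then show ?case by (rule Suc.IH)
  qed simp
  from this[of "max M1 M2"] have "lev N \<phi>1 \<and> lev N \<phi>2" using lev_mono M by (metis le_add2 max.bounded_iff)
  then show thesis using that[OF K psi] by blast
qed

text \<open>At level \<open>N\<close> the summand \<open>\<phi>2\<close> has no coordinates of type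
  \<open>t\<close>, so \<open>H t N\<close> sees only \<open>\<phi>1\<close>, where the kernel
  equation expresses it one level lower. On the other half the roles are reversed: there
  \<open>H (\<not> t) N\<close> sees only \<open>\<phi>2\<close>.\<close>

lemma W_split_facts:
  assumes "\<psi> \<in> W" "lev N \<psi>" "N \<ge> 1"
  obtains \<phi>2 where "\<phi>2 \<in> Ker (\<not> t)" "lev N \<phi>2"
    "\<And>x. inn 0 x \<Longrightarrow> co (\<not> t) (N - 1) x \<phi>2 = co (\<not> t) (N - 1) x \<psi> + H t N x \<psi>"
    "\<And>x. inn 0 x \<Longrightarrow> H (\<not> t) N x (act bet \<phi>2) = H (\<not> t) N x (act bet \<psi>)"
proof -
  obtain \<phi>1 \<phi>2 where K: "\<phi>1 \<in> Ker t" "\<phi>2 \<in> Ker (\<not> t)" and psi: "\<psi> = (\<lambda>x. \<phi>1 x + \<phi>2 x)"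
    and L: "lev N \<phi>1" "lev N \<phi>2"
    using W_split[OF assms(1,2)] by metis
  have 2: "co t N x \<phi>2 = 0" if x: "inn 0 x" for x
    using Ker_other[OF K(2), of "Suc N" x] H_0[of "\<not> t" "Suc N" \<phi>2 x] levD(1)[OF L(2)] x by simp
  have 1: "co (\<not> t) N x (act bet \<phi>1) = 0" if x: "inn 0 x" for x
    using Ker_other[OF Ker_bet[OF K(1)], of "Suc N" x] H_0[of t "Suc N" "act bet \<phi>1" x] levD(2)[OF L(1)] x by simp
  have a: "co (\<not> t) (N - 1) x \<phi>2 = co (\<not> t) (N - 1) x \<psi> + H t N x \<psi>" if x: "inn 0 x" for x
  proof -
    have "H t N x \<phi>2 = 0" using 2 x by (intro H_0) auto
    then show ?thesis using Ker_other[OF K(1) assms(3), of x] by (simp add: psi co_add H_add) 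
  qed
  have b: "H (\<not> t) N x (act bet \<phi>2) = H (\<not> t) N x (act bet \<psi>)" if x: "inn 0 x" for x
  proof -
    have "H (\<not> t) N x (act bet \<phi>1) = 0" using 1 x by (intro H_0) auto
    then show ?thesis by (simp add: psi act_add H_add)
  qed
  show thesis using that[OF K(2) L(2) a b] .
qed

text \<open>The obstruction that drives both the independence proof and the analysis of invariant
  vectors.\<close>

lemma W_top:
  assumes "\<psi> \<in> W" "lev N \<psi>" "N \<ge> 1" "inn 0 x" "inn 0 y" "inn (int (N - 1)) (x - y)"
  shows "H t N x \<psi> = H t N y \<psi>"
proof -
  obtain \<phi>2 where F: "\<phi>2 \<in> Ker (\<not> t)"
    "\<And>x. inn 0 x \<Longrightarrow> co (\<not> t) (N - 1) x \<phi>2 = co (\<not> t) (N - 1) x \<psi> + H t N x \<psi>"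
    using W_split_facts[OF assms(1-3)] by metis
  show ?thesis using F(2)[OF assms(4)] F(2)[OF assms(5)]
      co_cong[OF Ker_ind[OF F(1)] assms(6)] co_cong[OF W_ind[OF assms(1)] assms(6)] by simp
qed

text \<open>The equation \<open>Ker_same\<close> for \<open>\<phi>2\<close>, expressed through
  \<open>\<psi>\<close> alone. It is what excludes further invariants over Q_p.\<close>

lemma W_sum_zero:
  assumes "\<psi> \<in> W" "lev N \<psi>" "N \<ge> 2" "inn 0 x"
  shows "(\<Sum>m\<in>FF. co (\<not> t) (N - 1) (x + \<pi> ^ (N - 2) * tc m) \<psi> + H t N (x + \<pi> ^ (N - 2) * tc m) \<psi>) = 0"
proof -
  obtain \<phi>2 where F: "\<phi>2 \<in> Ker (\<not> t)"
    "\<And>x. inn 0 x \<Longrightarrow> co (\<not> t) (N - 1) x \<phi>2 = co (\<not> t) (N - 1) x \<psi> + H t N x \<psi>"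
    using W_split_facts[OF assms(1,2)] assms(3) by (metis One_nat_def Suc_1 Suc_leD)
  have "Suc (N - 2) = N - 1" using assms by simp
  then have "(\<Sum>m\<in>FF. co (\<not> t) (N - 1) (x + \<pi> ^ (N - 2) * tc m) \<phi>2) = 0"
    using Ker_same[OF F(1), of "N - 2" x] by simp
  then show ?thesis using F(2) assms(4) by simp
qed

text \<open>\<open>\<phi>2\<close> has the same coordinate at level 0 seen from either half, so the
  two descriptions in \<open>W_split_facts\<close> can be equated by the kernel equation of
  \<open>act bet \<phi>2\<close>.\<close>

lemma W_one:
  assumes "\<psi> \<in> W" "lev 1 \<psi>" "inn 0 x"
  shows "co (\<not> t) 0 x \<psi> + H t 1 x \<psi> + H (\<not> t) 1 x (act bet \<psi>) = 0"
proof -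
  obtain \<phi>2 where F: "\<phi>2 \<in> Ker (\<not> t)"
    "\<And>x. inn 0 x \<Longrightarrow> co (\<not> t) (1 - 1) x \<phi>2 = co (\<not> t) (1 - 1) x \<psi> + H t 1 x \<psi>"
    "\<And>x. inn 0 x \<Longrightarrow> H (\<not> t) 1 x (act bet \<phi>2) = H (\<not> t) 1 x (act bet \<psi>)"
    using W_split_facts[OF assms(1,2)] by (metis order_refl)
  have "co t 0 x (act bet \<phi>2) = co (\<not> t) 0 x \<phi>2" using co_bet_0[OF Ker_ind[OF F(1)]] assms(3) by blast
  then show ?thesis using Ker_other[OF Ker_bet[OF F(1)], of 1 x] F(2,3) assms(3) by simp
qed

lemma W_level_0:
  assumes "\<psi> \<in> W" "lev 0 \<psi>" "inn 0 x" shows "co t 0 x \<psi> = 0"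
proof -
  have "H (\<not> t) 1 x \<psi> = 0" "H t 1 x (act bet \<psi>) = 0"
    using levD[OF assms(2)] assms(3) by (auto intro!: H_0)
  then show ?thesis using W_one[OF assms(1) lev_mono[OF assms(2)] assms(3), of "\<not> t"] by simp
qed

section \<open>Elementary kernel elements and the removal of top coordinates\<close>

definition rel :: "bool \<Rightarrow> nat \<Rightarrow> 'f \<Rightarrow> ('k \<Rightarrow> 'k) \<Rightarrow> 'k \<Rightarrow> 'f m2 \<Rightarrow> 'k" where
  "rel t N x0 g K = (\<lambda>y. (\<Sum>m\<in>FF. g m * E t N (x0 + \<pi> ^ (N - 1) * tc m) y) - K * E (\<not> t) (N - 1) x0 y)"

lemma rel_ind: "rel t N x0 g K \<in> ind"
  unfolding rel_def by (intro ind_diff ind_sum ind_scale E_ind)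

lemma digit_sum:
  assumes "N \<ge> 1" "inn 0 x" "inn 0 x0"
  shows "(\<Sum>m\<in>FF. g m * (if inn (int N) (x - (x0 + \<pi> ^ (N - 1) * tc m)) then 1 else 0))
     = (if inn (int (N - 1)) (x - x0) then g (red ((x - x0) / \<pi> ^ (N - 1))) else (0::'k))"
proof (cases "inn (int (N - 1)) (x - x0)")
  case True
  let ?z = "(x - x0) / \<pi> ^ (N - 1)"
  have z: "inn 0 ?z" using True by (simp add: inn_div_iff)
  have iff: "inn (int N) (x - (x0 + \<pi> ^ (N - 1) * tc m)) \<longleftrightarrow> m = red ?z" if "m \<in> FF" for m
  proof -
    have "x - (x0 + \<pi> ^ (N - 1) * tc m) = \<pi> ^ (N - 1) * (?z - tc m)" by (simp add: field_simps)
    then have "inn (int N) (x - (x0 + \<pi> ^ (N - 1) * tc m)) \<longleftrightarrow> inn 1 (?z - tc m)" using assms(1) by (simp add: of_nat_diff)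
    then show ?thesis using red_eq_iff[OF z, of "tc m"] that by auto
  qed
  have "(\<Sum>m\<in>FF. g m * (if inn (int N) (x - (x0 + \<pi> ^ (N - 1) * tc m)) then 1 else 0)) = (\<Sum>m\<in>FF. if m = red ?z then g m else 0)"
    by (intro sum.cong) (auto simp: iff)
  then show ?thesis using True z by simp
next
  case False
  have "\<not> inn (int N) (x - (x0 + \<pi> ^ (N - 1) * tc m))" if "m \<in> FF" for m
  proof
    assume "inn (int N) (x - (x0 + \<pi> ^ (N - 1) * tc m))"
    then have "inn (int (N - 1)) (x - x0 - \<pi> ^ (N - 1) * tc m)"
      by (intro inn_mono[of "int N" _ "int (N - 1)"]) (auto simp: algebra_simps)
    then have "inn (int (N - 1)) (x - x0)"
      using inn_add[of "int (N - 1)" "x - x0 - \<pi> ^ (N - 1) * tc m" "\<pi> ^ (N - 1) * tc m"] that by simp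
    then show False using False by simp
  qed
  then show ?thesis using False by simp
qed

lemma co_rel:
  assumes "N \<ge> 1" "inn 0 x" "inn 0 x0"
  shows "co t' n x (rel t N x0 g K) =
    (if inn (int (N - 1)) (x - x0) then
       (if t' = t \<and> n = N then g (red ((x - x0) / \<pi> ^ (N - 1))) else if t' \<noteq> t \<and> n = N - 1 then - K else 0)
     else 0)"
proof -
  have "co t' n x (rel t N x0 g K) = (\<Sum>m\<in>FF. g m * co t' n x (E t N (x0 + \<pi> ^ (N - 1) * tc m))) - K * co t' n x (E (\<not> t) (N - 1) x0)"
    by (simp add: rel_def co_diff co_sum co_scale)
  also have "(\<Sum>m\<in>FF. g m * co t' n x (E t N (x0 + \<pi> ^ (N - 1) * tc m)))
    = (if t' = t \<and> n = N then (\<Sum>m\<in>FF. g m * (if inn (int N) (x - (x0 + \<pi> ^ (N - 1) * tc m)) then 1 else 0)) else 0)"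
    using assms by (simp add: co_E)
  finally show ?thesis using assms by (auto simp: co_E digit_sum)
qed

lemma co_bet_rel:
  assumes "N \<ge> 1" "inn 0 x" "inn 0 x0"
  shows "co t' n x (act bet (rel t N x0 g K)) = (if n = 0 \<and> N = 1 \<and> t' = t then - K else 0)"
  using assms by (auto simp: rel_def act_diff act_sum act_scale co_diff co_sum co_scale co_bE)

text \<open>The equation of type \<open>\<not> t\<close> is the hypothesis on \<open>g\<close>, the
  term with \<open>K\<close> compensating the constant; the equation of type \<open>t\<close> asks
  that \<open>g\<close> sum to 0, which is \<open>kap_const_sum\<close>.\<close>

lemma rel_Ker:
  assumes N: "N \<ge> 1" and x0: "inn 0 x0"
    and g: "\<And>\<nu>. \<nu> \<in> FF \<Longrightarrow> (\<Sum>m\<in>FF. kap t (m - \<nu>) * g m) = K"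
  shows "rel t N x0 g K \<in> Ker t"
proof -
  let ?R = "rel t N x0 g K"
  note ri = rel_ind[of t N x0 g K]
  note rb = bet_ind[OF ri]
  have co_shift: "co t N (x + \<pi> ^ (N - 1) * tc m) ?R = (if inn (int (N - 1)) (x - x0) then g (m + red ((x - x0) / \<pi> ^ (N - 1))) else 0)"
    if x: "inn 0 x" "m \<in> FF" for x m
  proof -
    have e: "x + \<pi> ^ (N - 1) * tc m - x0 = (x - x0) + \<pi> ^ (N - 1) * tc m" by simp
    have "inn (int (N - 1)) ((x - x0) + \<pi> ^ (N - 1) * tc m) \<longleftrightarrow> inn (int (N - 1)) (x - x0)"
      using inn_cancel[of "int (N - 1)" "\<pi> ^ (N - 1) * tc m" "x - x0"] x(2) by (simp add: add.commute)
    moreover have "((x - x0) + \<pi> ^ (N - 1) * tc m) / \<pi> ^ (N - 1) = tc m + (x - x0) / \<pi> ^ (N - 1)" by (simp add: field_simps)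
    ultimately show ?thesis using x N x0 by (auto simp: co_rel e red_add inn_div_iff)
  qed
  have same: "co t n x (TT t ?R) = 0" if x: "inn 0 x" for n x
  proof (cases "Suc n = N \<and> inn (int (N - 1)) (x - x0)")
    case True
    let ?z = "red ((x - x0) / \<pi> ^ (N - 1))"
    have z: "?z \<in> FF" using True[THEN conjunct2] by (simp add: inn_div_iff)
    have "co t n x (TT t ?R) = (\<Sum>m\<in>FF. co t N (x + \<pi> ^ (N - 1) * tc m) ?R)"
      using True co_TT_same[OF ri, of t n x] by auto
    also have "\<dots> = (\<Sum>m\<in>FF. g (m + ?z))"
      using True[THEN conjunct2] x by (intro sum.cong refl) (simp only: co_shift if_True)
    also have "\<dots> = sum g FF" using z by (rule FF_shift)
    finally show ?thesis using kap_const_sum[OF g] by simp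
  next
    case False
    then show ?thesis unfolding co_TT_same[OF ri]
    proof (intro sum.neutral ballI)
      fix m assume m: "m \<in> FF"
      show "co t (Suc n) (x + \<pi> ^ n * tc m) ?R = 0"
      proof (cases "Suc n = N")
        case True
        then show ?thesis using False co_shift[OF x m] by auto
      qed (use N x0 x m in \<open>simp add: co_rel\<close>)
    qed
  qed
  have other: "co (\<not> t) n x (TT t ?R) = 0" if x: "inn 0 x" "n \<ge> 1" for n x
  proof (cases "n = N")
    case True
    show ?thesis
    proof (cases "inn (int (N - 1)) (x - x0)")
      case t1: True
      let ?z = "red ((x - x0) / \<pi> ^ (N - 1))"
      have z: "?z \<in> FF" using t1 by (simp add: inn_div_iff)
      have "H t N x ?R = (\<Sum>m\<in>FF. kap t ((m + ?z) - ?z) * g (m + ?z))"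
        unfolding H_def using t1 x by (intro sum.cong) (auto simp: co_shift)
      also have "\<dots> = (\<Sum>m\<in>FF. kap t (m - ?z) * g m)"
        by (rule FF_shift[OF z, of "\<lambda>m. kap t (m - ?z) * g m"])
      also have "\<dots> = K" using g z by simp
      finally show ?thesis unfolding co_TT_other[OF ri x(2)] using True t1 x N x0 by (simp add: co_rel)
    next
      case f1: False
      have "H t N x ?R = 0" unfolding H_def using f1 x by (intro sum.neutral) (auto simp: co_shift)
      then show ?thesis unfolding co_TT_other[OF ri x(2)] using True f1 x N x0 by (simp add: co_rel)
    qed
  next
    case False
    then have "H t n x ?R = 0" using x N x0 by (intro H_0) (auto simp: co_rel)
    then show ?thesis unfolding co_TT_other[OF ri x(2)] using False x N x0 by (auto simp: co_rel)
  qed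
  have bsame: "co t n x (TT t (act bet ?R)) = 0" if x: "inn 0 x" for n x
    unfolding co_TT_same[OF rb] using x N x0 by (intro sum.neutral ballI) (simp add: co_bet_rel)
  have bother: "co (\<not> t) n x (TT t (act bet ?R)) = 0" if x: "inn 0 x" "n \<ge> 1" for n x
  proof -
    have "H t n x (act bet ?R) = 0" using x N x0 by (intro H_0) (auto simp: co_bet_rel)
    then show ?thesis unfolding co_TT_other[OF rb x(2)] using x N x0 by (auto simp: co_bet_rel)
  qed
  have b: "act bet (TT t ?R) = TT t (act bet ?R)" by (simp add: TT_act[OF ri])
  have "TT t ?R = (\<lambda>_. 0)"
  proof (rule ind_zeroI[OF TT_ind[OF ri]])
    fix t' n x assume x: "inn 0 x"
    \<comment> \<open>Level 0 of type \<open>\<not> t\<close> is not covered by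
      \<open>other\<close>, which requires a positive level; it is read off on the other half of the
      tree.\<close>
    have o0: "co (\<not> t) 0 x (TT t ?R) = 0"
      using co_bet_0[OF TT_ind[OF ri] x x, of t t] bsame[OF x, of 0] by (simp add: b)
    have bo0: "co (\<not> t) 0 x (act bet (TT t ?R)) = 0"
      using co_bet_0[OF TT_ind[OF ri] x x, of "\<not> t" t] same[OF x, of 0] by simp
    show "co t' n x (TT t ?R) = 0"
      using same[OF x] other[OF x, of n] o0 by (cases "t' = t"; cases "n = 0") auto
    show "co t' n x (act bet (TT t ?R)) = 0"
      using bsame[OF x] bother[OF x, of n] bo0 by (cases "t' = t"; cases "n = 0") (auto simp: b)
  qed
  then show ?thesis using ri by (simp add: Ker_def)
qed

text \<open>On each class modulo \<open>\<pi> ^ (N - 1)\<close> the hypothesis is the constancy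
  required by \<open>rel_Ker\<close>, with \<open>g\<close> the top coordinates in that class;
  \<open>w\<close> is the sum of these relations. Subtracting \<open>w\<close> trades the top
  coordinates of type \<open>t\<close> for the values of \<open>H\<close> at level
  \<open>N - 1\<close> and type \<open>\<not> t\<close>.\<close>

lemma reduce:
  assumes phi: "\<phi> \<in> ind" and N: "N \<ge> 1"
    and h: "\<And>x y. inn 0 x \<Longrightarrow> inn 0 y \<Longrightarrow> inn (int (N - 1)) (x - y) \<Longrightarrow> H t N x \<phi> = H t N y \<phi>"
  obtains w where "w \<in> W"
    "\<And>x. inn 0 x \<Longrightarrow> co t N x w = co t N x \<phi>"
    "\<And>x. inn 0 x \<Longrightarrow> co (\<not> t) (N - 1) x w = - H t N x \<phi>"
    "\<And>t' n x. inn 0 x \<Longrightarrow> \<not> (t' = t \<and> n = N) \<Longrightarrow> \<not> (t' \<noteq> t \<and> n = N - 1) \<Longrightarrow> co t' n x w = 0"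
    "\<And>t' n x. inn 0 x \<Longrightarrow> n \<ge> 1 \<Longrightarrow> co t' n x (act bet w) = 0"
proof -
  define g where "g \<mu> m = co t N (ds (N - 1) \<mu> + \<pi> ^ (N - 1) * tc m) \<phi>" for \<mu> m
  define K where "K \<mu> = H t N (ds (N - 1) \<mu>) \<phi>" for \<mu>
  define \<rho> where "\<rho> \<mu> = rel t N (ds (N - 1) \<mu>) (g \<mu>) (K \<mu>)" for \<mu>
  define w where "w = (\<lambda>y. \<Sum>\<mu>\<in>digs v red (N - 1). \<rho> \<mu> y)"
  have rK: "\<rho> \<mu> \<in> Ker t" if "\<mu> \<in> digs v red (N - 1)" for \<mu>
    unfolding \<rho>_def
  proof (rule rel_Ker[OF N])
    show "inn 0 (ds (N - 1) \<mu>)" using that by simp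
    fix \<nu> assume nu: "\<nu> \<in> FF"
    have "(\<Sum>m\<in>FF. kap t (m - \<nu>) * g \<mu> m) = H t N (ds (N - 1) \<mu> + \<pi> ^ (N - 1) * tc \<nu>) \<phi>"
      unfolding g_def using H_shift[OF phi N nu] by simp
    also have "\<dots> = K \<mu>" unfolding K_def using that nu by (intro h) auto
    finally show "(\<Sum>m\<in>FF. kap t (m - \<nu>) * g \<mu> m) = K \<mu>" .
  qed
  have wW: "w \<in> W" unfolding w_def using rK Ker_W by (intro W_sum) blast
  have cw: "co t' n x w = (if t' = t \<and> n = N then co t N x \<phi> else if t' \<noteq> t \<and> n = N - 1 then - H t N x \<phi> else 0)"
    if x: "inn 0 x" for t' n x
  proof -
    define G where "G \<mu> = (if t' = t \<and> n = N then g \<mu> (red ((x - ds (N - 1) \<mu>) / \<pi> ^ (N - 1))) else if t' \<noteq> t \<and> n = N - 1 then - K \<mu> else 0)" for \<mu>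
    let ?m = "restrict (\<lambda>i. dg i x) {..<N - 1}"
    have dm: "ds (N - 1) ?m = trunc (N - 1) x" unfolding trunc_def by (rule ds_cong) simp
    have "co t' n x w = (\<Sum>\<mu>\<in>digs v red (N - 1). if inn (int (N - 1)) (x - ds (N - 1) \<mu>) then G \<mu> else 0)"
      unfolding w_def co_sum \<rho>_def G_def using x N by (intro sum.cong refl) (simp add: co_rel)
    also have "\<dots> = G ?m" by (rule digs_sum[OF x])
    finally have cG: "co t' n x w = G ?m" .
    have "(x - trunc (N - 1) x) / \<pi> ^ (N - 1) = rem (N - 1) x" using trunc_rem[of x "N - 1"]
      by (metis add_diff_cancel_left' nonzero_mult_div_cancel_left pi_nz power_not_zero)
    then have "g ?m (red ((x - ds (N - 1) ?m) / \<pi> ^ (N - 1))) = co t N (trunc (N - 1) x + \<pi> ^ (N - 1) * tc (red (rem (N - 1) x))) \<phi>"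
      by (simp add: g_def dm)
    also have "\<dots> = co t N x \<phi>"
    proof (rule co_cong[OF phi])
      have "trunc (N - 1) x + \<pi> ^ (N - 1) * tc (red (rem (N - 1) x)) = trunc N x"
        using N by (cases N) (simp_all add: trunc_def ds_Suc dg_def mult.commute)
      then show "inn (int N) (trunc (N - 1) x + \<pi> ^ (N - 1) * tc (red (rem (N - 1) x)) - x)"
        using trunc_cong[OF x, of N] inn_sym by simp
    qed
    finally have gm: "g ?m (red ((x - ds (N - 1) ?m) / \<pi> ^ (N - 1))) = co t N x \<phi>" .
    have "K ?m = H t N x \<phi>" unfolding K_def dm
      by (rule h) (use x trunc_cong[OF x, of "N - 1"] inn_sym in auto)
    then show ?thesis unfolding cG G_def gm by simp
  qed
  have bw: "co t' n x (act bet w) = 0" if "inn 0 x" "n \<ge> 1" for t' n x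
    unfolding w_def act_sum co_sum \<rho>_def using that N by (intro sum.neutral ballI) (simp add: co_bet_rel)
  show thesis
    by (rule that[OF wW]) (use cw bw N in auto)
qed

section \<open>The action of the pro-p Iwahori subgroup\<close>

text \<open>The action of the inverse of k on the coordinates.\<close>

definition moeb :: "'f m2 \<Rightarrow> 'f \<Rightarrow> 'f" where
  "moeb k x = (ed k * x - eb k) / (ea k - ec k * x)"

lemma Iwa1_D:
  assumes "(\<alpha>, \<beta>, \<gamma>, \<delta>) \<in> Iwa1 v"
  shows "inn 1 (\<alpha> - 1)" "inn 0 \<beta>" "inn 1 \<gamma>" "inn 1 (\<delta> - 1)" "inn 0 \<alpha>" "inn 0 \<delta>"
  using assms by (auto simp: Iwa1_def Iwa_def Kgrp_def)

lemma unit_sub: "inn 1 (a - 1) \<Longrightarrow> inn 1 b \<Longrightarrow> a - b \<noteq> 0 \<and> v (a - b) = 0 \<and> up (a - b) = 1 \<and> inn 1 (a - b - 1)"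
proof -
  assume "inn 1 (a - 1)" "inn 1 b"
  then have "inn 1 (a - b - 1)" using inn_diff[of 1 "a - 1" b] by (simp add: algebra_simps)
  then show ?thesis using red_1_plus[of "a - b - 1"] by simp
qed

lemma prod_1: "inn 1 (a - 1) \<Longrightarrow> inn 1 (b - 1) \<Longrightarrow> inn 1 (a * b - 1)"
proof -
  assume a: "inn 1 (a - 1)" "inn 1 (b - 1)"
  have "inn 0 b" using unit_1[OF a(2)] by (simp add: inO_def)
  then have "inn 1 ((a - 1) * b + (b - 1))" using a by (intro inn_add inn_mult_right)
  also have "(a - 1) * b + (b - 1) = a * b - 1" by (simp add: algebra_simps)
  finally show ?thesis .
qed

lemma Iwa1_I:
  assumes "inn 1 (\<alpha> - 1)" "inn 0 \<beta>" "inn 1 \<gamma>" "inn 1 (\<delta> - 1)"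
  shows "(\<alpha>, \<beta>, \<gamma>, \<delta>) \<in> Iwa1 v"
proof -
  have a: "inn 0 \<alpha>" "inn 0 \<delta>"
    using assms inn_mono[of 1 "\<alpha> - 1" 0] inn_mono[of 1 "\<delta> - 1" 0] inn_add[of 0 "\<alpha> - 1" 1] inn_add[of 0 "\<delta> - 1" 1] by auto
  have "inn 1 (\<alpha> * \<delta> - 1)" using assms by (intro prod_1)
  moreover have "inn 1 (\<beta> * \<gamma>)" using assms by (simp add: inn_mult_left)
  ultimately have "\<alpha> * \<delta> - \<beta> * \<gamma> \<noteq> 0 \<and> v (\<alpha> * \<delta> - \<beta> * \<gamma>) = 0" using unit_sub by blast
  then show ?thesis using assms a inn_mono[of 1 \<gamma> 0] by (simp add: Iwa1_def Iwa_def Kgrp_def)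
qed

lemma Iwa1_GL2: "k \<in> Iwa1 v \<Longrightarrow> k \<in> GL2"
  by (auto simp: Iwa1_def Iwa_def Kgrp_def GL2_def)

lemma cj_Iwa1: "k \<in> Iwa1 v \<Longrightarrow> cj k \<in> Iwa1 v"
proof -
  assume "k \<in> Iwa1 v"
  moreover obtain \<alpha> \<beta> \<gamma> \<delta> where k: "k = (\<alpha>, \<beta>, \<gamma>, \<delta>)" by (cases k)
  ultimately show ?thesis using Iwa1_D[of \<alpha> \<beta> \<gamma> \<delta>] unfolding k cj_eq
    by (intro Iwa1_I) (auto simp: inn_div_iff)
qed

lemma cj_Iwa1_surj: assumes "k \<in> Iwa1 v" shows "\<exists>k'\<in>Iwa1 v. k = cj k'"
proof -
  obtain \<alpha> \<beta> \<gamma> \<delta> where k: "k = (\<alpha>, \<beta>, \<gamma>, \<delta>)" by (cases k)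
  have "k = cj (\<delta>, \<gamma> / \<pi>, \<pi> * \<beta>, \<alpha>)" unfolding k by (simp add: cj_eq)
  moreover have "(\<delta>, \<gamma> / \<pi>, \<pi> * \<beta>, \<alpha>) \<in> Iwa1 v" using assms Iwa1_D[of \<alpha> \<beta> \<gamma> \<delta>] unfolding k
    by (intro Iwa1_I) (auto simp: inn_div_iff)
  ultimately show ?thesis by blast
qed

lemma bet_act: "act bet (act k \<phi>) = act (cj k) (act bet \<phi>)"
  unfolding act_act cj_def by (simp add: mmul_assoc minv_left)

lemma moeb_facts:
  assumes "k \<in> Iwa1 v" "inn 0 x"
  shows "ea k - ec k * x \<noteq> 0" "v (ea k - ec k * x) = 0" "inn 1 (ea k - ec k * x - 1)" "inn 0 (moeb k x)"
proof -
  obtain \<alpha> \<beta> \<gamma> \<delta> where k: "k = (\<alpha>, \<beta>, \<gamma>, \<delta>)" by (cases k)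
  note D = Iwa1_D[OF assms(1)[unfolded k]]
  show 1: "ea k - ec k * x \<noteq> 0" "v (ea k - ec k * x) = 0" "inn 1 (ea k - ec k * x - 1)"
    unfolding k using D assms(2) unit_sub[of \<alpha> "\<gamma> * x"] by (auto simp: inn_mult_right)
  have "inn 0 (\<delta> * x - \<beta>)" using D assms(2) by (intro inn_diff inn_mult0) auto
  then show "inn 0 (moeb k x)" unfolding moeb_def using 1 by (simp add: k inn_div_iff)
qed

lemma moeb_diff:
  assumes "k \<in> Iwa1 v" "inn 0 x" "inn 0 y"
  shows "moeb k y - moeb k x = (y - x) * (mdet k / ((ea k - ec k * y) * (ea k - ec k * x)))"
proof -
  obtain \<alpha> \<beta> \<gamma> \<delta> where k: "k = (\<alpha>, \<beta>, \<gamma>, \<delta>)" by (cases k)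
  have "\<alpha> - \<gamma> * x \<noteq> 0" "\<alpha> - \<gamma> * y \<noteq> 0"
    using moeb_facts(1)[OF assms(1,2)] moeb_facts(1)[OF assms(1,3)] by (auto simp: k)
  moreover have "(\<delta> * y - \<beta>) / A - (\<delta> * x - \<beta>) / B = (y - x) * ((\<alpha> * \<delta> - \<beta> * \<gamma>) / (A * B))"
    if "A \<noteq> 0" "B \<noteq> 0" "A = \<alpha> - \<gamma> * y" "B = \<alpha> - \<gamma> * x" for A B
  proof -
    have "(\<delta> * y - \<beta>) / A - (\<delta> * x - \<beta>) / B = ((\<delta> * y - \<beta>) * B - (\<delta> * x - \<beta>) * A) / (A * B)"
      using that(1,2) by (simp add: diff_frac_eq)
    also have "(\<delta> * y - \<beta>) * B - (\<delta> * x - \<beta>) * A = (y - x) * (\<alpha> * \<delta> - \<beta> * \<gamma>)"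
      unfolding that by (simp add: algebra_simps)
    finally show ?thesis by simp
  qed
  ultimately show ?thesis by (simp add: moeb_def k)
qed

lemma mdet_Iwa1: "k \<in> Iwa1 v \<Longrightarrow> inn 1 (mdet k - 1)"
proof -
  assume kI: "k \<in> Iwa1 v"
  obtain \<alpha> \<beta> \<gamma> \<delta> where k: "k = (\<alpha>, \<beta>, \<gamma>, \<delta>)" by (cases k)
  note D = Iwa1_D[OF kI[unfolded k]]
  have "inn 1 (\<alpha> * \<delta> - 1)" "inn 1 (\<beta> * \<gamma>)" using D by (auto intro: prod_1 inn_mult_left)
  then have "inn 1 ((\<alpha> * \<delta> - 1) - \<beta> * \<gamma>)" by (rule inn_diff)
  then show ?thesis by (simp add: k algebra_simps)
qed

lemma quot_1: "inn 1 (a - 1) \<Longrightarrow> inn 1 (b - 1) \<Longrightarrow> inn 1 (a / b - 1)"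
proof -
  assume a: "inn 1 (a - 1)" "inn 1 (b - 1)"
  have b: "b \<noteq> 0" "v b = 0" using unit_1 a by auto
  have "inn 1 (((a - 1) - (b - 1)) / b)" using inn_diff[OF a] b by (subst inn_div_iff) auto
  also have "((a - 1) - (b - 1)) / b = a / b - 1" using b by (simp add: field_simps)
  finally show ?thesis .
qed

text \<open>By \<open>moeb_diff\<close> the difference is multiplied by the determinant over a
  product of two 1-units, hence by a 1-unit, which preserves its leading digit.\<close>

lemma moeb_shift:
  assumes "k \<in> Iwa1 v" "inn 0 x" "inn 0 z"
  shows "inn (int (Suc n)) (moeb k (x + \<pi> ^ n * z) - (moeb k x + \<pi> ^ n * z))"
proof -
  have y: "inn 0 (x + \<pi> ^ n * z)" using assms by (intro inn_add) (auto intro: inn_mono)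
  define U where "U = mdet k / ((ea k - ec k * (x + \<pi> ^ n * z)) * (ea k - ec k * x))"
  have "inn 1 (U - 1)" unfolding U_def
    by (intro quot_1 prod_1 mdet_Iwa1 moeb_facts assms y)
  then have "inn 1 (z * (U - 1))" using assms inn_mult_left by blast
  moreover have "moeb k (x + \<pi> ^ n * z) - moeb k x = (x + \<pi> ^ n * z - x) * U"
    unfolding U_def by (rule moeb_diff[OF assms(1,2) y])
  then have "moeb k (x + \<pi> ^ n * z) - (moeb k x + \<pi> ^ n * z) = \<pi> ^ n * (z * (U - 1))"
    by (simp add: algebra_simps)
  ultimately show ?thesis by simp
qed

text \<open>The factor \<open>h\<close> relating the two representatives is lower triangular with
  1-units on the diagonal, so chi_r is trivial on it and on its conjugate by
  \<open>bet\<close>.\<close>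

lemma co_act:
  assumes phi: "\<phi> \<in> ind" and k: "k \<in> Iwa1 v" and x: "inn 0 x"
  shows "co t n x (act k \<phi>) = co t n (moeb k x) \<phi>"
proof -
  obtain \<alpha> \<beta> \<gamma> \<delta> where kk: "k = (\<alpha>, \<beta>, \<gamma>, \<delta>)" by (cases k)
  note D = Iwa1_D[OF k[unfolded kk]]
  note F = moeb_facts[OF k x]
  define A where "A = \<alpha> - \<gamma> * x"
  define y where "y = moeb k x"
  have A: "A \<noteq> 0" "v A = 0" "up A = 1" using F red_1_plus[OF F(3)] by (auto simp: A_def kk)
  have yO: "inn 0 y" using F by (simp add: y_def)
  have Ay: "A * y = \<delta> * x - \<beta>" using A by (simp add: y_def moeb_def kk A_def)
  have B: "\<delta> + \<gamma> * y \<noteq> 0 \<and> v (\<delta> + \<gamma> * y) = 0 \<and> up (\<delta> + \<gamma> * y) = 1"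
    using unit_sub[of \<delta> "- (\<gamma> * y)"] D yO by (simp add: inn_mult_right)
  define h :: "'f m2" where "h = (A, 0, \<pi> ^ n * \<gamma>, \<delta> + \<gamma> * y)"
  have hI: "h \<in> IZ v" unfolding h_def IZ_iff using A B D(3) inn_mono[OF D(3), of "1 - int n"] by auto
  have Xh: "X h = 1" "X (cj h) = 1" using A B by (auto simp: h_def cj_eq chi_eq)
  have e: "mmul (1, - x, 0, \<pi> ^ n) k = mmul h (1, - y, 0, \<pi> ^ n)"
    using Ay by (simp add: kk h_def algebra_simps A_def)
  have cb: "mmul bet h = mmul (cj h) bet" unfolding cj_def by (simp add: mmul_assoc minv_left)
  have "\<exists>h'\<in>IZ v. X h' = 1 \<and> mmul (ci t n x) k = mmul h' (ci t n y)"
  proof (cases t)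
    case True
    have "mmul (ci t n x) k = mmul (cj h) (ci t n y)"
      unfolding ci_def mmul_assoc e using True by (simp add: bt_def cb mmul_assoc[symmetric])
    then show ?thesis using hI Xh by (intro bexI[of _ "cj h"]) auto
  next
    case False
    then have "mmul (ci t n x) k = mmul h (ci t n y)"
      unfolding ci_def mmul_assoc e by (simp add: bt_def)
    then show ?thesis using hI Xh by blast
  qed
  then show ?thesis unfolding co_def act_def y_def[symmetric] using ind_left[OF phi _ ci_GL2] by auto
qed

lemma co_bet_act:
  assumes "\<phi> \<in> ind" "k \<in> Iwa1 v" "inn 0 x"
  shows "co t n x (act bet (act k \<phi>)) = co t n (moeb (cj k) x) (act bet \<phi>)"
  unfolding bet_act using assms by (simp add: co_act cj_Iwa1)

text \<open>\<open>moeb_shift\<close> moves all \<open>q\<close> edges in the sum rigidly modulo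
  \<open>\<pi> ^ n\<close>, so the weights are unaffected.\<close>

lemma H_act:
  assumes phi: "\<phi> \<in> ind" and k: "k \<in> Iwa1 v" and x: "inn 0 x" and n: "n \<ge> 1"
  shows "H t n x (act k \<phi>) = H t n (moeb k x) \<phi>"
  unfolding H_def
proof (intro sum.cong refl arg_cong2[where f = "(*)"])
  fix m assume m: "m \<in> FF"
  have "co t n (x + \<pi> ^ (n - 1) * tc m) (act k \<phi>) = co t n (moeb k (x + \<pi> ^ (n - 1) * tc m)) \<phi>"
    using m x by (simp add: co_act[OF phi k])
  also have "\<dots> = co t n (moeb k x + \<pi> ^ (n - 1) * tc m) \<phi>"
    using moeb_shift[OF k x tc_inn[OF m], of "n - 1"] n by (intro co_cong[OF phi]) simp
  finally show "co t n (x + \<pi> ^ (n - 1) * tc m) (act k \<phi>) = co t n (moeb k x + \<pi> ^ (n - 1) * tc m) \<phi>" .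
qed

lemma lev_act: "\<phi> \<in> ind \<Longrightarrow> k \<in> Iwa1 v \<Longrightarrow> lev N \<phi> \<Longrightarrow> lev N (act k \<phi>)"
  unfolding lev_def using co_act co_bet_act moeb_facts(4) cj_Iwa1 by simp

section \<open>Vectors invariant modulo the kernels\<close>

abbreviation "invar \<equiv> inv_mod v red \<pi> r q"

lemma inv_ind: "invar \<phi> \<Longrightarrow> \<phi> \<in> ind"
  by (simp add: inv_mod_def)

text \<open>Beta normalizes I(1) as well and preserves the sum of the kernels.\<close>

lemma inv_bet: assumes "invar \<phi>" shows "invar (act bet \<phi>)"
  unfolding inv_mod_def
proof (intro conjI ballI)
  show "act bet \<phi> \<in> ind" using assms inv_ind by simp
  fix k assume "k \<in> Iwa1 v"
  then obtain k' where k': "k' \<in> Iwa1 v" "k = cj k'" using cj_Iwa1_surj by blast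
  have "(\<lambda>x. act k' \<phi> x - \<phi> x) \<in> W" using assms k' by (simp add: inv_mod_def)
  then have "act bet (\<lambda>x. act k' \<phi> x - \<phi> x) \<in> W" by (rule W_act) simp
  then show "(\<lambda>x. act k (act bet \<phi>) x - act bet \<phi> x) \<in> W"
    unfolding act_diff bet_act k'(2) .
qed

lemma inv_W: "w \<in> W \<Longrightarrow> invar w"
  unfolding inv_mod_def by (auto intro!: W_ind W_diff W_act Iwa1_GL2)

lemma inv_diff: assumes "invar \<phi>" "invar \<psi>" shows "invar (\<lambda>x. \<phi> x - \<psi> x)"
  unfolding inv_mod_def
proof (intro conjI ballI)
  show "(\<lambda>x. \<phi> x - \<psi> x) \<in> ind" using assms inv_ind ind_diff by blast
  fix k assume "k \<in> Iwa1 v"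
  then have "(\<lambda>x. (act k \<phi> x - \<phi> x) - (act k \<psi> x - \<psi> x)) \<in> W"
    using assms by (intro W_diff[of "\<lambda>x. act k \<phi> x - \<phi> x"]) (auto simp: inv_mod_def)
  then show "(\<lambda>x. act k (\<lambda>x. \<phi> x - \<psi> x) x - (\<phi> x - \<psi> x)) \<in> W"
    unfolding act_diff by (simp add: algebra_simps)
qed

lemma inv_scale: assumes "invar \<phi>" shows "invar (\<lambda>x. c * \<phi> x)"
  unfolding inv_mod_def
proof (intro conjI ballI)
  show "(\<lambda>x. c * \<phi> x) \<in> ind" using assms inv_ind ind_scale by blast
  fix k assume "k \<in> Iwa1 v"
  then have "(\<lambda>x. c * (act k \<phi> x - \<phi> x)) \<in> W"
    using assms by (intro W_scale) (auto simp: inv_mod_def)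
  then show "(\<lambda>x. act k (\<lambda>x. c * \<phi> x) x - c * \<phi> x) \<in> W"
    unfolding act_scale by (simp add: algebra_simps)
qed

lemma inv_0: "invar (\<lambda>_. 0)"
  by (rule inv_W[OF W_0])

lemma inv_add: "invar \<phi> \<Longrightarrow> invar \<psi> \<Longrightarrow> invar (\<lambda>x. \<phi> x + \<psi> x)"
  using inv_diff[of \<phi> "\<lambda>x. (-1) * \<psi> x"] inv_scale[of \<psi> "-1"] by simp

lemma inv_sum: "(\<And>i. i \<in> A \<Longrightarrow> invar (g i)) \<Longrightarrow> invar (\<lambda>x. \<Sum>i\<in>A. g i x)"
  by (induction A rule: infinite_finite_induct) (auto intro: inv_add inv_0)

section \<open>Base \<open>p\<close> digits, binomial coefficients modulo \<open>p\<close> and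
  vanishing convolutions\<close>

lemma complement_digits:
  fixes n m P :: nat
  assumes "n < m * P" "0 < P"
  shows "(m * P - 1 - n) div P = m - 1 - n div P \<and> (m * P - 1 - n) mod P = P - 1 - n mod P"
proof -
  have "n div P < m" using assms by (simp add: less_mult_imp_div_less)
  then have "m * P - 1 - n = (m - 1 - n div P) * P + (P - 1 - n mod P)"
  proof -
    obtain d where d: "m = n div P + 1 + d" using \<open>n div P < m\<close> by (metis Suc_eq_plus1 add.commute less_iff_Suc_add add_Suc_right)
    have "n mod P < P" using assms by simp
    moreover have "m * P = n div P * P + P + d * P" unfolding d by (simp add: algebra_simps)
    moreover have "n = n div P * P + n mod P" by simp
    ultimately have "m * P - 1 - n = d * P + (P - 1 - n mod P)" by linarith
    moreover have "m - 1 - n div P = d" using d by simp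
    ultimately show ?thesis by (simp only:)
  qed
  moreover have "P - 1 - n mod P < P" using assms by simp
  ultimately show ?thesis by (metis add.commute div_mult_self1 div_less mod_mult_self1 mod_less add_0 add.right_neutral assms(2) less_numeral_extra(3))
qed

text \<open>Subtraction from \<open>q - 1\<close> involves no borrowing: the digits of
  \<open>q - 1 - r\<close> are \<open>p - 1 - r_j\<close>, which satisfy the same strict
  bounds.\<close>

lemma kap_exp_digits:
  assumes "j < f" shows "0 < kap_exp t div p ^ j mod p \<and> kap_exp t div p ^ j mod p < p - 1"
proof (cases t)
  case True
  have "p ^ f = p ^ (f - j) * p ^ j" using assms by (simp flip: power_add)
  then have 1: "(q - 1 - r) div p ^ j = p ^ (f - j) - 1 - r div p ^ j"
    using complement_digits[of r "p ^ (f - j)" "p ^ j"] r_lt by simp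
  have pp: "p ^ (f - j) = p ^ (f - j - 1) * p" using assms power_minus_mult[of "f - j" p] by simp
  have "r div p ^ j < p ^ (f - j)"
    using r_lt \<open>p ^ f = p ^ (f - j) * p ^ j\<close> by (intro less_mult_imp_div_less) linarith
  then have "(p ^ (f - j) - 1 - r div p ^ j) mod p = p - 1 - r div p ^ j mod p"
    using complement_digits[of "r div p ^ j" "p ^ (f - j - 1)" p] pp by simp
  then show ?thesis using True digits assms 1 by (auto simp: kap_exp_def)
next
  case False
  then show ?thesis using digits assms by (auto simp: kap_exp_def)
qed

lemma prime_power_choose:
  assumes "0 < i" "i < p ^ l" shows "p dvd (p ^ l choose i)"
proof (rule ccontr)
  assume "\<not> p dvd (p ^ l choose i)"
  then have "coprime (p ^ l) (p ^ l choose i)" using prime_p by (simp add: prime_imp_coprime)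
  moreover obtain k where k: "i = Suc k" using assms(1) by (cases i) auto
  then have "p ^ l dvd i * (p ^ l choose i)"
    using binomial_absorption[of k "p ^ l"] by simp
  ultimately have "p ^ l dvd i" using coprime_dvd_mult_left_iff by blast
  then show False using assms by (auto dest: dvd_imp_le)
qed

lemma binom_shift: "(of_nat ((n + p ^ l) choose p ^ l) :: 'k) = of_nat (n choose p ^ l) + 1"
proof -
  let ?P = "p ^ l"
  have "(of_nat ((n + ?P) choose ?P) :: 'k) = (\<Sum>i\<le>?P. of_nat ((n choose i) * (?P choose (?P - i))))"
    unfolding of_nat_sum[symmetric] vandermonde ..
  also have "\<dots> = (\<Sum>i\<in>{0, ?P}. of_nat ((n choose i) * (?P choose (?P - i))))"
  proof (rule sum.mono_neutral_right)
    show "\<forall>i\<in>{..?P} - {0, ?P}. (of_nat ((n choose i) * (?P choose (?P - i))) :: 'k) = 0"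
    proof
      fix i assume "i \<in> {..?P} - {0, ?P}"
      then have "p dvd (?P choose (?P - i))" by (intro prime_power_choose) auto
      then show "(of_nat ((n choose i) * (?P choose (?P - i))) :: 'k) = 0"
        by (simp only: of_nat_k_0_iff dvd_mult)
    qed
  qed auto
  also have "\<dots> = of_nat (n choose ?P) + 1" by simp
  finally show ?thesis .
qed

text \<open>The needed case of Lucas' theorem: modulo \<open>p\<close> the coefficient is the digit
  of \<open>n\<close> at place \<open>l\<close>. Each step subtracts \<open>p ^ l\<close>, and
  Vandermonde leaves only the two extreme terms.\<close>

lemma binom_frob: "(of_nat (n choose p ^ l) :: 'k) = of_nat (n div p ^ l)"
proof (induction n rule: less_induct)
  case (less n)
  show ?case
  proof (cases "n < p ^ l")
    case False
    moreover have "0 < p ^ l" by simp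
    ultimately have "n - p ^ l < n" "n = (n - p ^ l) + p ^ l" by linarith+
    then have "(of_nat (n choose p ^ l) :: 'k) = of_nat ((n - p ^ l) div p ^ l) + 1"
      using binom_shift[of "n - p ^ l" l] less.IH by metis
    also have "\<dots> = of_nat (n div p ^ l)" using False by (simp add: le_div_geq)
    finally show ?thesis .
  qed (simp add: binomial_eq_0)
qed

lemma binom_Rx_nz: "l < f \<Longrightarrow> (of_nat (kap_exp t choose p ^ l) :: 'k) \<noteq> 0"
  using kap_exp_digits[of l t] unfolding binom_frob of_nat_k_0_iff by (auto simp: dvd_eq_mod_eq_0)

lemma q_split: "l < f \<Longrightarrow> p ^ l < q - 1"
proof -
  assume "l < f"
  then have "p ^ l * p \<le> q" using power_increasing[of "Suc l" f p] p_ge3 by (simp add: mult.commute Suc_leI)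
  moreover have "p ^ l * 3 \<le> p ^ l * p" using p_ge3 by simp
  moreover have "p ^ l \<ge> 1" by (simp add: Suc_leI One_nat_def)
  ultimately show ?thesis by linarith
qed

text \<open>The range of \<open>i\<close> in the monomials \<open>m ^ (i * p ^ b)\<close> to be
  annihilated. The quadratic term of the group action requires 2, the carries require
  \<open>p - 1\<close>; for \<open>f = 1\<close> and \<open>e\<close> at least 2 the carries are
  0.\<close>

definition bound :: nat where "bound = (if f = 1 then 2 else p - 1)"

lemma FF_power_q: "z \<in> FF \<Longrightarrow> z ^ (q * n) = z ^ n"
  by (simp add: power_mult FF_fermat)

text \<open>The bracket is the rotation of the base \<open>p\<close> digits of
  \<open>kap_exp t\<close> by \<open>b\<close> places. For \<open>f\<close> at least 2 its top digit
  is at most \<open>p - 2\<close>, which leaves a gap of \<open>p ^ (f - 1)\<close> for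
  \<open>i\<close>. For \<open>f = 1\<close> the two values of \<open>t\<close> use
  \<open>r < p - 3\<close> and \<open>r > 2\<close> respectively.\<close>

lemma rotated_bound:
  assumes "i \<le> bound" "b < f"
  shows "i + ((kap_exp t mod p ^ b) * p ^ (f - b) + kap_exp t div p ^ b) < q - 1"
proof (cases "f = 1")
  case True
  then have "kap_exp t < p - 3" unfolding kap_exp_def using f1 r_pos by auto
  then show ?thesis using True assms unfolding bound_def by auto
next
  case False
  then have f2: "f \<ge> 2" using f_ge by simp
  let ?R = "kap_exp t"
  have Rq: "?R < q" using kap_exp_bounds[of t] by simp
  have top: "(?R mod p ^ b) * p ^ (f - b) + ?R div p ^ b < (p - 1) * p ^ (f - 1)"
  proof (cases "b = 0")
    case True
    have "?R div p ^ (f - 1) < p"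
      using Rq f2 by (intro less_mult_imp_div_less) (simp add: power_minus_mult mult.commute[of p])
    then have "?R div p ^ (f - 1) < p - 1" using kap_exp_digits[of "f - 1" t] f2 by simp
    then show ?thesis using True by (simp add: div_less_iff_less_mult)
  next
    case False
    then obtain c where c: "b = Suc c" by (cases b) auto
    have "(?R mod p ^ b) div p ^ c = ?R div p ^ c mod p"
      unfolding c by (simp add: mod_mult2_eq mult.commute[of p])
    also have "\<dots> < p - 1" using kap_exp_digits[of c t] assms c by simp
    finally have "?R mod p ^ b < (p - 1) * p ^ c" by (simp add: div_less_iff_less_mult)
    then have "(?R mod p ^ b + 1) * p ^ (f - b) \<le> (p - 1) * p ^ c * p ^ (f - b)" by (intro mult_right_mono) auto
    also have "\<dots> = (p - 1) * p ^ (f - 1)" using assms c by (simp add: mult.assoc One_nat_def flip: power_add)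
    finally have 1: "?R mod p ^ b * p ^ (f - b) + p ^ (f - b) \<le> (p - 1) * p ^ (f - 1)" by (simp add: algebra_simps)
    have "?R div p ^ b < p ^ (f - b)"
      using Rq assms by (intro less_mult_imp_div_less) (simp flip: power_add)
    then show ?thesis using 1 by linarith
  qed
  have "p ^ 1 \<le> p ^ (f - 1)" using f2 p_ge3 by (intro power_increasing) auto
  then have pf: "p \<le> p ^ (f - 1)" by simp
  have qq: "q = (p - 1) * p ^ (f - 1) + p ^ (f - 1)"
  proof -
    have "q = p * p ^ (f - 1)" using power_minus_mult[of f p] f2 by (simp add: mult.commute)
    also have "\<dots> = (p - 1 + 1) * p ^ (f - 1)" using p_ge3 by simp
    finally show ?thesis by (simp only: distrib_right mult_1)
  qed
  have "i \<le> p - 1" using assms False by (simp add: bound_def)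
  then show ?thesis using top pf p_ge3 unfolding qq by linarith
qed

text \<open>Raising to a power of p rotates the base p digits of all exponents, after which the total degree
is below q - 1; this is where r_j < p - 1, and 2 < r < p - 3 for f = 1, is needed.\<close>

lemma vanish_monomial:
  assumes "i \<le> bound" "\<nu> \<in> FF"
  shows "(\<Sum>m\<in>FF. m ^ (i * p ^ b) * (\<nu> - m) ^ kap_exp t) = 0"
proof -
  have main: "(\<Sum>m\<in>FF. m ^ (i * p ^ b) * (\<nu> - m) ^ kap_exp t) = 0" if b: "b < f" for b
  proof -
    let ?s = "f - b" and ?R = "kap_exp t" and ?R' = "(kap_exp t mod p ^ b) * p ^ (f - b) + kap_exp t div p ^ b"
    let ?S = "\<Sum>m\<in>FF. m ^ (i * p ^ b) * (\<nu> - m) ^ ?R"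
    have q: "p ^ b * p ^ ?s = q" using b by (simp flip: power_add)
    have z: "(z ^ ?R) ^ (p ^ ?s) = z ^ ?R'" if "z \<in> FF" for z
    proof -
      have "?R * p ^ ?s = (?R div p ^ b * p ^ b + ?R mod p ^ b) * p ^ ?s" by (simp only: div_mult_mod_eq)
      also have "\<dots> = (p ^ b * p ^ ?s) * (?R div p ^ b) + ?R mod p ^ b * p ^ ?s" by (simp only: distrib_left distrib_right mult_ac)
      also have "\<dots> = q * (?R div p ^ b) + ?R mod p ^ b * p ^ ?s" by (simp only: q)
      finally have "?R * p ^ ?s = q * (?R div p ^ b) + ?R mod p ^ b * p ^ ?s" .
      then show ?thesis using that by (simp add: FF_power_q power_add mult.commute flip: power_mult)
    qed
    have "?S ^ (p ^ ?s) = (\<Sum>m\<in>FF. m ^ i * (\<nu> - m) ^ ?R')"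
      unfolding frob_sum
    proof (intro sum.cong refl)
      fix m assume m: "m \<in> FF"
      have "(m ^ (i * p ^ b)) ^ (p ^ ?s) = m ^ (q * i)" by (simp add: q[symmetric] mult_ac flip: power_mult)
      then show "(m ^ (i * p ^ b) * (\<nu> - m) ^ ?R) ^ (p ^ ?s) = m ^ i * (\<nu> - m) ^ ?R'"
        using m assms z[of "\<nu> - m"] by (simp add: power_mult_distrib FF_power_q)
    qed
    also have "\<dots> = 0" by (rule conv_small[OF rotated_bound[OF assms(1) b]])
    finally show ?thesis by simp
  qed
  have "m ^ (i * p ^ b) = m ^ (i * p ^ (b mod f))" if "m \<in> FF" for m
  proof -
    have it: "x ^ (p ^ (f * k)) = x" if "x \<in> FF" for x k
    proof (induction k)
      case (Suc k)
      have "p ^ (f * Suc k) = q * p ^ (f * k)" by (simp add: power_add)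
      then show ?case using Suc that by (simp only: FF_power_q)
    qed simp
    have "p ^ b = p ^ (f * (b div f)) * p ^ (b mod f)" by (simp flip: power_add)
    then have "m ^ (i * p ^ b) = ((m ^ (p ^ (b mod f))) ^ i) ^ (p ^ (f * (b div f)))" by (simp add: mult_ac flip: power_mult)
    also have "\<dots> = (m ^ (p ^ (b mod f))) ^ i" using that by (intro it) simp
    finally show ?thesis by (simp add: mult.commute flip: power_mult)
  qed
  then show ?thesis using main[of "b mod f"] f_ge by (simp cong: sum.cong)
qed

text \<open>Frobenius twists are included because digits will occur to the power
  \<open>p ^ l\<close>, and both weights because s_n and t_n are treated together.\<close>

definition conv_null :: "('k \<Rightarrow> 'k) \<Rightarrow> bool" where
  "conv_null g \<longleftrightarrow> (\<forall>l t. \<forall>\<nu>\<in>FF. (\<Sum>m\<in>FF. g m ^ (p ^ l) * (\<nu> - m) ^ kap_exp t) = 0)"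

lemma conv_null_add: "conv_null g \<Longrightarrow> conv_null h \<Longrightarrow> conv_null (\<lambda>m. g m + h m)"
  by (simp add: conv_null_def frob distrib_right sum.distrib)

lemma conv_null_0: "conv_null (\<lambda>_. 0)"
  by (simp add: conv_null_def zero_power)

lemma conv_null_sum: "finite A \<Longrightarrow> (\<And>i. i \<in> A \<Longrightarrow> conv_null (g i)) \<Longrightarrow> conv_null (\<lambda>m. \<Sum>i\<in>A. g i m)"
  by (induction A rule: finite_induct) (auto intro: conv_null_add simp: conv_null_0)

lemma conv_null_monomial: "i \<le> bound \<Longrightarrow> conv_null (\<lambda>m. c * m ^ (i * p ^ b))"
  unfolding conv_null_def
proof (intro allI ballI)
  fix l t \<nu> assume a: "i \<le> bound" "\<nu> \<in> FF"
  have "(\<Sum>m\<in>FF. (c * m ^ (i * p ^ b)) ^ (p ^ l) * (\<nu> - m) ^ kap_exp t) = c ^ (p ^ l) * (\<Sum>m\<in>FF. m ^ (i * p ^ (b + l)) * (\<nu> - m) ^ kap_exp t)"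
    by (simp add: sum_distrib_left power_mult_distrib power_add mult_ac flip: power_mult)
  then show "(\<Sum>m\<in>FF. (c * m ^ (i * p ^ b)) ^ (p ^ l) * (\<nu> - m) ^ kap_exp t) = 0"
    using vanish_monomial[OF a] by simp
qed

lemma conv_null_cong: "conv_null g \<Longrightarrow> (\<And>m. m \<in> FF \<Longrightarrow> h m = g m) \<Longrightarrow> conv_null h"
  by (simp add: conv_null_def cong: sum.cong)

text \<open>If \<open>f = 1\<close>, ramification makes every carry reduce to 0. Otherwise
  \<open>cr_formula\<close> expresses the carry by monomials of exponent
  \<open>i * p ^ (f - 1)\<close> with \<open>i < p\<close>, all within \<open>bound\<close>.\<close>

lemma conv_null_cr:
  assumes "\<not> (e = 1 \<and> f = 1)" "b \<in> FF" shows "conv_null (\<lambda>m. cr b m)"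
proof (cases "f = 1")
  case True
  then have "red (of_nat p / \<pi>) = 0" using assms e_ge p_pi_red by auto
  then have "cr b m = 0 * m ^ (0 * p ^ 0)" if "m \<in> FF" for m using cr_formula[OF assms(2) that] by simp
  then show ?thesis by (rule conv_null_cong[OF conv_null_monomial, rotated]) simp_all
next
  case False
  have "conv_null (\<lambda>m. \<Sum>i\<in>{1..<p}. (- red (of_nat p / \<pi>) * of_nat ((p choose i) div p) * (b ^ p ^ (f - 1)) ^ (p - i)) * m ^ (i * p ^ (f - 1)))"
    by (intro conv_null_sum conv_null_monomial) (use False in \<open>auto simp: bound_def\<close>)
  then show ?thesis by (rule conv_null_cong) (rule cr_formula[OF assms(2)])
qed

section \<open>Invariance of the basis vectors\<close>

lemma dg_ds_add:
  assumes "\<And>i. i < n \<Longrightarrow> \<mu> i \<in> FF" "inn 0 z" shows "dg n (ds n \<mu> + \<pi> ^ n * z) = red z"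
proof -
  have O: "inn 0 (ds n \<mu>)" using assms(1) by (rule ds_inn)
  have "trunc n (ds n \<mu>) = ds n \<mu>"
    unfolding trunc_def by (rule ds_cong, rule dg_ds[OF O assms(1)]) auto
  then have "\<pi> ^ n * rem n (ds n \<mu>) = 0" using trunc_rem[of "ds n \<mu>" n] by simp
  then have "dg n (ds n \<mu>) = 0" by (simp add: dg_def)
  then show ?thesis using dg_add[OF O assms(2)] by simp
qed

lemma ds_upd: "ds n \<mu> + \<pi> ^ n * tc m = ds (Suc n) (\<mu>(n := m))"
proof -
  have "ds n (\<mu>(n := m)) = ds n \<mu>" by (rule ds_cong) simp
  then show ?thesis by (simp add: ds_Suc mult.commute)
qed

text \<open>Expansion of the Moebius action around \<open>x\<close> up to
  \<open>\<pi> ^ (n + 2)\<close>: \<open>c1\<close> measures how far the derivative is from 1,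
  \<open>c2\<close> comes from the lower left entry of \<open>k\<close>.\<close>

lemma moeb_expand:
  assumes k: "k \<in> Iwa1 v" and x: "inn 0 x"
  obtains c1 c2 where "inn 0 c1" "inn 0 c2"
    "\<And>y. inn 0 y \<Longrightarrow> \<exists>z. inn 1 z \<and> moeb k (x + \<pi> ^ n * y) = moeb k x + \<pi> ^ n * (y + \<pi> * (c1 * y + c2 * y ^ 2 + z))"
proof -
  define A where "A = ea k - ec k * x"
  define G where "G = ec k * \<pi> ^ n"
  define u where "u = mdet k / (A * A)"
  have A: "A \<noteq> 0" "v A = 0" "inn 1 (A - 1)" using moeb_facts[OF k x] by (auto simp: A_def)
  have "inn 1 (ec k)" using k by (auto simp: Iwa1_def Iwa_def)
  then have G: "inn 1 G" unfolding G_def by (simp add: inn_mono)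
  have u1: "inn 1 (u - 1)" unfolding u_def by (intro quot_1 prod_1 mdet_Iwa1 k A)
  have u0: "inn 0 u" using unit_1[OF u1] by (simp add: inO_def)
  have GA: "inn 1 (G / A)" using G A by (simp add: inn_div_iff)
  define c1 where "c1 = (u - 1) / \<pi>"
  define c2 where "c2 = u * (G / A) / \<pi>"
  have c: "inn 0 c1" "inn 0 c2" using u1 u0 GA by (auto simp: c1_def c2_def inn_div_iff simp del: times_divide_eq_right intro: inn_mult_left)
  show thesis
  proof (rule that[OF c])
    fix y assume y: "inn 0 y"
    have B: "A - G * y \<noteq> 0" "v (A - G * y) = 0" using unit_sub[OF A(3), of "G * y"] G y by (auto simp: inn_mult_right)
    define s where "s = G / A * y"
    have s: "inn 1 s" unfolding s_def using GA y by (rule inn_mult_right)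
    \<comment> \<open>The tail of the geometric series:
      \<open>u / (1 - s) = u * (1 + s) + w\<close>.\<close>
    define w where "w = u * (s * s) * (A / (A - G * y))"
    have "inn (1 + 1) (s * s)" using s inn_mult by blast
    moreover have "inn 0 (A / (A - G * y))" using A B by (simp add: inn_div_iff) (simp add: inO_def)
    ultimately have w: "inn 2 w" unfolding w_def using inn_mult_right[OF inn_mult_left[OF u0]] by (simp del: times_divide_eq_right)
    have xy: "inn 0 (x + \<pi> ^ n * y)" using x y by (intro inn_add) (auto intro: inn_mono)
    have AB: "ea k - ec k * (x + \<pi> ^ n * y) = A - G * y" by (simp add: A_def G_def algebra_simps)
    have Gs: "G * y = A * s" using A by (simp add: s_def)
    have uA: "mdet k = u * A * A" using A by (simp add: u_def)
    have s1: "1 - s \<noteq> 0" using B(1) A(1) unfolding Gs by (metis diff_self mult.right_neutral right_diff_distrib mult_zero_right)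
    have q: "mdet k / ((A - G * y) * A) = u * (1 + s) + w"
    proof -
      have e: "A - A * s = A * (1 - s)" by (simp add: algebra_simps)
      have "mdet k / ((A - G * y) * A) = u / (1 - s)" unfolding uA Gs e using A s1 by (simp add: field_simps)
      moreover have "w = u * (s * s) / (1 - s)" unfolding w_def Gs e using A s1 by simp
      moreover have "u / (1 - s) = u * (1 + s) + u * (s * s) / (1 - s)" using s1 by (simp add: divide_eq_eq distrib_right) (simp add: algebra_simps)
      ultimately show ?thesis by simp
    qed
    have "moeb k (x + \<pi> ^ n * y) - moeb k x = \<pi> ^ n * y * (u * (1 + s) + w)"
      using moeb_diff[OF k x xy] unfolding AB A_def[symmetric] q by simp
    also have "\<dots> = \<pi> ^ n * (y + \<pi> * (c1 * y + c2 * y ^ 2 + y * w / \<pi>))"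
      by (simp add: c1_def c2_def s_def distrib_left power2_eq_square) (simp add: algebra_simps)
    finally have "moeb k (x + \<pi> ^ n * y) = moeb k x + \<pi> ^ n * (y + \<pi> * (c1 * y + c2 * y ^ 2 + y * w / \<pi>))" by (simp only: diff_eq_eq add.commute)
    moreover have "inn 1 (y * w / \<pi>)" using y w by (simp add: inn_div_iff inn_mult_left)
    ultimately show "\<exists>z. inn 1 z \<and> moeb k (x + \<pi> ^ n * y) = moeb k x + \<pi> ^ n * (y + \<pi> * (c1 * y + c2 * y ^ 2 + z))" by blast
  qed
qed

lemma bound_ge2: "2 \<le> bound"
  using p_ge3 unfolding bound_def by auto

text \<open>The change of the digit of index n + 1 under k is, as a function of the preceding digit m, a carry
plus a polynomial of degree 2 in m; the quadratic term comes from the lower left entry of k (only for n = 0).\<close>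

lemma carry_conv_null:
  assumes nq: "\<not> (e = 1 \<and> f = 1)" and k: "k \<in> Iwa1 v" and x: "inn 0 x"
  shows "conv_null (\<lambda>m. dg (Suc n) (moeb k (trunc n x + \<pi> ^ n * tc m)) - dg (Suc n) (trunc n x + \<pi> ^ n * tc m))"
proof -
  define x0 where "x0 = trunc n x"
  have x0: "inn 0 x0" using x by (simp add: x0_def)
  obtain c1 c2 where c: "inn 0 c1" "inn 0 c2"
    "\<And>y. inn 0 y \<Longrightarrow> \<exists>z. inn 1 z \<and> moeb k (x0 + \<pi> ^ n * y) = moeb k x0 + \<pi> ^ n * (y + \<pi> * (c1 * y + c2 * y ^ 2 + z))"
    using moeb_expand[OF k x0] by blast
  define X0 where "X0 = moeb k x0"
  have X0: "inn 0 X0" unfolding X0_def by (rule moeb_facts(4)[OF k x0])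
  define s where "s = rem n X0"
  define b where "b = red s"
  have s: "inn 0 s" using X0 by (simp add: s_def)
  have b: "b \<in> FF" using s by (simp add: b_def)
  define s1 where "s1 = (s - tc b) / \<pi>"
  have s1: "inn 0 s1" using tc_red_cong[OF s] by (simp add: s1_def b_def inn_div_iff)
  have g: "dg (Suc n) (moeb k (x0 + \<pi> ^ n * tc m)) - dg (Suc n) (x0 + \<pi> ^ n * tc m)
     = red s1 * m ^ (0 * p ^ 0) + (cr b m + (red c1 * m ^ (1 * p ^ 0) + red c2 * m ^ (2 * p ^ 0)))" if m: "m \<in> FF" for m
  proof -
    have "x0 + \<pi> ^ n * tc m = ds (Suc n) ((\<lambda>i. dg i x)(n := m)) + \<pi> ^ Suc n * 0"
      unfolding x0_def trunc_def ds_upd by simp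
    then have 1: "dg (Suc n) (x0 + \<pi> ^ n * tc m) = 0"
      using dg_ds_add[of "Suc n" "(\<lambda>i. dg i x)(n := m)" 0] x m by (simp del: power_Suc)
    obtain z where z: "inn 1 z" "moeb k (x0 + \<pi> ^ n * tc m) = X0 + \<pi> ^ n * (tc m + \<pi> * (c1 * tc m + c2 * tc m ^ 2 + z))"
      using c(3)[OF tc_inn[OF m]] by (auto simp: X0_def)
    define y where "y = tc m"
    define \<kappa> where "\<kappa> = (tc b + y - tc (b + m)) / \<pi>"
    have K: "inn 0 \<kappa>" "red \<kappa> = cr b m" using cr_inn[OF b m] by (auto simp: \<kappa>_def y_def cr_def)
    \<comment> \<open>\<open>Z\<close> collects all that lands at place \<open>n + 1\<close>: the
      tail of \<open>X0\<close>, the carry of \<open>tc b + tc m\<close>, and the terms of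
      \<open>moeb_expand\<close>.\<close>
    define Z where "Z = s1 + (\<kappa> + (c1 * y + (c2 * y ^ 2 + z)))"
    have yO: "inn 0 y" "red y = m" using m by (auto simp: y_def)
    have z0: "inn 0 z" "red z = 0" using z(1) inn_mono[OF z(1), of 0] red_0_iff[of z] by auto
    have O: "inn 0 (c1 * y)" "inn 0 (c2 * y ^ 2)" "inn 0 (y ^ 2)" using c yO by (auto intro: inn_mult0 inn_power)
    have Z: "inn 0 Z" unfolding Z_def using s1 K O z0 by (intro inn_add)
    have rZ: "red Z = red s1 + (cr b m + (red c1 * m + red c2 * m ^ 2))"
      unfolding Z_def using s1 K O z0 c yO by (simp add: red_add inn_add red_mult red_power)
    have se: "s = tc b + \<pi> * s1" by (simp add: s1_def)
    have ke: "tc b + y = tc (b + m) + \<pi> * \<kappa>" by (simp add: \<kappa>_def)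
    have "moeb k (x0 + \<pi> ^ n * tc m) = trunc n X0 + \<pi> ^ n * (s + y + \<pi> * (c1 * y + c2 * y ^ 2 + z))"
      unfolding z(2) using trunc_rem[of X0 n] by (simp add: s_def y_def[symmetric] distrib_left)
    also have "s + y + \<pi> * (c1 * y + c2 * y ^ 2 + z) = (tc b + y) + \<pi> * s1 + \<pi> * (c1 * y + c2 * y ^ 2 + z)"
      unfolding se by simp
    also have "\<dots> = tc (b + m) + \<pi> * Z" unfolding ke Z_def by (simp add: algebra_simps)
    also have "trunc n X0 + \<pi> ^ n * (tc (b + m) + \<pi> * Z) = ds (Suc n) ((\<lambda>i. dg i X0)(n := b + m)) + \<pi> ^ Suc n * Z"
      unfolding ds_upd[symmetric] trunc_def by (simp add: algebra_simps)
    finally have "dg (Suc n) (moeb k (x0 + \<pi> ^ n * tc m)) = red Z"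
      using dg_ds_add[of "Suc n" "(\<lambda>i. dg i X0)(n := b + m)" Z] X0 b m Z by (simp del: power_Suc)
    then show ?thesis using 1 rZ by simp
  qed
  have "conv_null (\<lambda>m. red s1 * m ^ (0 * p ^ 0) + (cr b m + (red c1 * m ^ (1 * p ^ 0) + red c2 * m ^ (2 * p ^ 0))))"
    using bound_ge2 by (intro conv_null_add conv_null_monomial conv_null_cr nq b) auto
  then show ?thesis unfolding x0_def[symmetric] by (rule conv_null_cong) (rule g)
qed

section \<open>The vectors s_n and t_n in coordinates, and their invariance\<close>

definition tau :: "bool \<Rightarrow> nat \<Rightarrow> nat \<Rightarrow> 'f m2 \<Rightarrow> 'k" where
  "tau t N j = (\<lambda>y. \<Sum>\<mu>\<in>digs v red N. \<mu> (N - 1) ^ j * E t N (ds N \<mu>) y)"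

lemma tau_ind [simp]: "tau t N j \<in> ind"
  unfolding tau_def by (intro ind_sum ind_scale E_ind)

lemma co_tau:
  assumes "N \<ge> 1" "inn 0 x"
  shows "co t' n x (tau t N j) = (if t' = t \<and> n = N then dg (N - 1) x ^ j else 0)"
proof (cases "t' = t \<and> n = N")
  case True
  have "co t' n x (tau t N j) = (\<Sum>\<mu>\<in>digs v red N. if inn (int N) (x - ds N \<mu>) then \<mu> (N - 1) ^ j else 0)"
    unfolding tau_def co_sum co_scale using True assms by (intro sum.cong refl) (simp add: co_E)
  then show ?thesis using digs_sum[OF assms(2), of N "\<lambda>\<mu>. \<mu> (N - 1) ^ j"] True assms by simp
next
  case False
  then have "co t' n x (tau t N j) = 0"
    unfolding tau_def co_sum co_scale using assms by (intro sum.neutral) (auto simp: co_E)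
  with False show ?thesis by auto
qed

lemma co_bet_tau: "N \<ge> 1 \<Longrightarrow> inn 0 x \<Longrightarrow> co t' n x (act bet (tau t N j)) = 0"
  unfolding tau_def act_sum act_scale co_sum co_scale by (intro sum.neutral) (auto simp: co_bE)

lemma lev_tau: "N \<ge> 1 \<Longrightarrow> N \<le> M \<Longrightarrow> lev M (tau t N j)"
  by (auto simp: lev_def co_tau co_bet_tau)

text \<open>Equal to \<open>r + p ^ l\<close> for t_n and \<open>q - 1 - r + p ^ l\<close> for s_n;
  by \<open>conv_frob\<close> it is the exponent whose convolution collapses to a single Frobenius
  power.\<close>

definition tau_exp :: "bool \<Rightarrow> nat \<Rightarrow> nat" where "tau_exp t l = (q - 1 - kap_exp t) + p ^ l"

definition H_const :: "bool \<Rightarrow> nat \<Rightarrow> 'k" where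
  "H_const t l = kap_sign t * (- of_nat (kap_exp t choose p ^ l) * (-1) ^ (kap_exp t - p ^ l))"

lemma H_const_nz: "l < f \<Longrightarrow> H_const t l \<noteq> 0"
  using binom_Rx_nz by (simp add: H_const_def)

lemma kap_conv: "(\<Sum>m\<in>FF. kap t (m - \<nu>) * g m) = kap_sign t * (\<Sum>m\<in>FF. g m * (\<nu> - m) ^ kap_exp t)"
  by (simp add: kap_eq sum_distrib_left mult_ac)

lemma H_tau:
  assumes "N \<ge> 1" "inn 0 x" "l < f"
  shows "H t N x (tau t N (tau_exp t l)) = H_const t l * dg (N - 1) x ^ p ^ l"
proof -
  let ?d = "dg (N - 1) x"
  have d: "?d \<in> FF" using assms by simp
  have "H t N x (tau t N (tau_exp t l)) = (\<Sum>m\<in>FF. kap t ((m + ?d) - ?d) * (m + ?d) ^ tau_exp t l)"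
    unfolding H_def using assms by (intro sum.cong refl) (simp add: co_tau dg_add add.commute)
  also have "\<dots> = (\<Sum>m\<in>FF. kap t (m - ?d) * m ^ tau_exp t l)"
    by (rule FF_shift[OF d, of "\<lambda>m. kap t (m - ?d) * m ^ tau_exp t l"])
  also have "\<dots> = H_const t l * ?d ^ p ^ l"
    unfolding kap_conv tau_exp_def using kap_exp_bounds(2)[of t] q_split[OF assms(3)]
    by (subst conv_frob) (auto simp: H_const_def)
  finally show ?thesis .
qed

text \<open>\<open>reduce\<close> is applied twice to the difference of the vector and its
  translate: first it becomes \<open>h\<close> at level \<open>N - 1\<close> and opposite type, and
  there \<open>carry_conv_null\<close> makes the convolution vanish.\<close>

lemma tau_inv:
  assumes nq: "\<not> (e = 1 \<and> f = 1)" and N: "N \<ge> 2" and l: "l < f"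
  shows "invar (tau t N (tau_exp t l))"
  unfolding inv_mod_def
proof (intro conjI ballI)
  let ?T = "tau t N (tau_exp t l)" and ?P = "p ^ l"
  fix k assume k: "k \<in> Iwa1 v"
  define n where "n = N - 2"
  have Nn: "N = Suc (Suc n)" using N by (simp add: n_def)
  define \<psi> where "\<psi> = (\<lambda>x. act k ?T x - ?T x)"
  have kG: "k \<in> GL2" using Iwa1_GL2[OF k] .
  have pi: "\<psi> \<in> ind" unfolding \<psi>_def by (intro ind_diff act_ind tau_ind kG)
  have mO: "inn 0 (moeb k x)" if "inn 0 x" for x using moeb_facts(4)[OF k that] .
  have mO': "inn 0 (moeb (cj k) x)" if "inn 0 x" for x using moeb_facts(4)[OF cj_Iwa1[OF k] that] .
  have psi_co: "co t' m x \<psi> = 0" if "inn 0 x" "\<not> (t' = t \<and> m = N)" for t' m x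
    using that N mO by (auto simp: \<psi>_def co_diff co_act[OF tau_ind k] co_tau)
  have psi_bet: "co t' m x (act bet \<psi>) = 0" if "inn 0 x" for t' m x
    using that N mO' by (simp add: \<psi>_def act_diff co_diff co_bet_act[OF tau_ind k] co_bet_tau)
  define h where "h x = H_const t l * (dg (Suc n) (moeb k x) - dg (Suc n) x) ^ ?P" for x
  have psi_H: "H t N x \<psi> = h x" if x: "inn 0 x" for x
    using x N mO l by (simp add: \<psi>_def H_diff H_act[OF tau_ind k] H_tau h_def Nn frob_diff right_diff_distrib)
  \<comment> \<open>A change of \<open>x\<close> at place \<open>n + 1\<close> changes that digit of
    \<open>x\<close> and of \<open>moeb k x\<close> by the same amount, so it cancels in
    \<open>h\<close>.\<close>
  have h_cong: "h x = h y" if xy: "inn 0 x" "inn 0 y" "inn (int (Suc n)) (x - y)" for x y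
  proof -
    define z where "z = (x - y) / \<pi> ^ Suc n"
    have z: "inn 0 z" using xy(3) unfolding z_def by (subst inn_div_iff) (simp_all del: power_Suc)
    have x: "x = y + \<pi> ^ Suc n * z" by (simp add: z_def)
    have "dg (Suc n) (moeb k x) = dg (Suc n) (moeb k y + \<pi> ^ Suc n * z)"
    proof (rule dg_cong)
      show "inn 0 (moeb k y + \<pi> ^ Suc n * z)" using mO[OF xy(2)] z by (intro inn_add) (auto intro: inn_mono simp del: power_Suc)
      show "inn (int (Suc (Suc n))) (moeb k x - (moeb k y + \<pi> ^ Suc n * z))" unfolding x by (rule moeb_shift[OF k xy(2) z])
    qed (use mO xy in auto)
    then show ?thesis using dg_add[OF mO[OF xy(2)] z, of "Suc n"] dg_add[OF xy(2) z, of "Suc n"]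
      unfolding h_def x[symmetric] by simp
  qed
  have hyp: "H t N x \<psi> = H t N y \<psi>" if "inn 0 x" "inn 0 y" "inn (int (N - 1)) (x - y)" for x y
    using psi_H[OF that(1)] psi_H[OF that(2)] h_cong[OF that(1,2)] that(3) by (simp add: Nn)
  have N1: "N \<ge> 1" using N by simp
  obtain w where w: "w \<in> W" "\<And>x. inn 0 x \<Longrightarrow> co t N x w = co t N x \<psi>"
    "\<And>x. inn 0 x \<Longrightarrow> co (\<not> t) (N - 1) x w = - H t N x \<psi>"
    "\<And>t' n x. inn 0 x \<Longrightarrow> \<not> (t' = t \<and> n = N) \<Longrightarrow> \<not> (t' \<noteq> t \<and> n = N - 1) \<Longrightarrow> co t' n x w = 0"
    "\<And>t' n x. inn 0 x \<Longrightarrow> n \<ge> 1 \<Longrightarrow> co t' n x (act bet w) = 0"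
    using reduce[where t = t, OF pi N1] hyp by blast
  define \<psi>1 where "\<psi>1 = (\<lambda>x. \<psi> x - w x)"
  have p1: "\<psi>1 \<in> ind" unfolding \<psi>1_def using pi W_ind[OF w(1)] by (rule ind_diff)
  have c1: "co t' m x \<psi>1 = (if t' \<noteq> t \<and> m = Suc n then h x else 0)" if x: "inn 0 x" for t' m x
  proof -
    consider "t' = t \<and> m = N" | "t' \<noteq> t \<and> m = Suc n" | "\<not> (t' = t \<and> m = N)" "\<not> (t' \<noteq> t \<and> m = Suc n)" by blast
    then show ?thesis
    proof cases
      case 1
      then show ?thesis using w(2)[OF x] by (simp add: \<psi>1_def co_diff)
    next
      case 2
      then have "t' = (\<not> t)" by auto
      then show ?thesis using 2 w(3)[OF x] psi_co[OF x, of "\<not> t" "Suc n"] psi_H[OF x] by (simp add: \<psi>1_def co_diff Nn)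
    next
      case 3
      then show ?thesis using w(4)[OF x, of t' m] psi_co[OF x, of t' m] by (auto simp: \<psi>1_def co_diff Nn)
    qed
  qed
  have b1: "co t' m x (act bet \<psi>1) = 0" if x: "inn 0 x" for t' m x
  proof (cases "m = 0")
    case True
    then show ?thesis using co_bet_0[OF p1 x x, of t'] c1[OF x] by simp
  next
    case False
    then show ?thesis using psi_bet[OF x] w(5)[OF x, of m] by (simp add: \<psi>1_def act_diff co_diff)
  qed
  have H1: "H (\<not> t) (Suc n) x \<psi>1 = 0" if x: "inn 0 x" for x
  proof -
    let ?a = "dg n x" and ?x0 = "trunc n x"
    have a: "?a \<in> FF" using x by simp
    have "H (\<not> t) (Suc n) x \<psi>1 = (\<Sum>m\<in>FF. kap (\<not> t) ((m + ?a) - ?a) * h (?x0 + \<pi> ^ n * tc (m + ?a)))"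
      unfolding H_def
    proof (intro sum.cong refl)
      fix m assume m: "m \<in> FF"
      have "x + \<pi> ^ n * tc m - (?x0 + \<pi> ^ n * tc (m + ?a)) = \<pi> ^ n * ((rem n x - tc ?a) + (tc m + tc ?a - tc (m + ?a)))"
        using trunc_rem[of x n] by (simp add: algebra_simps)
      moreover have "inn 1 ((rem n x - tc ?a) + (tc m + tc ?a - tc (m + ?a)))"
        using tc_red_cong[of "rem n x"] x tc_add_cong[OF m a] by (intro inn_add) (auto simp: dg_def)
      ultimately have "inn (int (Suc n)) (x + \<pi> ^ n * tc m - (?x0 + \<pi> ^ n * tc (m + ?a)))" by simp
      then have "h (x + \<pi> ^ n * tc m) = h (?x0 + \<pi> ^ n * tc (m + ?a))" using m a x by (intro h_cong) auto
      then show "kap (\<not> t) m * co (\<not> t) (Suc n) (x + \<pi> ^ (Suc n - 1) * tc m) \<psi>1 =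
         kap (\<not> t) (m + ?a - ?a) * h (?x0 + \<pi> ^ n * tc (m + ?a))" using m x by (simp add: c1)
    qed
    also have "\<dots> = (\<Sum>m\<in>FF. kap (\<not> t) (m - ?a) * h (?x0 + \<pi> ^ n * tc m))"
      by (rule FF_shift[OF a, of "\<lambda>m. kap (\<not> t) (m - ?a) * h (?x0 + \<pi> ^ n * tc m)"])
    also have "\<dots> = kap_sign (\<not> t) * H_const t l * (\<Sum>m\<in>FF. (dg (Suc n) (moeb k (?x0 + \<pi> ^ n * tc m)) - dg (Suc n) (?x0 + \<pi> ^ n * tc m)) ^ ?P * (?a - m) ^ kap_exp (\<not> t))"
      unfolding kap_conv h_def by (simp add: sum_distrib_left mult_ac)
    also have "\<dots> = 0" using carry_conv_null[OF nq k x, of n] a unfolding conv_null_def by simp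
    finally show ?thesis .
  qed
  have hyp1: "H (\<not> t) (Suc n) x \<psi>1 = H (\<not> t) (Suc n) y \<psi>1" if "inn 0 x" "inn 0 y" for x y
    using H1 that by simp
  \<comment> \<open>As \<open>H\<close> vanishes, this reduction leaves nothing one level lower, and
    \<open>w2\<close> shares all coordinates with \<open>\<psi>1\<close>.\<close>
  obtain w2 where w2: "w2 \<in> W" "\<And>x. inn 0 x \<Longrightarrow> co (\<not> t) (Suc n) x w2 = co (\<not> t) (Suc n) x \<psi>1"
    "\<And>x. inn 0 x \<Longrightarrow> co (\<not> \<not> t) (Suc n - 1) x w2 = - H (\<not> t) (Suc n) x \<psi>1"
    "\<And>t' m x. inn 0 x \<Longrightarrow> \<not> (t' = (\<not> t) \<and> m = Suc n) \<Longrightarrow> \<not> (t' \<noteq> (\<not> t) \<and> m = Suc n - 1) \<Longrightarrow> co t' m x w2 = 0"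
    "\<And>t' n x. inn 0 x \<Longrightarrow> n \<ge> 1 \<Longrightarrow> co t' n x (act bet w2) = 0"
    using reduce[where t = "\<not> t" and N = "Suc n", OF p1 _ hyp1] by auto
  have c2: "co t' m x w2 = co t' m x \<psi>1" if x: "inn 0 x" for t' m x
  proof -
    consider "t' = (\<not> t) \<and> m = Suc n" | "t' = t \<and> m = n" | "\<not> (t' = (\<not> t) \<and> m = Suc n)" "\<not> (t' = t \<and> m = n)" by blast
    then show ?thesis
    proof cases
      case 2
      then show ?thesis using w2(3)[OF x] H1[OF x] c1[OF x] by simp
    next
      case 3
      then have "co t' m x w2 = 0" by (intro w2(4)[OF x]) auto
      then show ?thesis using 3 c1[OF x, of t' m] by auto
    qed (use w2(2)[OF x] in auto)
  qed
  have "w2 = \<psi>1"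
  proof (rule ind_eqI[OF W_ind[OF w2(1)] p1 c2])
    fix t' m x assume x: "inn 0 x"
    show "co t' m x (act bet w2) = co t' m x (act bet \<psi>1)"
    proof (cases "m = 0")
      case True
      then show ?thesis using co_bet_0[OF p1 x x, of t'] co_bet_0[OF W_ind[OF w2(1)] x x, of t'] c2[OF x] by simp
    next
      case False
      then show ?thesis using w2(5)[OF x, of m t'] b1[OF x] by simp
    qed
  qed
  then have "\<psi>1 \<in> W" using w2(1) by simp
  then have "(\<lambda>x. \<psi>1 x + w x) \<in> W" using w(1) W_add by blast
  then show "\<psi> \<in> W" by (simp add: \<psi>1_def)
qed simp

section \<open>Additive functions and invariant vectors\<close>

text \<open>Lagrange interpolation: \<open>1 - (u - b) ^ (q - 1)\<close> is the indicator function
  of \<open>b\<close> on \<open>FF\<close>, and \<open>a\<close> collects its coefficients in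
  \<open>u\<close>.\<close>

lemma FF_interpolation: "\<exists>a. \<forall>u\<in>FF. \<delta> u = (\<Sum>j<q. a j * u ^ j)" for \<delta> :: "'k \<Rightarrow> 'k"
proof -
  define a where "a j = (\<Sum>b\<in>FF. \<delta> b * ((if j = 0 then 1 else 0) - of_nat ((q - 1) choose j) * (- b) ^ (q - 1 - j)))" for j
  have qs: "{..<q} = {..q - 1}" using q_ge by auto
  have "\<delta> u = (\<Sum>j<q. a j * u ^ j)" if u: "u \<in> FF" for u
  proof -
    have L: "(\<Sum>j<q. ((if j = 0 then 1 else 0) - of_nat ((q - 1) choose j) * (- b) ^ (q - 1 - j)) * u ^ j) = (if b = u then 1 else 0)"
      if b: "b \<in> FF" for b
    proof -
      have "(\<Sum>j<q. ((if j = 0 then 1 else 0) - of_nat ((q - 1) choose j) * (- b) ^ (q - 1 - j)) * u ^ j)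
        = (\<Sum>j<q. (if j = 0 then 1 else 0) * u ^ j) - (\<Sum>j\<le>q - 1. of_nat ((q - 1) choose j) * u ^ j * (- b) ^ (q - 1 - j))"
        unfolding qs sum_subtractf[symmetric] by (intro sum.cong refl) (simp only: right_diff_distrib left_diff_distrib mult_ac)
      also have "(\<Sum>j\<le>q - 1. of_nat ((q - 1) choose j) * u ^ j * (- b) ^ (q - 1 - j)) = (u - b) ^ (q - 1)"
        using binomial_ring[of u "- b" "q - 1"] by simp
      also have "(\<Sum>j<q. (if j = 0 then 1 else 0) * u ^ j) = (\<Sum>j<q. if j = 0 then 1 else 0)" by (intro sum.cong) auto
      also have "\<dots> = (1::'k)" by simp
      also have "1 - (u - b) ^ (q - 1) = (if b = u then 1 else 0)"
        using FF_fermat1[of "u - b"] u b q_ge by (auto simp: zero_power)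
      finally show ?thesis .
    qed
    have "(\<Sum>j<q. a j * u ^ j) = (\<Sum>j<q. \<Sum>b\<in>FF. \<delta> b * (((if j = 0 then 1 else 0) - of_nat ((q - 1) choose j) * (- b) ^ (q - 1 - j)) * u ^ j))"
      unfolding a_def sum_distrib_right by (simp only: mult.assoc)
    also have "\<dots> = (\<Sum>b\<in>FF. \<Sum>j<q. \<delta> b * (((if j = 0 then 1 else 0) - of_nat ((q - 1) choose j) * (- b) ^ (q - 1 - j)) * u ^ j))"
      by (rule sum.swap)
    also have "\<dots> = (\<Sum>b\<in>FF. \<delta> b * (if b = u then 1 else 0))"
      unfolding sum_distrib_left[symmetric] by (intro sum.cong refl) (simp only: L)
    also have "\<dots> = (\<Sum>b\<in>FF. if b = u then \<delta> b else 0)" by (intro sum.cong) auto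
    also have "\<dots> = \<delta> u" using u by simp
    finally show ?thesis by simp
  qed
  then show ?thesis by blast
qed

text \<open>Comparing coefficients of \<open>\<delta> (u + w)\<close> gives
  \<open>a j * (j choose i) = 0\<close> for \<open>0 < i < j\<close>. If \<open>j > 0\<close> is not
  a power of \<open>p\<close>, let \<open>i\<close> be the exact power of \<open>p\<close> dividing
  it: the binomial coefficient is then \<open>j div i\<close> modulo \<open>p\<close>, which is
  nonzero.\<close>

lemma additive_poly:
  assumes add: "\<And>u w. u \<in> FF \<Longrightarrow> w \<in> FF \<Longrightarrow> \<delta> (u + w) = \<delta> u + \<delta> w"
  shows "\<exists>c. \<forall>u\<in>FF. \<delta> u = (\<Sum>l<f. c l * u ^ p ^ l)"
proof -
  obtain a where a: "\<And>u. u \<in> FF \<Longrightarrow> \<delta> u = (\<Sum>j<q. a j * u ^ j)" using FF_interpolation by blast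
  have q0: "0 < q" by simp
  have zero: "a j * of_nat (j choose i) = 0" if ij: "1 \<le> i" "i < j" "j < q" for i j
  proof -
    have row: "(\<Sum>j<q. a j * of_nat (j choose i) * w ^ (j - i)) - a i = 0" if w: "w \<in> FF" for w
    proof -
      \<comment> \<open>The coefficient of \<open>u ^ i\<close> in
        \<open>\<delta> (u + w) - \<delta> u - \<delta> w\<close>.\<close>
      define c where "c i = (\<Sum>j<q. a j * of_nat (j choose i) * w ^ (j - i)) - a i - (if i = 0 then \<delta> w else 0)" for i
      have "(\<Sum>i<q. c i * u ^ i) = 0" if u: "u \<in> FF" for u
      proof -
        have "\<delta> (u + w) = (\<Sum>j<q. \<Sum>i<q. a j * (of_nat (j choose i) * u ^ i * w ^ (j - i)))"
        proof -
          have "(u + w) ^ j = (\<Sum>i<q. of_nat (j choose i) * u ^ i * w ^ (j - i))" if "j < q" for j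
            unfolding binomial_ring using that by (intro sum.mono_neutral_left) (auto simp: binomial_eq_0)
          then show ?thesis using a[of "u + w"] u w by (simp add: sum_distrib_left)
        qed
        also have "\<dots> = (\<Sum>i<q. \<Sum>j<q. a j * (of_nat (j choose i) * u ^ i * w ^ (j - i)))" by (rule sum.swap)
        also have "\<dots> = (\<Sum>i<q. (\<Sum>j<q. a j * of_nat (j choose i) * w ^ (j - i)) * u ^ i)"
          unfolding sum_distrib_right by (simp only: mult_ac)
        finally have 1: "\<delta> (u + w) = \<dots>" .
        have 3: "(\<Sum>i<q. (if i = 0 then \<delta> w else 0) * u ^ i) = \<delta> w"
        proof -
          have "(\<Sum>i<q. (if i = 0 then \<delta> w else 0) * u ^ i) = (\<Sum>i<q. if i = 0 then \<delta> w else 0)" by (intro sum.cong) auto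
          then show ?thesis by simp
        qed
        have "(\<Sum>i<q. c i * u ^ i) = \<delta> (u + w) - \<delta> u - \<delta> w"
          unfolding c_def left_diff_distrib sum_subtractf 1 3 using a[OF u] by simp
        then show ?thesis using add[OF u w] by simp
      qed
      from poly_FF_0[OF this, of i] ij show ?thesis by (simp add: c_def)
    qed
    \<comment> \<open>\<open>row\<close> is now read as a polynomial in \<open>w\<close>; its
      constant term, from \<open>j = i\<close>, cancels against \<open>a i\<close>.\<close>
    define d where "d k = (if 0 < k \<and> k + i < q then a (k + i) * of_nat ((k + i) choose i) else 0)" for k
    have "(\<Sum>k<q. d k * w ^ k) = 0" if w: "w \<in> FF" for w
    proof -
      have iq: "i < q" using ij by simp
      have "(\<Sum>j<q. a j * of_nat (j choose i) * w ^ (j - i)) = a i + (\<Sum>j\<in>{..<q} - {i}. a j * of_nat (j choose i) * w ^ (j - i))"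
        using iq by (subst sum.remove[of _ i]) auto
      also have "(\<Sum>j\<in>{..<q} - {i}. a j * of_nat (j choose i) * w ^ (j - i)) = (\<Sum>j\<in>{i<..<q}. a j * of_nat (j choose i) * w ^ (j - i))"
        by (intro sum.mono_neutral_right) (auto simp: binomial_eq_0)
      also have "\<dots> = (\<Sum>k\<in>{0<..<q - i}. d k * w ^ k)"
        by (rule sum.reindex_bij_witness[of _ "\<lambda>k. k + i" "\<lambda>j. j - i"]) (auto simp: d_def)
      also have "\<dots> = (\<Sum>k<q. d k * w ^ k)"
        by (intro sum.mono_neutral_left) (auto simp: d_def)
      finally show ?thesis using row[OF w] by simp
    qed
    from poly_FF_0[OF this, of "j - i"] ij show ?thesis by (simp add: d_def)
  qed
  have a0: "a 0 = 0"
  proof -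
    have "\<delta> (0 + 0) = \<delta> 0 + \<delta> 0" using add FF_0 by blast
    then have "\<delta> 0 = 0" by (simp only: add_0 add_cancel_right_right)
    moreover have "(\<Sum>j<q. a j * 0 ^ j) = (\<Sum>j\<in>{0}. a j * 0 ^ j)" by (intro sum.mono_neutral_right) auto
    ultimately show ?thesis using a[of 0] by simp
  qed
  have nonpow: "a j = 0" if j: "j < q" "j \<notin> (\<lambda>l. p ^ l) ` {..<f}" for j
  proof (cases "j = 0")
    case False
    have "\<not> is_unit p" using prime_p by auto
    then obtain m where m: "j = p ^ multiplicity p j * m" "\<not> p dvd m"
      using multiplicity_decompose'[of j p] False by blast
    define l where "l = multiplicity p j"
    have "m \<noteq> 1"
    proof
      assume "m = 1"
      then have "j = p ^ l" using m by (simp add: l_def)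
      then have "l < f" using j(1) power_less_imp_less_exp[of p l f] p_ge3 by simp
      then show False using j(2) \<open>j = p ^ l\<close> by blast
    qed
    moreover have "m \<noteq> 0" using m(2) by (metis dvd_0_right)
    ultimately have m1: "m > 1" by linarith
    have "p ^ l * 1 < p ^ l * m" using m1 by (intro mult_strict_left_mono) simp_all
    then have lj: "p ^ l < j" using m(1) by (simp add: l_def[symmetric])
    have "j div p ^ l = m" using m(1) by (metis l_def nonzero_mult_div_cancel_left p_pos(2) power_not_zero)
    then have "(of_nat (j choose p ^ l) :: 'k) \<noteq> 0" using m(2) by (simp add: binom_frob of_nat_k_0_iff)
    moreover have "1 \<le> p ^ l" by (simp add: Suc_leI One_nat_def)
    ultimately show ?thesis using zero[OF _ lj j(1)] by auto
  qed (use a0 in simp)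
  have "\<delta> u = (\<Sum>l<f. a (p ^ l) * u ^ p ^ l)" if u: "u \<in> FF" for u
  proof -
    have sub: "(\<lambda>l. p ^ l) ` {..<f} \<subseteq> {..<q}" using p_ge3 by (auto intro!: power_strict_increasing)
    have "\<delta> u = (\<Sum>j\<in>(\<lambda>l. p ^ l) ` {..<f}. a j * u ^ j)"
      unfolding a[OF u] by (rule sum.mono_neutral_right) (use sub nonpow in auto)
    also have "\<dots> = (\<Sum>l<f. a (p ^ l) * u ^ p ^ l)"
      using p_ge3 by (subst sum.reindex) (auto intro!: inj_onI simp: power_inject_exp)
    finally show ?thesis .
  qed
  then show ?thesis by (intro exI[of _ "\<lambda>l. a (p ^ l)"]) simp
qed

lemma frob_indep:
  assumes "\<And>u. u \<in> FF \<Longrightarrow> (\<Sum>l<f. d l * u ^ p ^ l) = (0::'k)" "l < f"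
  shows "d l = 0"
proof -
  have inj: "p ^ l = p ^ m \<longleftrightarrow> l = m" for l m using p_ge3 by (simp add: power_inject_exp)
  define c where "c j = (\<Sum>l<f. if p ^ l = j then d l else 0)" for j
  have "(\<Sum>j<q. c j * u ^ j) = 0" if u: "u \<in> FF" for u
  proof -
    have "(\<Sum>j<q. c j * u ^ j) = (\<Sum>j<q. \<Sum>l<f. (if p ^ l = j then d l else 0) * u ^ j)"
      by (simp add: c_def sum_distrib_right)
    also have "\<dots> = (\<Sum>l<f. \<Sum>j<q. (if p ^ l = j then d l else 0) * u ^ j)" by (rule sum.swap)
    also have "\<dots> = (\<Sum>l<f. d l * u ^ p ^ l)"
    proof (intro sum.cong refl)
      fix l assume "l \<in> {..<f}"
      then have "p ^ l < q" using p_ge3 by (auto intro!: power_strict_increasing)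
      moreover have "(\<Sum>j<q. (if p ^ l = j then d l else 0) * u ^ j) = (\<Sum>j<q. if p ^ l = j then d l * u ^ j else 0)"
        by (intro sum.cong) auto
      ultimately show "(\<Sum>j<q. (if p ^ l = j then d l else 0) * u ^ j) = d l * u ^ p ^ l" by simp
    qed
    finally show ?thesis using assms(1)[OF u] by simp
  qed
  moreover have "p ^ l < q" using assms(2) p_ge3 by (auto intro!: power_strict_increasing)
  ultimately have "c (p ^ l) = 0" by (rule poly_FF_0)
  then show ?thesis using assms(2) by (simp add: c_def inj)
qed

section \<open>Translations acting on invariant vectors\<close>

definition transl :: "'f \<Rightarrow> 'f m2" where "transl y = (1, y, 0, 1)"

lemma transl_Iwa1: "inn 0 y \<Longrightarrow> transl y \<in> Iwa1 v"
  unfolding transl_def by (rule Iwa1_I) auto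

lemma moeb_nn: "moeb (transl y) x = x - y"
  by (simp add: moeb_def transl_def)

lemma moeb_cj_nn: "inn 0 x \<Longrightarrow> inn 0 y \<Longrightarrow> inn 1 (moeb (cj (transl y)) x - x)"
proof -
  assume xy: "inn 0 x" "inn 0 y"
  let ?A = "1 - \<pi> * y * x"
  have pyx: "inn 1 (\<pi> * y * x)" using xy by (simp add: mult.assoc inn_mult0)
  have A: "?A \<noteq> 0" "v ?A = 0" using unit_sub[of 1 "\<pi> * y * x"] pyx by auto
  have "moeb (cj (transl y)) x - x = x * (\<pi> * y * x) / ?A" using A by (simp add: moeb_def transl_def cj_eq field_simps)
  then show ?thesis using A xy pyx by (simp add: inn_div_iff inn_mult_left del: inn_mult_pi1_iff)
qed

lemma invar_diff_W: "invar \<phi> \<Longrightarrow> inn 0 y \<Longrightarrow> (\<lambda>x. act (transl y) \<phi> x - \<phi> x) \<in> W"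
  by (simp add: inv_mod_def transl_Iwa1)

lemma invar_diff_lev: "invar \<phi> \<Longrightarrow> inn 0 y \<Longrightarrow> lev N \<phi> \<Longrightarrow> lev N (\<lambda>x. act (transl y) \<phi> x - \<phi> x)"
  using lev_diff lev_act inv_ind transl_Iwa1 by blast

lemma H_nn_diff:
  assumes "invar \<phi>" "inn 0 y" "inn 0 x" "N \<ge> 1"
  shows "H t N x (\<lambda>x. act (transl y) \<phi> x - \<phi> x) = H t N (x - y) \<phi> - H t N x \<phi>"
  by (simp add: H_diff H_act[OF inv_ind[OF assms(1)] transl_Iwa1[OF assms(2)] assms(3,4)] moeb_nn)

text \<open>For the translation taking 0 to \<open>x\<close>, \<open>W_top\<close> compares the
  points \<open>\<pi> ^ (N - 1) * tc u\<close> and 0: the increment of \<open>H\<close> at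
  \<open>x\<close> is the one at 0. Additivity follows because the carry of
  \<open>tc u + tc w\<close> is not visible modulo \<open>\<pi> ^ N\<close>.\<close>

lemma H_additive:
  assumes phi: "invar \<phi>" "lev N \<phi>" and N: "N \<ge> 1"
  obtains \<delta> where "\<And>u w. u \<in> FF \<Longrightarrow> w \<in> FF \<Longrightarrow> \<delta> (u + w) = \<delta> u + \<delta> w"
    "\<And>x u. inn 0 x \<Longrightarrow> u \<in> FF \<Longrightarrow> H t N (x + \<pi> ^ (N - 1) * tc u) \<phi> = H t N x \<phi> + \<delta> u"
proof -
  define h where "h x = H t N x \<phi>" for x
  define \<delta> where "\<delta> u = h (\<pi> ^ (N - 1) * tc u) - h 0" for u
  have sh: "h (x + \<pi> ^ (N - 1) * tc u) = h x + \<delta> u" if x: "inn 0 x" and u: "u \<in> FF" for x u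
  proof -
    let ?z = "\<pi> ^ (N - 1) * tc u"
    have z: "inn 0 ?z" using u inn_shift[of 0 u "N - 1"] by simp
    have y: "inn 0 (- x)" using x by simp
    have "H t N ?z (\<lambda>a. act (transl (- x)) \<phi> a - \<phi> a) = H t N 0 (\<lambda>a. act (transl (- x)) \<phi> a - \<phi> a)"
      by (rule W_top[OF invar_diff_W[OF phi(1) y] invar_diff_lev[OF phi(1) y phi(2)] N z]) (use u in auto)
    then show ?thesis
      unfolding H_nn_diff[OF phi(1) y z N] H_nn_diff[OF phi(1) y inn_0 N]
      by (simp add: h_def \<delta>_def algebra_simps)
  qed
  have "\<delta> (u + w) = \<delta> u + \<delta> w" if uw: "u \<in> FF" "w \<in> FF" for u w
  proof -
    have "h (\<pi> ^ (N - 1) * tc (u + w)) = h (\<pi> ^ (N - 1) * tc u + \<pi> ^ (N - 1) * tc w)"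
      unfolding h_def
    proof (rule H_cong[OF inv_ind[OF phi(1)]])
      have "\<pi> ^ (N - 1) * tc (u + w) - (\<pi> ^ (N - 1) * tc u + \<pi> ^ (N - 1) * tc w) = - (\<pi> ^ (N - 1) * (tc u + tc w - tc (u + w)))"
        by (simp add: algebra_simps)
      then show "inn (int N) (\<pi> ^ (N - 1) * tc (u + w) - (\<pi> ^ (N - 1) * tc u + \<pi> ^ (N - 1) * tc w))"
        using tc_add_cong[OF uw] N by (simp add: of_nat_diff)
    qed
    also have "\<dots> = h (\<pi> ^ (N - 1) * tc u) + \<delta> w" using sh[of "\<pi> ^ (N - 1) * tc u" w] uw inn_shift[of 0 u "N - 1"] by simp
    finally show ?thesis by (simp add: \<delta>_def)
  qed
  then show thesis using that[of \<delta>] sh unfolding h_def by blast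
qed

lemma H_period:
  assumes "\<phi> \<in> ind" "N \<ge> 1"
    and s: "\<And>x u. inn 0 x \<Longrightarrow> u \<in> FF \<Longrightarrow> H t N (x + \<pi> ^ (N - 1) * tc u) \<phi> = H t N x \<phi>"
    and xy: "inn 0 x" "inn 0 y" "inn (int (N - 1)) (x - y)"
  shows "H t N x \<phi> = H t N y \<phi>"
proof -
  define z where "z = (x - y) / \<pi> ^ (N - 1)"
  have z: "inn 0 z" using xy(3) by (simp add: z_def inn_div_iff)
  have x: "x = y + \<pi> ^ (N - 1) * z" by (simp add: z_def)
  have "H t N x \<phi> = H t N (y + \<pi> ^ (N - 1) * tc (red z)) \<phi>"
  proof (rule H_cong[OF assms(1)])
    have "x - (y + \<pi> ^ (N - 1) * tc (red z)) = \<pi> ^ (N - 1) * (z - tc (red z))" by (simp add: x algebra_simps)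
    then show "inn (int N) (x - (y + \<pi> ^ (N - 1) * tc (red z)))" using tc_red_cong[OF z] assms(2) by (simp add: of_nat_diff)
  qed
  then show ?thesis using s[OF xy(2), of "red z"] z by simp
qed

text \<open>A translation is trivial on level 0 and, by \<open>moeb_cj_nn\<close>, on residues
  modulo \<open>\<pi>\<close> in the other half, so two of the three terms in \<open>W_one\<close>
  vanish.\<close>

lemma H_level_1:
  assumes phi: "invar \<phi>" "lev 1 \<phi>" and x: "inn 0 x" "inn 0 y"
  shows "H t 1 (x - y) \<phi> = H t 1 x \<phi>"
proof -
  let ?\<psi> = "\<lambda>x. act (transl y) \<phi> x - \<phi> x"
  note pi = inv_ind[OF phi(1)]
  have "co (\<not> t) 0 x ?\<psi> = 0"
    using co_cong[OF pi, of 0 "x - y" x] x by (simp add: co_diff co_act[OF pi transl_Iwa1[OF x(2)] x(1)] moeb_nn)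
  moreover have "H (\<not> t) 1 x (act bet ?\<psi>) = 0"
    using H_cong[OF bet_ind[OF pi], of 1 "moeb (cj (transl y)) x" x] moeb_cj_nn[OF x]
    by (simp add: act_diff H_diff bet_act H_act[OF bet_ind[OF pi] cj_Iwa1[OF transl_Iwa1[OF x(2)]] x(1)])
  ultimately have "H t 1 x ?\<psi> = 0"
    using W_one[OF invar_diff_W[OF phi(1) x(2)] invar_diff_lev[OF phi(1) x(2) phi(2)] x(1), of t] by simp
  then show ?thesis using H_nn_diff[OF phi(1) x(2,1), of 1 t] by simp
qed

lemma H_Qp:
  assumes phi: "invar \<phi>" "lev N \<phi>" and N: "N \<ge> 2" and Qp: "e = 1" "f = 1"
    and add: "\<And>u w. u \<in> FF \<Longrightarrow> w \<in> FF \<Longrightarrow> \<delta> (u + w) = \<delta> u + \<delta> w"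
    and sh: "\<And>x u. inn 0 x \<Longrightarrow> u \<in> FF \<Longrightarrow> H t N (x + \<pi> ^ (N - 1) * tc u) \<phi> = H t N x \<phi> + \<delta> u"
    and u: "u \<in> FF"
  shows "\<delta> u = 0"
proof -
  note pi = inv_ind[OF phi(1)]
  define n where "n = N - 2"
  have Nn: "N = Suc (Suc n)" using N by (simp add: n_def)
  \<comment> \<open>By \<open>cr_sum\<close> the carries \<open>cr m b\<close> then add up to
    \<open>u\<close>; the inverse exists since \<open>e = 1\<close>.\<close>
  define b where "b = inverse (red (of_nat p / \<pi>)) * u"
  have rn: "red (of_nat p / \<pi>) \<noteq> 0" using p_pi_red Qp by simp
  have b: "b \<in> FF" "red (of_nat p / \<pi>) * b = u" using rn u p_pi_inn by (auto simp: b_def)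
  define y where "y = - (\<pi> ^ n * tc b)"
  have y: "inn 0 y" using b inn_shift[of 0 b n] by (simp add: y_def)
  let ?\<psi> = "\<lambda>x. act (transl y) \<phi> x - \<phi> x"
  define c where "c m = co (\<not> t) (Suc n) (\<pi> ^ n * tc m) \<phi>" for m
  define h where "h m = H t N (\<pi> ^ n * tc m) \<phi>" for m
  have O: "inn 0 (\<pi> ^ n * tc m)" if "m \<in> FF" for m using inn_shift[of 0 m n] that by simp
  have C: "co (\<not> t) (Suc n) (\<pi> ^ n * tc m) ?\<psi> = c (m + b) - c m" if m: "m \<in> FF" for m
  proof -
    have "co (\<not> t) (Suc n) (\<pi> ^ n * tc m - y) \<phi> = c (m + b)"
      unfolding c_def using tc_add_shift[OF pi, of "Suc n" m b "\<not> t" 0] m b(1) by (simp add: y_def)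
    then show ?thesis using O[OF m] by (simp add: co_diff co_act[OF pi transl_Iwa1[OF y]] moeb_nn c_def)
  qed
  have Hh: "H t N (\<pi> ^ n * tc m) ?\<psi> = h (m + b) + \<delta> (cr m b) - h m" if m: "m \<in> FF" for m
  proof -
    define \<kappa> where "\<kappa> = (tc m + tc b - tc (m + b)) / \<pi>"
    have K: "inn 0 \<kappa>" "red \<kappa> = cr m b" using cr_inn[OF m b(1)] by (auto simp: \<kappa>_def cr_def)
    have "\<pi> ^ n * tc m - y = \<pi> ^ n * (tc m + tc b)" by (simp add: y_def algebra_simps)
    also have "tc m + tc b = tc (m + b) + \<pi> * \<kappa>" by (simp add: \<kappa>_def)
    finally have "\<pi> ^ n * tc m - y = \<pi> ^ n * tc (m + b) + \<pi> ^ Suc n * \<kappa>" by (simp add: algebra_simps)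
    then have "H t N (\<pi> ^ n * tc m - y) \<phi> = H t N (\<pi> ^ n * tc (m + b) + \<pi> ^ (N - 1) * tc (red \<kappa>)) \<phi>"
    proof (intro H_cong[OF pi])
      assume e: "\<pi> ^ n * tc m - y = \<pi> ^ n * tc (m + b) + \<pi> ^ Suc n * \<kappa>"
      have "\<pi> ^ n * tc m - y - (\<pi> ^ n * tc (m + b) + \<pi> ^ (N - 1) * tc (red \<kappa>)) = \<pi> ^ Suc n * (\<kappa> - tc (red \<kappa>))"
        unfolding e by (simp add: Nn algebra_simps)
      then show "inn (int N) (\<pi> ^ n * tc m - y - (\<pi> ^ n * tc (m + b) + \<pi> ^ (N - 1) * tc (red \<kappa>)))"
        using tc_red_cong[OF K(1)] by (simp add: Nn del: power_Suc)
    qed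
    also have "\<dots> = h (m + b) + \<delta> (cr m b)" unfolding h_def K(2)
      using sh[OF O[of "m + b"], of "cr m b"] K m b(1) red_in_FF[OF K(1)] by simp
    finally show ?thesis unfolding h_def using H_nn_diff[OF phi(1) y O[OF m], of N t] N by simp
  qed
  have "0 = (\<Sum>m\<in>FF. co (\<not> t) (N - 1) (0 + \<pi> ^ (N - 2) * tc m) ?\<psi> + H t N (0 + \<pi> ^ (N - 2) * tc m) ?\<psi>)"
    using W_sum_zero[OF invar_diff_W[OF phi(1) y] invar_diff_lev[OF phi(1) y phi(2)] N inn_0, of t] by simp
  also have "\<dots> = (\<Sum>m\<in>FF. (c (m + b) - c m) + (h (m + b) + \<delta> (cr m b) - h m))"
    by (intro sum.cong refl) (use C Hh in \<open>simp add: Nn\<close>)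
  \<comment> \<open>The differences of \<open>c\<close> and of \<open>h\<close> sum to 0 because
    shifting by \<open>b\<close> permutes \<open>FF\<close>.\<close>
  also have "\<dots> = (\<Sum>m\<in>FF. \<delta> (cr m b))"
    using FF_shift[OF b(1), of c] FF_shift[OF b(1), of h] by (simp add: sum.distrib sum_subtractf)
  also have "\<dots> = \<delta> (\<Sum>m\<in>FF. cr m b)"
  proof -
    have "\<delta> (0 + 0) = \<delta> 0 + \<delta> 0" using add FF_0 by blast
    then have d0: "\<delta> 0 = 0" by (simp only: add_0 add_cancel_right_right)
    have "(\<Sum>m\<in>A. g m) \<in> FF \<and> \<delta> (\<Sum>m\<in>A. g m) = (\<Sum>m\<in>A. \<delta> (g m))" if "finite A" "\<And>m. m \<in> A \<Longrightarrow> g m \<in> FF" for A :: "'k set" and g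
      using that by (induction A rule: finite_induct) (auto simp: d0 add)
    moreover have "cr m b \<in> FF" if "m \<in> FF" for m using cr_inn[OF that b(1)] by (simp add: cr_def)
    ultimately show ?thesis using fin_FF by metis
  qed
  also have "(\<Sum>m\<in>FF. cr m b) = u" using cr_sum[OF Qp(2) b(1)] b(2) by simp
  finally show ?thesis by simp
qed

section \<open>The claimed basis in terms of half, type, level and Frobenius exponent\<close>

definition bas_idx :: "bool \<Rightarrow> bool \<Rightarrow> nat \<Rightarrow> nat \<Rightarrow> bidx" where
  "bas_idx s t n l = (if s then (if t then BBT n l else BBS n l) else (if t then BT n l else BS n l))"

abbreviation "basis \<equiv> belem v red \<pi> r p q"

lemma brk_scal: "z = \<pi> \<Longrightarrow> brk (mmul (scal z) g) = brk g"
proof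
  fix x assume z: "z = \<pi>"
  have e: "mmul x (mmul (scal z) g) = mmul (scal z) (mmul x g)"
    by (simp only: mmul_assoc[symmetric] scal_comm)
  show "brk (mmul (scal z) g) x = brk g x"
    unfolding brk_val e using z IZ_mmul[OF scal_IZ[OF pi_nz]] by (auto simp: IZ_scal_iff X_scal_pi)
qed

lemma tau_False: "sfun v red \<pi> r q N j = tau False N j"
  by (simp add: sfun_def tau_def E_def gA_def bt_def)

text \<open>Up to the central scalar \<open>\<pi>\<close>, the matrix of level \<open>N - 1\<close>
  ending in \<open>wm\<close> is the matrix of level \<open>N\<close> followed by
  \<open>bet\<close>.\<close>

lemma tau_True: assumes "N \<ge> 1" shows "tfun v red \<pi> r q N j = tau True N j"
proof -
  obtain n where n: "N = Suc n" using assms by (cases N) auto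
  have e: "brk (mmul (mmul (\<pi> ^ n, ds n \<mu>, 0, 1) (1, tc (\<mu> n), 0, 1)) wm) = E True N (ds N \<mu>)" for \<mu>
  proof -
    have "mmul (gA N (ds N \<mu>)) (bt True) = mmul (scal \<pi>) (mmul (mmul (\<pi> ^ n, ds n \<mu>, 0, 1) (1, tc (\<mu> n), 0, 1)) wm)"
      by (simp add: gA_def bt_def betam_def wm_def n ds_Suc algebra_simps)
    then show ?thesis unfolding E_def using brk_scal by simp
  qed
  show ?thesis unfolding tfun_def tau_def using e by (simp add: n)
qed

lemma bel_bi: "n \<ge> 1 \<Longrightarrow> basis (bas_idx s t n l) = (if s then act bet (tau t n (tau_exp t l)) else tau t n (tau_exp t l))"
proof -
  assume n: "n \<ge> 1"
  have "tau_exp True l = r + p ^ l" "tau_exp False l = q - 1 - r + p ^ l" using r_lt by (auto simp: tau_exp_def kap_exp_def)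
  then show ?thesis using n by (auto simp: bas_idx_def tau_False tau_True)
qed

lemma bel_Id: "basis BId = E False 0 0" "basis BBeta = E True 0 0"
proof -
  have i: "gA 0 0 = Idm" by (simp add: gA_def Idm_def)
  show "basis BId = E False 0 0" "basis BBeta = E True 0 0" by (simp_all add: E_def i bt_def)
qed

lemma bindex_cases:
  assumes "i \<in> bindex e f"
  obtains "i = BId" | "i = BBeta" | s t n l where "\<not> (e = 1 \<and> f = 1)" "i = bas_idx s t n l" "n \<ge> 2" "l < f"
proof -
  have "i = BId \<or> i = BBeta \<or> (\<not> (e = 1 \<and> f = 1) \<and> (\<exists>s t n l. i = bas_idx s t n l \<and> n \<ge> 2 \<and> l < f))"
  proof (cases "e = 1 \<and> f = 1")
    case False
    then have "i = BId \<or> i = BBeta \<or> (\<exists>n l. n \<ge> 2 \<and> l < f \<and> (i = BS n l \<or> i = BBS n l \<or> i = BT n l \<or> i = BBT n l))"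
      using assms unfolding bindex_def if_not_P[OF False] by blast
    moreover have "BS n l = bas_idx False False n l" "BT n l = bas_idx False True n l" "BBS n l = bas_idx True False n l" "BBT n l = bas_idx True True n l" for n l
      by (simp_all add: bas_idx_def)
    ultimately show ?thesis using False by metis
  qed (use assms in \<open>auto simp: bindex_def\<close>)
  then show thesis using that by blast
qed

lemma bindex_bi: "\<not> (e = 1 \<and> f = 1) \<Longrightarrow> n \<ge> 2 \<Longrightarrow> l < f \<Longrightarrow> bas_idx s t n l \<in> bindex e f"
  by (auto simp: bindex_def bas_idx_def)

lemma bindex_Id: "BId \<in> bindex e f" "BBeta \<in> bindex e f"
  by (auto simp: bindex_def)

text \<open>Coordinates of level 0 do not depend on \<open>x\<close>, so these two vectors are fixed
  by I(1) before passing to the quotient.\<close>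

lemma E0_inv: "invar (E t 0 0)"
  unfolding inv_mod_def
proof (intro conjI ballI)
  fix k assume k: "k \<in> Iwa1 v"
  have "act k (E t 0 0) = E t 0 0"
  proof (rule ind_eqI[OF act_ind[OF E_ind Iwa1_GL2[OF k]] E_ind])
    fix t' n x assume x: "inn 0 x"
    show "co t' n x (act k (E t 0 0)) = co t' n x (E t 0 0)"
      using x moeb_facts(4)[OF k x] by (simp add: co_act[OF E_ind k x] co_E)
    show "co t' n x (act bet (act k (E t 0 0))) = co t' n x (act bet (E t 0 0))"
      using x moeb_facts(4)[OF cj_Iwa1[OF k] x] by (simp add: co_bet_act[OF E_ind k x] co_bE)
  qed
  then show "(\<lambda>x. act k (E t 0 0) x - E t 0 0 x) \<in> W" using W_0 by simp
qed simp

lemma basis_inv: assumes "i \<in> bindex e f" shows "invar (basis i)"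
  using assms
proof (cases rule: bindex_cases)
  case (3 s t n l)
  then have "invar (tau t n (tau_exp t l))" by (intro tau_inv) auto
  then show ?thesis using 3 inv_bet by (simp add: bel_bi)
qed (simp_all only: bel_Id E0_inv)

section \<open>Spanning and independence\<close>

definition spanned :: "('f m2 \<Rightarrow> 'k) \<Rightarrow> bool" where
  "spanned \<phi> \<longleftrightarrow> (\<exists>J c. finite J \<and> J \<subseteq> bindex e f \<and> (\<lambda>x. \<phi> x - (\<Sum>i\<in>J. c i * basis i x)) \<in> W)"

lemma spanned_W: "w \<in> W \<Longrightarrow> spanned w"
  unfolding spanned_def by (rule exI[of _ "{}"]) simp

lemma spanned_bel: "i \<in> bindex e f \<Longrightarrow> spanned (\<lambda>x. a * basis i x)"
  unfolding spanned_def by (rule exI[of _ "{i}"], rule exI[of _ "\<lambda>_. a"]) (simp add: W_0)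

lemma spanned_add: assumes "spanned \<phi>" "spanned \<psi>" shows "spanned (\<lambda>x. \<phi> x + \<psi> x)"
proof -
  obtain J c where J: "finite J" "J \<subseteq> bindex e f" "(\<lambda>x. \<phi> x - (\<Sum>i\<in>J. c i * basis i x)) \<in> W"
    using assms(1) unfolding spanned_def by blast
  obtain J' c' where J': "finite J'" "J' \<subseteq> bindex e f" "(\<lambda>x. \<psi> x - (\<Sum>i\<in>J'. c' i * basis i x)) \<in> W"
    using assms(2) unfolding spanned_def by blast
  define a where "a i = (if i \<in> J then c i else 0)" for i
  define a' where "a' i = (if i \<in> J' then c' i else 0)" for i
  have 1: "(\<Sum>i\<in>J \<union> J'. a i * basis i x) = (\<Sum>i\<in>J. c i * basis i x)" for x
    using J J' by (intro sum.mono_neutral_cong_right) (auto simp: a_def)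
  have 2: "(\<Sum>i\<in>J \<union> J'. a' i * basis i x) = (\<Sum>i\<in>J'. c' i * basis i x)" for x
    using J J' by (intro sum.mono_neutral_cong_right) (auto simp: a'_def)
  have "(\<lambda>x. (\<phi> x - (\<Sum>i\<in>J. c i * basis i x)) + (\<psi> x - (\<Sum>i\<in>J'. c' i * basis i x))) \<in> W"
    using J(3) J'(3) by (rule W_add)
  also have "(\<lambda>x. (\<phi> x - (\<Sum>i\<in>J. c i * basis i x)) + (\<psi> x - (\<Sum>i\<in>J'. c' i * basis i x)))
     = (\<lambda>x. (\<phi> x + \<psi> x) - (\<Sum>i\<in>J \<union> J'. (a i + a' i) * basis i x))"
    by (simp add: distrib_right sum.distrib 1 2 algebra_simps)
  finally show ?thesis unfolding spanned_def using J J' by (intro exI[of _ "J \<union> J'"] exI[of _ "\<lambda>i. a i + a' i"]) auto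
qed

lemma spanned_sum: "finite A \<Longrightarrow> (\<And>i. i \<in> A \<Longrightarrow> spanned (g i)) \<Longrightarrow> spanned (\<lambda>x. \<Sum>i\<in>A. g i x)"
  by (induction A rule: finite_induct) (auto intro: spanned_add spanned_W W_0)

lemma bel_ind: "i \<in> bindex e f \<Longrightarrow> basis i \<in> ind"
  using basis_inv inv_ind by blast

text \<open>Beta permutes the claimed basis by exchanging the two halves.\<close>

lemma spanned_bet_bel: assumes "i \<in> bindex e f" shows "spanned (\<lambda>x. a * act bet (basis i) x)"
  using assms
proof (cases rule: bindex_cases)
  case 1
  have "act bet (basis BId) = basis BBeta" by (simp add: act_brk)
  then show ?thesis using 1 spanned_bel[OF bindex_Id(2), of a] by simp
next
  case 2
  have "act bet (basis BBeta) = act bet (act bet (basis BId))" by (simp add: act_brk)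
  also have "\<dots> = basis BId" using bel_ind[OF bindex_Id(1)] by (rule bb)
  finally show ?thesis using 2 spanned_bel[OF bindex_Id(1), of a] by simp
next
  case (3 s t n l)
  have "act bet (basis i) = basis (bas_idx (\<not> s) t n l)" using 3 by (simp add: bel_bi bb)
  then show ?thesis using spanned_bel[OF bindex_bi[OF 3(1,3,4), of "\<not> s" t], of a] by simp
qed

lemma spanned_bet: assumes "spanned \<phi>" shows "spanned (act bet \<phi>)"
proof -
  obtain J c where J: "finite J" "J \<subseteq> bindex e f" "(\<lambda>x. \<phi> x - (\<Sum>i\<in>J. c i * basis i x)) \<in> W"
    using assms(1) unfolding spanned_def by blast
  have "spanned (\<lambda>x. act bet (\<lambda>x. \<phi> x - (\<Sum>i\<in>J. c i * basis i x)) x + (\<Sum>i\<in>J. c i * act bet (basis i) x))"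
    using J by (intro spanned_add spanned_sum spanned_W W_act spanned_bet_bel) auto
  then show ?thesis by (simp add: act_diff act_sum act_scale)
qed

section \<open>Lowering the level of an invariant vector\<close>

lemma H_tau_shift:
  assumes "N \<ge> 1" "inn 0 x" "u \<in> FF" "l < f"
  shows "H t N (x + \<pi> ^ (N - 1) * tc u) (tau t N (tau_exp t l)) = H t N x (tau t N (tau_exp t l)) + H_const t l * u ^ p ^ l"
  using assms by (simp add: H_tau dg_add frob distrib_left)

text \<open>Prepares the hypothesis of \<open>reduce\<close>: the additive increment of
  \<open>H\<close> is cancelled by a combination of the vectors \<open>tau\<close>. At level 1 and
  over Q_p, where the basis offers no such vector, the increment is 0 already.\<close>

lemma periodic_part:
  assumes phi: "invar \<phi>" "lev N \<phi>" and N: "N \<ge> 1"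
  obtains \<psi> where "invar \<psi>" "lev N \<psi>" "spanned (\<lambda>x. \<phi> x - \<psi> x)"
    "\<And>t' x. inn 0 x \<Longrightarrow> t' \<noteq> t \<Longrightarrow> co t' N x \<psi> = co t' N x \<phi>"
    "\<And>t' x. inn 0 x \<Longrightarrow> co t' N x (act bet \<psi>) = co t' N x (act bet \<phi>)"
    "\<And>x u. inn 0 x \<Longrightarrow> u \<in> FF \<Longrightarrow> H t N (x + \<pi> ^ (N - 1) * tc u) \<psi> = H t N x \<psi>"
proof -
  obtain \<delta> where add: "\<And>u w. u \<in> FF \<Longrightarrow> w \<in> FF \<Longrightarrow> \<delta> (u + w) = \<delta> u + \<delta> w"
    and sh: "\<And>x u. inn 0 x \<Longrightarrow> u \<in> FF \<Longrightarrow> H t N (x + \<pi> ^ (N - 1) * tc u) \<phi> = H t N x \<phi> + \<delta> u"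
    using H_additive[OF phi N, where t = t] by blast
  have self: "spanned (\<lambda>x. \<phi> x - \<phi> x)" by (simp add: spanned_W W_0)
  show thesis
  proof (cases "N = 1 \<or> (e = 1 \<and> f = 1)")
    case True
    have "\<delta> u = 0" if u: "u \<in> FF" for u
    proof (cases "N = 1")
      case True
      have "H t 1 (0 - (- tc u)) \<phi> = H t 1 0 \<phi>"
        by (rule H_level_1) (use phi True u in auto)
      then show ?thesis using sh[OF inn_0 u] True by simp
    next
      case False
      then show ?thesis using H_Qp[OF phi, where t = t and \<delta> = \<delta>] add sh u True N by simp
    qed
    then show ?thesis using that[OF phi self] sh by simp
  next
    case False
    then have nq: "\<not> (e = 1 \<and> f = 1)" and N2: "N \<ge> 2" using N by auto
    obtain d where d: "\<And>u. u \<in> FF \<Longrightarrow> \<delta> u = (\<Sum>l<f. d l * u ^ p ^ l)" using additive_poly[OF add] by blast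
    \<comment> \<open>Division by \<open>H_const\<close> normalizes each \<open>tau\<close>, so that
      \<open>H\<close> of \<open>T\<close> has the increment \<open>\<delta>\<close>.\<close>
    define T where "T = (\<lambda>x. \<Sum>l<f. d l / H_const t l * tau t N (tau_exp t l) x)"
    have T: "T \<in> ind" "lev N T" "invar T" "spanned T"
    proof -
      show "T \<in> ind" unfolding T_def by (intro ind_sum ind_scale tau_ind)
      show "lev N T" unfolding T_def by (intro lev_sum lev_scale lev_tau) (use N in auto)
      show "invar T" unfolding T_def by (intro inv_sum inv_scale tau_inv nq N2) simp
      have "spanned (\<lambda>x. d l / H_const t l * tau t N (tau_exp t l) x)" if "l < f" for l
        using spanned_bel[OF bindex_bi[OF nq N2 that, of False t], of "d l / H_const t l"] N by (simp add: bel_bi)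
      then show "spanned T" unfolding T_def by (intro spanned_sum) auto
    qed
    define \<psi> where "\<psi> = (\<lambda>x. \<phi> x - T x)"
    have coT: "co t' N x T = 0" if "inn 0 x" "t' \<noteq> t" for t' x
      unfolding T_def co_sum co_scale using that N by (simp add: co_tau)
    have coTb: "co t' N x (act bet T) = 0" if "inn 0 x" for t' x
      unfolding T_def act_sum act_scale co_sum co_scale using that N by (simp add: co_bet_tau)
    have HT: "H t N (x + \<pi> ^ (N - 1) * tc u) T = H t N x T + \<delta> u" if "inn 0 x" "u \<in> FF" for x u
    proof -
      have "H t N (x + \<pi> ^ (N - 1) * tc u) T = (\<Sum>l<f. d l / H_const t l * (H t N x (tau t N (tau_exp t l)) + H_const t l * u ^ p ^ l))"
        unfolding T_def H_sum H_scale using that N by (intro sum.cong refl) (simp add: H_tau_shift)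
      also have "\<dots> = H t N x T + (\<Sum>l<f. d l * u ^ p ^ l)"
        unfolding T_def H_sum H_scale sum.distrib[symmetric] by (intro sum.cong refl) (simp add: distrib_left H_const_nz)
      finally show ?thesis using d that by simp
    qed
    show ?thesis
    proof (rule that)
      show "invar \<psi>" unfolding \<psi>_def using phi(1) T(3) by (rule inv_diff)
      show "lev N \<psi>" unfolding \<psi>_def using phi(2) T(2) by (rule lev_diff)
      show "spanned (\<lambda>x. \<phi> x - \<psi> x)" using T(4) by (simp add: \<psi>_def)
    qed (use coT coTb HT sh in \<open>simp_all add: \<psi>_def co_diff act_diff H_diff\<close>)
  qed
qed

lemma one_step:
  assumes phi: "invar \<phi>" "lev N \<phi>" and N: "N \<ge> 1"
  obtains \<psi> where "invar \<psi>" "lev N \<psi>" "spanned (\<lambda>x. \<phi> x - \<psi> x)"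
    "\<And>x. inn 0 x \<Longrightarrow> co t N x \<psi> = 0"
    "\<And>x. inn 0 x \<Longrightarrow> co (\<not> t) N x \<psi> = co (\<not> t) N x \<phi>"
    "\<And>t' x. inn 0 x \<Longrightarrow> co t' N x (act bet \<psi>) = co t' N x (act bet \<phi>)"
proof -
  obtain \<psi> where P: "invar \<psi>" "lev N \<psi>" "spanned (\<lambda>x. \<phi> x - \<psi> x)"
    "\<And>t' x. inn 0 x \<Longrightarrow> t' \<noteq> t \<Longrightarrow> co t' N x \<psi> = co t' N x \<phi>"
    "\<And>t' x. inn 0 x \<Longrightarrow> co t' N x (act bet \<psi>) = co t' N x (act bet \<phi>)"
    "\<And>x u. inn 0 x \<Longrightarrow> u \<in> FF \<Longrightarrow> H t N (x + \<pi> ^ (N - 1) * tc u) \<psi> = H t N x \<psi>"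
    using periodic_part[OF phi N, where t = t] by blast
  note pi = inv_ind[OF P(1)]
  have hyp: "H t N x \<psi> = H t N y \<psi>" if "inn 0 x" "inn 0 y" "inn (int (N - 1)) (x - y)" for x y
    by (rule H_period[OF pi N P(6) that])
  obtain w where w: "w \<in> W" "\<And>x. inn 0 x \<Longrightarrow> co t N x w = co t N x \<psi>"
    "\<And>x. inn 0 x \<Longrightarrow> co (\<not> t) (N - 1) x w = - H t N x \<psi>"
    "\<And>t' n x. inn 0 x \<Longrightarrow> \<not> (t' = t \<and> n = N) \<Longrightarrow> \<not> (t' \<noteq> t \<and> n = N - 1) \<Longrightarrow> co t' n x w = 0"
    "\<And>t' n x. inn 0 x \<Longrightarrow> n \<ge> 1 \<Longrightarrow> co t' n x (act bet w) = 0"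
    using reduce[where t = t, OF pi N] hyp by blast
  define \<psi>' where "\<psi>' = (\<lambda>x. \<psi> x - w x)"
  have levw: "lev N w" unfolding lev_def
  proof (intro allI impI conjI)
    fix n t' x assume "N < n" "inn 0 x"
    then show "co t' n x w = 0" by (intro w(4)) auto
    show "co t' n x (act bet w) = 0" using \<open>N < n\<close> \<open>inn 0 x\<close> by (intro w(5)) auto
  qed
  show thesis
  proof (rule that)
    show "invar \<psi>'" unfolding \<psi>'_def using P(1) inv_W[OF w(1)] by (rule inv_diff)
    show "lev N \<psi>'" unfolding \<psi>'_def using P(2) levw by (rule lev_diff)
    show "spanned (\<lambda>x. \<phi> x - \<psi>' x)"
      using spanned_add[OF P(3) spanned_W[OF w(1)]] by (simp add: \<psi>'_def algebra_simps)
    fix x assume x: "inn 0 x"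
    show "co t N x \<psi>' = 0" using w(2)[OF x] by (simp add: \<psi>'_def co_diff)
    show "co (\<not> t) N x \<psi>' = co (\<not> t) N x \<phi>" using w(4)[OF x, of "\<not> t" N] P(4)[OF x, of "\<not> t"] N by (simp add: \<psi>'_def co_diff)
    show "co t' N x (act bet \<psi>') = co t' N x (act bet \<phi>)" for t'
      using w(5)[OF x N] P(5)[OF x] by (simp add: \<psi>'_def act_diff co_diff)
  qed
qed

text \<open>Clearing the coordinates of one type touches the other type only at level
  \<open>N - 1\<close>, so the two clearings do not disturb each other at level
  \<open>N\<close>.\<close>

lemma half_step:
  assumes phi: "invar \<phi>" "lev N \<phi>" and N: "N \<ge> 1"
  obtains \<psi> where "invar \<psi>" "lev N \<psi>" "spanned (\<lambda>x. \<phi> x - \<psi> x)"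
    "\<And>t' x. inn 0 x \<Longrightarrow> co t' N x \<psi> = 0"
    "\<And>t' x. inn 0 x \<Longrightarrow> co t' N x (act bet \<psi>) = co t' N x (act bet \<phi>)"
proof -
  obtain \<psi>1 where 1: "invar \<psi>1" "lev N \<psi>1" "spanned (\<lambda>x. \<phi> x - \<psi>1 x)"
    "\<And>x. inn 0 x \<Longrightarrow> co True N x \<psi>1 = 0"
    "\<And>x. inn 0 x \<Longrightarrow> co (\<not> True) N x \<psi>1 = co (\<not> True) N x \<phi>"
    "\<And>t' x. inn 0 x \<Longrightarrow> co t' N x (act bet \<psi>1) = co t' N x (act bet \<phi>)"
    using one_step[OF phi N, where t = True] by blast
  obtain \<psi> where 2: "invar \<psi>" "lev N \<psi>" "spanned (\<lambda>x. \<psi>1 x - \<psi> x)"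
    "\<And>x. inn 0 x \<Longrightarrow> co False N x \<psi> = 0"
    "\<And>x. inn 0 x \<Longrightarrow> co (\<not> False) N x \<psi> = co (\<not> False) N x \<psi>1"
    "\<And>t' x. inn 0 x \<Longrightarrow> co t' N x (act bet \<psi>) = co t' N x (act bet \<psi>1)"
    using one_step[OF 1(1,2) N, where t = False] by blast
  have "spanned (\<lambda>x. \<phi> x - \<psi> x)" using spanned_add[OF 1(3) 2(3)] by simp
  moreover have "co t' N x \<psi> = 0" if "inn 0 x" for t' x
    using 2(4,5)[OF that] 1(4)[OF that] by (cases t') auto
  ultimately show thesis using that[OF 2(1,2)] 1(6) 2(6) by simp
qed

text \<open>The second half of the tree is cleared after applying \<open>bet\<close>. This does not
  spoil the first half, since the corrections have no coordinates there at the positive level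
  \<open>Suc N\<close>.\<close>

lemma level_step:
  assumes phi: "invar \<phi>" "lev (Suc N) \<phi>"
  obtains \<psi> where "invar \<psi>" "lev N \<psi>" "spanned (\<lambda>x. \<phi> x - \<psi> x)"
proof -
  have S: "Suc N \<ge> 1" by simp
  obtain \<psi>1 where 1: "invar \<psi>1" "lev (Suc N) \<psi>1" "spanned (\<lambda>x. \<phi> x - \<psi>1 x)"
    "\<And>t' x. inn 0 x \<Longrightarrow> co t' (Suc N) x \<psi>1 = 0"
    "\<And>t' x. inn 0 x \<Longrightarrow> co t' (Suc N) x (act bet \<psi>1) = co t' (Suc N) x (act bet \<phi>)"
    using half_step[OF phi S] by blast
  note p1 = inv_ind[OF 1(1)]
  obtain \<psi> where 2: "invar \<psi>" "lev (Suc N) \<psi>" "spanned (\<lambda>x. act bet \<psi>1 x - \<psi> x)"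
    "\<And>t' x. inn 0 x \<Longrightarrow> co t' (Suc N) x \<psi> = 0"
    "\<And>t' x. inn 0 x \<Longrightarrow> co t' (Suc N) x (act bet \<psi>) = co t' (Suc N) x (act bet (act bet \<psi>1))"
    using half_step[OF inv_bet[OF 1(1)] lev_bet[OF p1 1(2)] S] by blast
  note p2 = inv_ind[OF 2(1)]
  have "lev N \<psi>" unfolding lev_def
  proof (intro allI impI)
    fix n t' x assume n: "N < n" and x: "inn 0 x"
    show "co t' n x \<psi> = 0 \<and> co t' n x (act bet \<psi>) = 0"
    proof (cases "n = Suc N")
      case True
      then show ?thesis using 2(4,5)[OF x] 1(4)[OF x] bb[OF p1] by simp
    next
      case False
      then show ?thesis using levD[OF 2(2) _ x, of n] n by simp
    qed
  qed
  then have L: "lev N (act bet \<psi>)" by (rule lev_bet[OF p2])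
  have "spanned (\<lambda>x. \<psi>1 x - act bet \<psi> x)"
    using spanned_bet[OF 2(3)] by (simp add: act_diff bb[OF p1])
  then have "spanned (\<lambda>x. \<phi> x - act bet \<psi> x)" using spanned_add[OF 1(3)] by fastforce
  then show thesis using that[OF inv_bet[OF 2(1)] L] by blast
qed

lemma level_0_span:
  assumes "\<phi> \<in> ind" "lev 0 \<phi>" shows "spanned \<phi>"
proof -
  define \<psi> where "\<psi> = (\<lambda>x. co False 0 0 \<phi> * basis BId x + co True 0 0 \<phi> * basis BBeta x)"
  have pi: "\<psi> \<in> ind" unfolding \<psi>_def by (intro ind_add ind_scale bel_ind bindex_Id)
  have c: "co t n x \<phi> = co t n x \<psi>" if x: "inn 0 x" for t n x
  proof (cases "n = 0")
    case True
    then show ?thesis using co_cong[OF assms(1), of 0 x 0 t] x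
      by (cases t) (simp_all add: \<psi>_def co_add co_scale bel_Id co_E del: belem.simps)
  next
    case False
    then show ?thesis using levD(1)[OF assms(2) _ x, of n] x
      by (simp add: \<psi>_def co_add co_scale bel_Id co_E del: belem.simps)
  qed
  have "\<phi> = \<psi>"
  proof (rule ind_eqI[OF assms(1) pi c])
    fix t n x assume x: "inn 0 x"
    show "co t n x (act bet \<phi>) = co t n x (act bet \<psi>)"
    proof (cases "n = 0")
      case True
      then show ?thesis using co_bet_0[OF assms(1) x x] co_bet_0[OF pi x x] c[OF x] by simp
    next
      case False
      then show ?thesis using levD(2)[OF assms(2) _ x, of n] x
        by (simp add: \<psi>_def act_add act_scale co_add co_scale bel_Id co_bE del: belem.simps)
    qed
  qed
  moreover have "spanned \<psi>" unfolding \<psi>_def by (intro spanned_add spanned_bel bindex_Id)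
  ultimately show ?thesis by simp
qed

lemma spanning: assumes "invar \<phi>" shows "spanned \<phi>"
proof -
  have "lev N \<phi> \<Longrightarrow> invar \<phi> \<Longrightarrow> spanned \<phi>" for N \<phi>
  proof (induction N arbitrary: \<phi>)
    case 0
    then show ?case using level_0_span inv_ind by blast
  next
    case (Suc N)
    obtain \<psi> where "invar \<psi>" "lev N \<psi>" "spanned (\<lambda>x. \<phi> x - \<psi> x)" using level_step[OF Suc.prems(2,1)] by blast
    then show ?case using spanned_add[of "\<lambda>x. \<phi> x - \<psi> x" \<psi>] Suc.IH by simp
  qed
  then show ?thesis using lev_exists[OF inv_ind[OF assms]] assms by blast
qed

section \<open>Linear independence\<close>

fun blev :: "bidx \<Rightarrow> nat" where
  "blev BId = 0" | "blev BBeta = 0" | "blev (BS n l) = n" | "blev (BBS n l) = n" | "blev (BT n l) = n" | "blev (BBT n l) = n"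

lemma blev_bi [simp]: "blev (bas_idx s t n l) = n"
  by (simp add: bas_idx_def)

lemma bas_idx_inj [simp]: "bas_idx s t n l = bas_idx s' t' n' l' \<longleftrightarrow> s = s' \<and> t = t' \<and> n = n' \<and> l = l'"
  by (auto simp: bas_idx_def)

lemma bas_idx_neq [simp]: "BId \<noteq> bas_idx s t n l" "BBeta \<noteq> bas_idx s t n l"
  by (auto simp: bas_idx_def)

lemma lev_bel: assumes "i \<in> bindex e f" "blev i \<le> N" shows "lev N (basis i)"
  using assms(1)
proof (cases rule: bindex_cases)
  case (3 s t n l)
  then have "lev N (tau t n (tau_exp t l))" using assms(2) by (intro lev_tau) auto
  then show ?thesis using 3 lev_bet by (simp add: bel_bi)
qed (simp_all add: bel_Id lev_E del: belem.simps)

text \<open>Only basis vectors of the right half, type and level contribute; the conditional sum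
  over \<open>l\<close> can later be exchanged with the sum over the index set.\<close>

lemma H_bel:
  assumes i: "i \<in> bindex e f" and N: "N \<ge> 1" and x: "inn 0 x"
  shows "H t N x (basis i) = (\<Sum>l<f. if i = bas_idx False t N l then H_const t l * dg (N - 1) x ^ p ^ l else 0)"
    and "H t N x (act bet (basis i)) = (\<Sum>l<f. if i = bas_idx True t N l then H_const t l * dg (N - 1) x ^ p ^ l else 0)"
proof -
  have E0: "H t N x (E t' 0 0) = 0" "H t N x (act bet (E t' 0 0)) = 0" for t'
    using N x by (auto intro!: H_0 simp: co_E co_bE)
  have T: "H t N x (tau t' n (tau_exp t' l)) = (if t' = t \<and> n = N then H_const t l * dg (N - 1) x ^ p ^ l else 0)"
    if "n \<ge> 2" "l < f" for t' n l
  proof (cases "t' = t \<and> n = N")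
    case True
    then show ?thesis using that x N by (simp add: H_tau)
  next
    case False
    then have "H t N x (tau t' n (tau_exp t' l)) = 0" using that x by (intro H_0) (auto simp: co_tau)
    then show ?thesis using False by auto
  qed
  have Tb: "H t N x (act bet (tau t' n (tau_exp t' l))) = 0" if "n \<ge> 2" for t' n l
    using that x by (intro H_0) (auto simp: co_bet_tau)
  have S: "(\<Sum>m<f. if l = m \<and> P then g m else 0) = (if P then g l else 0)" if "l < f" for l P and g :: "nat \<Rightarrow> 'k"
    using that by (cases P) auto
  show "H t N x (basis i) = (\<Sum>l<f. if i = bas_idx False t N l then H_const t l * dg (N - 1) x ^ p ^ l else 0)"
    using i
  proof (cases rule: bindex_cases)
    case (3 s t' n l)
    then show ?thesis
      using S[OF 3(4), of "\<not> s \<and> t' = t \<and> n = N" "\<lambda>l. H_const t l * dg (N - 1) x ^ p ^ l"]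
      by (cases s) (auto simp: bel_bi T Tb conj_ac)
  qed (simp_all add: bel_Id E0 del: belem.simps)
  show "H t N x (act bet (basis i)) = (\<Sum>l<f. if i = bas_idx True t N l then H_const t l * dg (N - 1) x ^ p ^ l else 0)"
    using i
  proof (cases rule: bindex_cases)
    case (3 s t' n l)
    then show ?thesis
      using S[OF 3(4), of "s \<and> t' = t \<and> n = N" "\<lambda>l. H_const t l * dg (N - 1) x ^ p ^ l"]
      by (cases s) (auto simp: bel_bi bb T Tb conj_ac)
  qed (simp_all add: bel_Id E0 del: belem.simps)
qed

text \<open>Periodicity makes \<open>h\<close> independent of the digit at place
  \<open>N - 1\<close>, so a combination of Frobenius powers of that digit vanishes on
  \<open>FF\<close>, and \<open>frob_indep\<close> applies.\<close>

lemma top_coefficients: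
  assumes J: "finite J" "J \<subseteq> bindex e f" and N: "N \<ge> 1"
    and per: "\<And>x y. inn 0 x \<Longrightarrow> inn 0 y \<Longrightarrow> inn (int (N - 1)) (x - y) \<Longrightarrow> h x = h y"
    and h: "\<And>x. inn 0 x \<Longrightarrow> h x = (\<Sum>i\<in>J. c i * (\<Sum>l<f. if i = bas_idx s t N l then H_const t l * dg (N - 1) x ^ p ^ l else 0))"
    and il: "bas_idx s t N l \<in> J" "l < f"
  shows "c (bas_idx s t N l) = 0"
proof -
  define d where "d l = (if bas_idx s t N l \<in> J then c (bas_idx s t N l) * H_const t l else 0)" for l
  have hd: "h x = (\<Sum>l<f. d l * dg (N - 1) x ^ p ^ l)" if x: "inn 0 x" for x
  proof -
    have "h x = (\<Sum>i\<in>J. \<Sum>l<f. if i = bas_idx s t N l then c i * (H_const t l * dg (N - 1) x ^ p ^ l) else 0)"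
      unfolding h[OF x] sum_distrib_left by (intro sum.cong refl) simp
    also have "\<dots> = (\<Sum>l<f. \<Sum>i\<in>J. if i = bas_idx s t N l then c i * (H_const t l * dg (N - 1) x ^ p ^ l) else 0)" by (rule sum.swap)
    also have "\<dots> = (\<Sum>l<f. d l * dg (N - 1) x ^ p ^ l)"
      using J(1) by (intro sum.cong refl) (simp add: d_def)
    finally show ?thesis .
  qed
  have dg0: "dg (N - 1) 0 = 0" using dg_ds_add[of "N - 1" "\<lambda>_. 0" 0] by (simp add: dsum_def)
  have z0: "(0::'k) ^ p ^ l = 0" for l by (simp add: zero_power)
  have "(\<Sum>l<f. d l * u ^ p ^ l) = 0" if u: "u \<in> FF" for u
  proof -
    let ?x = "0 + \<pi> ^ (N - 1) * tc u"
    have x: "inn 0 ?x" using u by (intro inn_shift) auto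
    have "dg (N - 1) ?x = u" using dg_add[OF inn_0 tc_inn[OF u], of "N - 1"] u dg0 by simp
    then have "(\<Sum>l<f. d l * u ^ p ^ l) = h ?x" using hd[OF x] by simp
    also have "\<dots> = h 0" using x u by (intro per) auto
    also have "\<dots> = 0" using hd[OF inn_0] dg0 z0 by simp
    finally show ?thesis .
  qed
  from frob_indep[OF this il(2)] have "d l = 0" .
  then show ?thesis using il H_const_nz by (simp add: d_def)
qed

text \<open>Induction on the highest level: \<open>W_top\<close> on both halves kills the
  coefficients there, and \<open>W_level_0\<close> separates the two vectors of level 0.\<close>

lemma independent:
  assumes "finite J" "J \<subseteq> bindex e f" "\<And>i. i \<in> J \<Longrightarrow> blev i \<le> N" "(\<lambda>x. \<Sum>i\<in>J. c i * basis i x) \<in> W"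
  shows "\<forall>i\<in>J. c i = 0"
  using assms
proof (induction N arbitrary: J)
  case 0
  let ?\<psi> = "\<lambda>x. \<Sum>i\<in>J. c i * basis i x"
  have sub: "J \<subseteq> {BId, BBeta}"
  proof
    fix i assume i: "i \<in> J"
    then have "i \<in> bindex e f" "blev i = 0" using 0 by auto
    then show "i \<in> {BId, BBeta}" by (cases rule: bindex_cases) auto
  qed
  have L: "lev 0 ?\<psi>" using 0 by (intro lev_sum lev_scale lev_bel) auto
  have co: "co t 0 0 ?\<psi> = 0" for t by (rule W_level_0[OF 0(4) L]) simp
  have b: "co t 0 0 (basis BId) = (if t then 0 else 1)" "co t 0 0 (basis BBeta) = (if t then 1 else 0)" for t
    by (auto simp: bel_Id co_E simp del: belem.simps)
  have s: "co t 0 0 ?\<psi> = (if BId \<in> J \<and> \<not> t then c BId else 0) + (if BBeta \<in> J \<and> t then c BBeta else 0)" for t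
  proof -
    have "co t 0 0 ?\<psi> = (\<Sum>i\<in>{BId, BBeta}. if i \<in> J then c i * co t 0 0 (basis i) else 0)"
      unfolding co_sum co_scale using sub by (intro sum.mono_neutral_cong_left) auto
    then show ?thesis by (simp add: b del: belem.simps)
  qed
  show ?case using sub co[of True] co[of False] s[of True] s[of False] by auto
next
  case (Suc N)
  let ?\<psi> = "\<lambda>x. \<Sum>i\<in>J. c i * basis i x"
  have L: "lev (Suc N) ?\<psi>" using Suc.prems by (intro lev_sum lev_scale lev_bel) auto
  have pi: "?\<psi> \<in> ind" using W_ind[OF Suc.prems(4)] .
  have top: "c i = 0" if i: "i \<in> J" "blev i = Suc N" for i
  proof -
    have "i \<in> bindex e f" using i Suc.prems by auto
    then show ?thesis
    proof (cases rule: bindex_cases)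
      case (3 s t n l)
      then have n: "n = Suc N" using i by simp
      show ?thesis
      proof (cases s)
        case True
        have "c (bas_idx True t (Suc N) l) = 0"
        proof (rule top_coefficients[OF Suc.prems(1,2)])
          show "H t (Suc N) x (act bet ?\<psi>) = H t (Suc N) y (act bet ?\<psi>)"
            if "inn 0 x" "inn 0 y" "inn (int (Suc N - 1)) (x - y)" for x y
            using W_top[OF W_act[OF Suc.prems(4) bet_GL2] lev_bet[OF pi L] _ that] by simp
          show "H t (Suc N) x (act bet ?\<psi>) = (\<Sum>i\<in>J. c i * (\<Sum>l<f. if i = bas_idx True t (Suc N) l then H_const t l * dg (Suc N - 1) x ^ p ^ l else 0))"
            if x: "inn 0 x" for x
            unfolding act_sum act_scale H_sum H_scale using Suc.prems(2) x
            by (intro sum.cong refl arg_cong2[where f = "(*)"] H_bel(2)) auto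
        qed (use i 3 n True in auto)
        then show ?thesis using 3 n True by simp
      next
        case False
        have "c (bas_idx False t (Suc N) l) = 0"
        proof (rule top_coefficients[OF Suc.prems(1,2)])
          show "H t (Suc N) x ?\<psi> = H t (Suc N) y ?\<psi>"
            if "inn 0 x" "inn 0 y" "inn (int (Suc N - 1)) (x - y)" for x y
            using W_top[OF Suc.prems(4) L _ that] by simp
          show "H t (Suc N) x ?\<psi> = (\<Sum>i\<in>J. c i * (\<Sum>l<f. if i = bas_idx False t (Suc N) l then H_const t l * dg (Suc N - 1) x ^ p ^ l else 0))"
            if x: "inn 0 x" for x
            unfolding H_sum H_scale using Suc.prems(2) x
            by (intro sum.cong refl arg_cong2[where f = "(*)"] H_bel(1)) auto
        qed (use i 3 n False in auto)
        then show ?thesis using 3 n False by simp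
      qed
    qed (use i in auto)
  qed
  define J' where "J' = {i \<in> J. blev i \<le> N}"
  have "(\<Sum>i\<in>J. c i * basis i x) = (\<Sum>i\<in>J'. c i * basis i x)" for x
    using Suc.prems(1,3) top unfolding J'_def
    by (intro sum.mono_neutral_right) (auto simp: le_Suc_eq)
  then have "(\<lambda>x. \<Sum>i\<in>J'. c i * basis i x) \<in> W" using Suc.prems(4) by simp
  then have "\<forall>i\<in>J'. c i = 0" using Suc.prems(1,2) by (intro Suc.IH) (auto simp: J'_def)
  then show ?case using top Suc.prems(3) unfolding J'_def by (auto simp: le_Suc_eq)
qed

lemma blev_bounded: "finite J \<Longrightarrow> \<exists>N. \<forall>i\<in>J. blev i \<le> N"
  by (rule exI[of _ "Max (insert 0 (blev ` J))"]) auto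

end

theorem theorem1p4:
  fixes v :: "'f::field \<Rightarrow> int" and red :: "'f \<Rightarrow> 'k::field" and \<pi> :: 'f
    and p e f r :: nat
  assumes data: "padic_data v red \<pi> p e f"
    and r_pos: "0 < r" and r_lt: "r < p ^ f - 1"
    and digits: "\<forall>j<f. 0 < r div p ^ j mod p \<and> r div p ^ j mod p < p - 1"
    and f1: "f = 1 \<longrightarrow> 2 < r \<and> r < p - 3"
  shows
    "(\<forall>i\<in>bindex e f. inv_mod v red \<pi> r (p ^ f) (belem v red \<pi> r p (p ^ f) i)) \<and>
     (\<forall>J c. finite J \<longrightarrow> J \<subseteq> bindex e f \<longrightarrow>
        (\<lambda>x. \<Sum>i\<in>J. c i * belem v red \<pi> r p (p ^ f) i x) \<in> Wsub v red \<pi> r (p ^ f) \<longrightarrow>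
        (\<forall>i\<in>J. c i = 0)) \<and>
     (\<forall>\<phi>. inv_mod v red \<pi> r (p ^ f) \<phi> \<longrightarrow>
        (\<exists>J c. finite J \<and> J \<subseteq> bindex e f \<and>
           (\<lambda>x. \<phi> x - (\<Sum>i\<in>J. c i * belem v red \<pi> r p (p ^ f) i x)) \<in> Wsub v red \<pi> r (p ^ f)))"
proof -
  interpret padic v red \<pi> p e f r
    using assms by unfold_locales
  have inv: "\<forall>i\<in>bindex e f. invar (basis i)"
    using basis_inv by blast
  have indep: "\<forall>i\<in>J. c i = 0"
    if "finite J" "J \<subseteq> bindex e f" "(\<lambda>x. \<Sum>i\<in>J. c i * basis i x) \<in> W" for J c
    using independent[OF that(1,2) _ that(3)] blev_bounded[OF that(1)] by blast
  have span: "\<exists>J c. finite J \<and> J \<subseteq> bindex e f \<and> (\<lambda>x. \<phi> x - (\<Sum>i\<in>J. c i * basis i x)) \<in> W"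
    if "invar \<phi>" for \<phi>
    using spanning[OF that] unfolding spanned_def .
  show ?thesis using inv indep span by blast
qed

end
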